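(* Let $k$ be a field, $P$ a finite poset which is Cohen–Macaulay over $k$, and $Q$ a poset ideal of $P$. Suppose that $\tilde\chi((-\infty,x)_P)=0$ for every $x\in(P\cup\{\infty\})\setminus Q$. Then $P\uplus Q$ is Cohen–Macaulay over $k$.
   Context: A poset ideal $Q$ of $P$ is a subset with $x\in Q$, $y<x$ implying $y\in Q$. $-\infty,\infty$ are new elements smaller/larger than everything; $(x,y)_P=\{z\in P: x<z<y\}$, so $(-\infty,\infty)_P=P$. The order complex $\Delta(P)$ is the simplicial complex of chains of $P$; $\tilde\chi(P)=\tilde\chi(\Delta(P))=\sum_{\sigma\in\Delta(P)}(-1)^{|\sigma|-1}$ (the empty chain included). $P$ is Cohen–Macaulay over $k$ if the Stanley–Reisner ring $k[\Delta(P)]$ is Cohen–Macaulay. The poset $P\uplus Q$ has underlying set $P\cup Q^\ast$, where $Q^\ast=\{x^\ast:x\in Q\}$ is a disjoint copy of $Q$, and $\alpha<\beta$ iff either $\alpha,\beta\in P$ and $\alpha<\beta$ in $P$; or $\alpha=x^\ast,\beta=y^\ast$ with $x<y$ in $P$; or $\alpha=x^\ast$ with $x\in Q$, $\beta\in P$ and $x\le\beta$ in $P$. *)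

theory Defs
  imports Main "HOL-Library.Poly_Mapping" "HOL-Library.Extended_Nat"
begin

definition is_ideal :: "'r::comm_ring_1 set \<Rightarrow> bool" where
  "is_ideal I \<longleftrightarrow> 0 \<in> I \<and> (\<forall>a\<in>I. \<forall>b\<in>I. a + b \<in> I) \<and> (\<forall>r. \<forall>a\<in>I. r * a \<in> I)"

definition gen_ideal :: "'r::comm_ring_1 set \<Rightarrow> 'r set" where
  "gen_ideal A = \<Inter>{I. is_ideal I \<and> A \<subseteq> I}"

definition is_prime_ideal :: "'r::comm_ring_1 set \<Rightarrow> bool" where
  "is_prime_ideal P \<longleftrightarrow> is_ideal P \<and> P \<noteq> UNIV \<and> (\<forall>a b. a * b \<in> P \<longrightarrow> a \<in> P \<or> b \<in> P)"

definition krull_dim_quot :: "'r::comm_ring_1 set \<Rightarrow> enat" where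
  "krull_dim_quot I = Sup {enat n | n. \<exists>p :: nat \<Rightarrow> 'r set.
      (\<forall>i\<le>n. is_prime_ideal (p i) \<and> I \<subseteq> p i) \<and> (\<forall>i<n. p i \<subset> p (Suc i))}"

text \<open>f_0, ..., f_{n-1} (elements of R, taken modulo I) form an (R/I)-regular
  sequence in the ideal m (a proper ideal of R containing I).\<close>
definition regular_seq_quot :: "'r::comm_ring_1 set \<Rightarrow> 'r set \<Rightarrow> nat \<Rightarrow> (nat \<Rightarrow> 'r) \<Rightarrow> bool" where
  "regular_seq_quot I m n f \<longleftrightarrow>
     (\<forall>i<n. f i \<in> m) \<and>
     (\<forall>i<n. \<forall>g. f i * g \<in> gen_ideal (I \<union> f ` {..<i}) \<longrightarrow> g \<in> gen_ideal (I \<union> f ` {..<i})) \<and>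
     gen_ideal (I \<union> f ` {..<n}) \<noteq> UNIV"

definition depth_quot :: "'r::comm_ring_1 set \<Rightarrow> 'r set \<Rightarrow> enat" where
  "depth_quot I m = Sup {enat n | n. \<exists>f. regular_seq_quot I m n f}"

type_synonym ('v, 'k) mpoly = "('v \<Rightarrow>\<^sub>0 nat) \<Rightarrow>\<^sub>0 'k"

definition pvar :: "'v \<Rightarrow> ('v, 'k::field) mpoly" where
  "pvar v = Poly_Mapping.single (Poly_Mapping.single v 1) 1"

text \<open>Simplicial complex on vertex set V given as a set of faces; the
  Stanley--Reisner ideal is generated by the squarefree monomials x^F of the
  non-faces F.  We work in the polynomial ring with one variable for every
  element of the type 'v; non-faces include the singletons {v}, v not in V, so
  the quotient is canonically isomorphic to k[x_v : v in V]/I_Delta.\<close>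
definition SR_ideal :: "'v set set \<Rightarrow> ('v, 'k::field) mpoly set" where
  "SR_ideal \<Delta> = gen_ideal {(\<Prod>v\<in>F. pvar v) | F. finite F \<and> F \<notin> \<Delta>}"

definition var_ideal :: "('v, 'k::field) mpoly set" where
  "var_ideal = gen_ideal (range pvar)"

text \<open>The graded k-algebra k[Delta] is Cohen--Macaulay iff depth = Krull dimension
  (depth with respect to the homogeneous maximal ideal).\<close>
definition SR_cohen_macaulay :: "'k::field itself \<Rightarrow> 'v set set \<Rightarrow> bool" where
  "SR_cohen_macaulay TYPE('k) \<Delta> \<longleftrightarrow>
     depth_quot (SR_ideal \<Delta> :: ('v,'k) mpoly set) var_ideal
       = krull_dim_quot (SR_ideal \<Delta> :: ('v,'k) mpoly set)"

definition partial_order_on' :: "'a set \<Rightarrow> ('a \<Rightarrow> 'a \<Rightarrow> bool) \<Rightarrow> bool" where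
  "partial_order_on' P le \<longleftrightarrow>
     (\<forall>x\<in>P. le x x) \<and>
     (\<forall>x\<in>P. \<forall>y\<in>P. le x y \<and> le y x \<longrightarrow> x = y) \<and>
     (\<forall>x\<in>P. \<forall>y\<in>P. \<forall>z\<in>P. le x y \<and> le y z \<longrightarrow> le x z)"

definition strict :: "('a \<Rightarrow> 'a \<Rightarrow> bool) \<Rightarrow> 'a \<Rightarrow> 'a \<Rightarrow> bool" where
  "strict le x y \<longleftrightarrow> le x y \<and> x \<noteq> y"

definition order_complex :: "'a set \<Rightarrow> ('a \<Rightarrow> 'a \<Rightarrow> bool) \<Rightarrow> 'a set set" where
  "order_complex P le = {F. F \<subseteq> P \<and> finite F \<and> (\<forall>x\<in>F. \<forall>y\<in>F. le x y \<or> le y x)}"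

definition cohen_macaulay_poset :: "'k::field itself \<Rightarrow> 'a set \<Rightarrow> ('a \<Rightarrow> 'a \<Rightarrow> bool) \<Rightarrow> bool" where
  "cohen_macaulay_poset TYPE('k) P le \<longleftrightarrow> SR_cohen_macaulay TYPE('k) (order_complex P le)"

definition red_euler_char :: "'a set \<Rightarrow> ('a \<Rightarrow> 'a \<Rightarrow> bool) \<Rightarrow> int" where
  "red_euler_char P le = (\<Sum>\<sigma>\<in>order_complex P le. - ((-1) ^ card \<sigma>))"

definition below :: "'a set \<Rightarrow> ('a \<Rightarrow> 'a \<Rightarrow> bool) \<Rightarrow> 'a \<Rightarrow> 'a set" where
  "below P le x = {z\<in>P. strict le z x}"

definition poset_ideal :: "'a set \<Rightarrow> ('a \<Rightarrow> 'a \<Rightarrow> bool) \<Rightarrow> 'a set \<Rightarrow> bool" where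
  "poset_ideal P le Q \<longleftrightarrow> Q \<subseteq> P \<and> (\<forall>x\<in>Q. \<forall>y\<in>P. strict le y x \<longrightarrow> y \<in> Q)"

section \<open>The poset P \<uplus> Q on P \<union> Q*, with Inl x = x and Inr x = x*\<close>

definition uplus_carrier :: "'a set \<Rightarrow> 'a set \<Rightarrow> ('a + 'a) set" where
  "uplus_carrier P Q = Inl ` P \<union> Inr ` Q"

fun uplus_less :: "('a \<Rightarrow> 'a \<Rightarrow> bool) \<Rightarrow> 'a set \<Rightarrow> 'a + 'a \<Rightarrow> 'a + 'a \<Rightarrow> bool" where
  "uplus_less le Q (Inl x) (Inl y) = strict le x y"
| "uplus_less le Q (Inr x) (Inr y) = strict le x y"
| "uplus_less le Q (Inr x) (Inl y) = (x \<in> Q \<and> le x y)"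
| "uplus_less le Q (Inl x) (Inr y) = False"

definition uplus_le :: "('a \<Rightarrow> 'a \<Rightarrow> bool) \<Rightarrow> 'a set \<Rightarrow> 'a + 'a \<Rightarrow> 'a + 'a \<Rightarrow> bool" where
  "uplus_le le Q a b \<longleftrightarrow> a = b \<or> uplus_less le Q a b"

end

theory Submission
  imports Defs "HOL-Library.FuncSet"
begin

text \<open>
  A regular sequence of length \<open>d\<close> on \<open>k[\<Delta>]\<close> makes the Koszul complex of the variables exact in degrees
  below \<open>d\<close>. In the multidegrees \<open>-1\<^sub>U\<close> this complex is the cochain complex of \<open>\<Delta>\<close> with the vertices \<open>U\<close> deleted,
  and from these deletions one obtains the vanishing below the top degree of the cohomology of all
  links of \<open>\<Delta>\<close>. Conversely, if the vertices of a complex are coloured by \<open>n\<close> colours that are distinct on each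
  face, as those of an order complex are by rank, and the cohomology of the links vanishes below
  degree \<open>n\<close>, then the sums of the variables of one colour form a regular sequence of length \<open>n\<close>.

  For the order complex of \<open>P\<close> the hypothesis on the Euler characteristics makes the link of a chain of \<open>P - Q\<close>
  acyclic also in the top degree. Faces of \<open>P \<uplus> Q\<close> containing a given one are paired by adding or removing the
  unstarred copy of their largest starred element, or the starred copy of their smallest unstarred one.
  What is left over is a complex of chains of \<open>P\<close>, either acyclic or shifted by one degree, so
  that the links of \<open>P \<uplus> Q\<close> satisfy the vanishing condition in one dimension more than those of \<open>P\<close>.
\<close>

section \<open>Cochain complexes of families of finite sets\<close>

text \<open>This amounts to Reisner's criterion, proved from scratch in both directions. Depth is
  defined by arbitrary regular sequences in \<open>var_ideal\<close>, not by homogeneous ones; the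
  Koszul complex copes with this, because it only needs each member to be a combination of the
  variables. Over a finite \<open>k\<close> generic linear parameters may be missing; colour sums
  are explicit and have coefficients 0 and 1.

  Links are never formed. A link is replaced by the family of faces containing a given face, with
  degrees counted by cardinality, so that links, deletions and differences of them are families of
  sets in one complex, and long exact sequences come from splitting such a family in two.

  The Euler characteristic decides acyclicity because the cohomology of a link of \<open>P\<close>
  sits in the top degree only, where its dimension is the Euler characteristic up to sign. The
  hypothesis forces all minimal elements of \<open>P\<close> into \<open>Q\<close>: below them is
  the empty poset, whose reduced Euler characteristic is -1.

  At the end depth and dimension need not be computed separately: depth never exceeds dimension, so
  it suffices that \<open>Suc height\<close> bounds the depth from below and the dimension from
  above.\<close>

definition osgn :: "('v \<Rightarrow> nat) \<Rightarrow> 'v \<Rightarrow> 'v set \<Rightarrow> 'r::comm_ring_1" where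
  "osgn \<nu> v G = (-1) ^ card {w \<in> G. \<nu> w < \<nu> v}"

text \<open>The weights \<open>x\<close> let one formula serve two complexes:
  \<open>x = (\<lambda>_. 1)\<close> gives the simplicial coboundary, relative to \<open>X\<close>,
  and \<open>x = pvar\<close> with \<open>X = Pow V\<close> gives the Koszul complex of the
  variables. Values of \<open>c\<close> outside \<open>X\<close> are ignored.\<close>

definition cob :: "('v \<Rightarrow> nat) \<Rightarrow> ('v \<Rightarrow> 'r::comm_ring_1) \<Rightarrow> 'v set set \<Rightarrow> ('v set \<Rightarrow> 'r) \<Rightarrow> 'v set \<Rightarrow> 'r" where
  "cob \<nu> x X c G = (\<Sum>v | v \<in> G \<and> G - {v} \<in> X. osgn \<nu> v G * x v * c (G - {v}))"

text \<open>Injectivity is required on each member only, so that a rank function or a colouring,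
  which repeats values on incomparable elements, may serve as the vertex order.\<close>

definition oriented :: "('v \<Rightarrow> nat) \<Rightarrow> 'v set set \<Rightarrow> bool" where
  "oriented \<nu> X \<longleftrightarrow> (\<forall>G\<in>X. finite G \<and> inj_on \<nu> G)"

text \<open>These are the differences of two simplicial complexes, that is, the families whose
  cochains form a relative cochain complex.\<close>

definition convex_family :: "'v set set \<Rightarrow> bool" where
  "convex_family X \<longleftrightarrow> (\<forall>A\<in>X. \<forall>C\<in>X. \<forall>B. A \<subseteq> B \<and> B \<subseteq> C \<longrightarrow> B \<in> X)"

lemma convex_familyD: "convex_family X \<Longrightarrow> A \<in> X \<Longrightarrow> C \<in> X \<Longrightarrow> A \<subseteq> B \<Longrightarrow> B \<subseteq> C \<Longrightarrow> B \<in> X"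
  unfolding convex_family_def by blast

lemma osgn_sq [simp]: "osgn \<nu> v G * osgn \<nu> v G = 1"
  by (simp add: osgn_def flip: power_mult_distrib)

lemma osgn_sq_left [simp]: "osgn \<nu> v G * (osgn \<nu> v G * a) = a"
  by (simp flip: mult.assoc)

lemma osgn_remove_above:
  assumes "\<nu> u \<le> \<nu> v" shows "osgn \<nu> u (G - {v}) = osgn \<nu> u G"
proof -
  have "{w \<in> G - {v}. \<nu> w < \<nu> u} = {w \<in> G. \<nu> w < \<nu> u}" using assms by auto
  then show ?thesis by (simp add: osgn_def)
qed

lemma osgn_remove_below:
  assumes "finite G" "u \<in> G" "\<nu> u < \<nu> v" shows "osgn \<nu> v (G - {u}) = - osgn \<nu> v G"
proof -
  have "{w \<in> G. \<nu> w < \<nu> v} = insert u {w \<in> G - {u}. \<nu> w < \<nu> v}" using assms by auto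
  then have "card {w \<in> G. \<nu> w < \<nu> v} = Suc (card {w \<in> G - {u}. \<nu> w < \<nu> v})"
    using assms(1) by (simp add: card_insert_if)
  then show ?thesis by (simp add: osgn_def)
qed

lemma osgn_swap:
  assumes "finite G" "u \<in> G" "v \<in> G" "\<nu> u \<noteq> \<nu> v"
  shows "osgn \<nu> v (G - {u}) * osgn \<nu> u G = - (osgn \<nu> u (G - {v}) * osgn \<nu> v G)"
proof (cases "\<nu> u < \<nu> v")
  case True
  then show ?thesis
    using assms by (simp add: osgn_remove_below osgn_remove_above)
next
  case False
  then have "\<nu> v < \<nu> u" using assms by simp
  then show ?thesis
    using assms by (simp add: osgn_remove_below osgn_remove_above)
qed

lemma cob_add: "cob \<nu> x X (\<lambda>G. b G + c G) G = cob \<nu> x X b G + cob \<nu> x X c G"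
  by (simp add: cob_def algebra_simps sum.distrib)

lemma cob_diff: "cob \<nu> x X (\<lambda>G. b G - c G) G = cob \<nu> x X b G - cob \<nu> x X c G"
  by (simp add: cob_def algebra_simps sum_subtractf)

lemma cob_scale: "cob \<nu> x X (\<lambda>G. r * c G) G = r * cob \<nu> x X c G"
  by (simp add: cob_def algebra_simps sum_distrib_left)

lemma cob_cong:
  assumes "\<And>v. v \<in> G \<Longrightarrow> G - {v} \<in> X \<Longrightarrow> b (G - {v}) = c (G - {v})"
  shows "cob \<nu> x X b G = cob \<nu> x X c G"
  unfolding cob_def by (rule sum.cong) (use assms in auto)

lemma cob_eq_0:
  assumes "\<And>v. v \<in> G \<Longrightarrow> G - {v} \<in> X \<Longrightarrow> c (G - {v}) = 0"
  shows "cob \<nu> x X c G = 0"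
  unfolding cob_def by (rule sum.neutral) (use assms in auto)

text \<open>Removing \<open>v\<close> and then \<open>w\<close> cancels against the opposite order
  by \<open>osgn_swap\<close>. Convexity guarantees that both intermediate sets belong to
  \<open>X\<close> as soon as \<open>G\<close> and \<open>G - {v} - {w}\<close> do, so no term lacks
  its partner.\<close>

lemma cob_cob:
  fixes c :: "'v set \<Rightarrow> 'r::comm_ring_1"
  assumes "oriented \<nu> X" "convex_family X" "G \<in> X"
  shows "cob \<nu> x X (cob \<nu> x X c) G = 0"
proof -
  have fin: "finite G" and inj: "inj_on \<nu> G" using assms by (auto simp: oriented_def)
  let ?S = "{(v, w). v \<in> G \<and> w \<in> G \<and> \<nu> v \<noteq> \<nu> w \<and> G - {v} - {w} \<in> X}"
  let ?L = "{(v, w). v \<in> G \<and> w \<in> G \<and> \<nu> v < \<nu> w \<and> G - {v} - {w} \<in> X}"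
  let ?U = "{(v, w). v \<in> G \<and> w \<in> G \<and> \<nu> w < \<nu> v \<and> G - {v} - {w} \<in> X}"
  define f where "f = (\<lambda>(v, w). osgn \<nu> v G * x v * (osgn \<nu> w (G - {v}) * x w * c (G - {v} - {w})))"
  have step: "G - {v} \<in> X" if "G - {v} - {w} \<in> X" for v w
    by (rule convex_familyD[OF assms(2) that assms(3)]) auto
  have "cob \<nu> x X (cob \<nu> x X c) G =
     (\<Sum>v | v \<in> G \<and> G - {v} \<in> X. \<Sum>w | w \<in> G - {v} \<and> G - {v} - {w} \<in> X. f (v, w))"
    unfolding cob_def f_def by (simp add: sum_distrib_left)
  also have "\<dots> = sum f (SIGMA v:{v \<in> G. G - {v} \<in> X}. {w \<in> G - {v}. G - {v} - {w} \<in> X})"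
    using fin by (subst sum.Sigma) auto
  also have "(SIGMA v:{v \<in> G. G - {v} \<in> X}. {w \<in> G - {v}. G - {v} - {w} \<in> X}) = ?S"
    using step inj by (auto simp: inj_on_def)
  also have "?S = ?L \<union> ?U" by auto
  also have "sum f (?L \<union> ?U) = sum f ?L + sum f ?U"
    by (rule sum.union_disjoint) (auto intro: finite_subset[of _ "G \<times> G"] fin)
  also have "sum f ?U = sum (\<lambda>(v, w). f (w, v)) ?L"
    by (rule sum.reindex_bij_witness[of _ prod.swap prod.swap])
       (auto simp: Diff_insert2[symmetric] insert_commute)
  also have "\<dots> = sum (\<lambda>p. - f p) ?L"
  proof (rule sum.cong, simp, clarify)
    fix v w assume vw: "v \<in> G" "w \<in> G" "\<nu> v < \<nu> w"
    have sw: "osgn \<nu> v (G - {w}) * osgn \<nu> w G = - (osgn \<nu> w (G - {v}) * osgn \<nu> v G :: 'r)"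
      using vw fin by (intro osgn_swap) auto
    have e: "G - {w} - {v} = G - {v} - {w}" by auto
    have "f (w, v) = (osgn \<nu> v (G - {w}) * osgn \<nu> w G) * (x w * x v * c (G - {v} - {w}))"
      by (simp add: f_def e ac_simps)
    also have "\<dots> = - f (v, w)"
      unfolding sw by (simp add: f_def ac_simps)
    finally show "f (w, v) = - f (v, w)" .
  qed
  also have "sum f ?L + \<dots> = 0" by (simp add: sum_negf)
  finally show ?thesis .
qed

section \<open>Contraction by a vertex and acyclicity of cones\<close>

definition cob_homotopy :: "('v \<Rightarrow> nat) \<Rightarrow> 'v \<Rightarrow> ('v set \<Rightarrow> 'r::comm_ring_1) \<Rightarrow> 'v set \<Rightarrow> 'r" where
  "cob_homotopy \<nu> u c G = (if u \<in> G then 0 else osgn \<nu> u (insert u G) * c (insert u G))"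

text \<open>The Cartan formula for exterior multiplication and contraction. With
  \<open>x u = 1\<close> it makes a family stable under toggling \<open>u\<close> acyclic; with
  \<open>x = pvar\<close> it makes multiplication by a variable null-homotopic on the Koszul
  complex.\<close>

lemma cob_homotopy_formula:
  fixes c :: "'v set \<Rightarrow> 'r::comm_ring_1"
  assumes or: "oriented \<nu> X" and st: "\<And>G. G \<in> X \<Longrightarrow> insert u G \<in> X" "\<And>G. G \<in> X \<Longrightarrow> G - {u} \<in> X"
    and G: "G \<in> X"
  shows "cob \<nu> x X (cob_homotopy \<nu> u c) G + cob_homotopy \<nu> u (cob \<nu> x X c) G = x u * c G"
proof (cases "u \<in> G")
  case True
  have fin: "finite G" using or G by (auto simp: oriented_def)
  have "cob \<nu> x X (cob_homotopy \<nu> u c) G = (\<Sum>v | v \<in> G \<and> G - {v} \<in> X. if v = u then x u * c G else 0)"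
    unfolding cob_def cob_homotopy_def
    by (rule sum.cong) (use True in \<open>auto simp: insert_absorb mult.assoc mult.left_commute\<close>)
  also have "\<dots> = x u * c G" using fin True st(2)[OF G] by simp
  finally show ?thesis using True by (simp add: cob_homotopy_def)
next
  case False
  let ?H = "insert u G"
  have H: "?H \<in> X" using st G by auto
  have fin: "finite ?H" "inj_on \<nu> ?H" using or H by (auto simp: oriented_def)
  let ?A = "{v. v \<in> G \<and> G - {v} \<in> X}"
  have ins: "?H - {v} \<in> X \<longleftrightarrow> G - {v} \<in> X" if "v \<in> G" for v
  proof -
    have "?H - {v} = insert u (G - {v})" "G - {v} = ?H - {v} - {u}" using False that by auto
    then show ?thesis using st by metis
  qed
  have "{v. v \<in> ?H \<and> ?H - {v} \<in> X} = insert u ?A"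
    using ins G False by auto
  then have "cob \<nu> x X c ?H = osgn \<nu> u ?H * x u * c G + (\<Sum>v\<in>?A. osgn \<nu> v ?H * x v * c (?H - {v}))"
    unfolding cob_def using fin False by simp
  then have 1: "cob_homotopy \<nu> u (cob \<nu> x X c) G = x u * c G + (\<Sum>v\<in>?A. osgn \<nu> u ?H * (osgn \<nu> v ?H * x v * c (?H - {v})))"
    using False by (simp add: cob_homotopy_def distrib_left sum_distrib_left mult.assoc)
  have "cob \<nu> x X (cob_homotopy \<nu> u c) G = (\<Sum>v\<in>?A. - (osgn \<nu> u ?H * (osgn \<nu> v ?H * x v * c (?H - {v}))))"
    unfolding cob_def
  proof (rule sum.cong, simp)
    fix v assume v: "v \<in> ?A"
    then have vu: "v \<noteq> u" "\<nu> v \<noteq> \<nu> u" using False fin by (auto simp: inj_on_def)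
    have e: "insert u (G - {v}) = ?H - {v}" "G = ?H - {u}" using vu False by auto
    have "osgn \<nu> v G * osgn \<nu> u ?H = (- (osgn \<nu> u (?H - {v}) * osgn \<nu> v ?H) :: 'r)"
      using osgn_swap[of ?H u v \<nu>, where ?'b = 'r] v vu fin e(2) by auto
    then have "(osgn \<nu> v G * osgn \<nu> u ?H) * (osgn \<nu> u ?H * osgn \<nu> u (?H - {v}))
        = (- (osgn \<nu> u (?H - {v}) * osgn \<nu> v ?H) * (osgn \<nu> u ?H * osgn \<nu> u (?H - {v})) :: 'r)"
      by simp
    then have "osgn \<nu> v G * osgn \<nu> u (?H - {v}) = (- (osgn \<nu> u ?H * osgn \<nu> v ?H) :: 'r)"
      by (simp add: mult.assoc mult.left_commute)
    then have "osgn \<nu> v G * osgn \<nu> u (?H - {v}) * (x v * c (?H - {v})) = - (osgn \<nu> u ?H * osgn \<nu> v ?H) * (x v * c (?H - {v}))"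
      by simp
    then show "osgn \<nu> v G * x v * cob_homotopy \<nu> u c (G - {v}) = - (osgn \<nu> u ?H * (osgn \<nu> v ?H * x v * c (?H - {v})))"
      using False by (simp add: cob_homotopy_def e(1) algebra_simps)
  qed
  then show ?thesis using 1 by (simp add: sum_negf)
qed

text \<open>Degrees are counted by cardinality. For the faces of a complex that contain a face \<open>F\<close>, the cochains
  on the faces with \<open>i\<close> elements compute the reduced cohomology of the link of \<open>F\<close> in degree
  \<open>i - card F - 1\<close>.\<close>

definition exact_below :: "'k::field itself \<Rightarrow> ('v \<Rightarrow> nat) \<Rightarrow> 'v set set \<Rightarrow> nat \<Rightarrow> bool" where
  "exact_below TYPE('k) \<nu> X n \<longleftrightarrow>
     (\<forall>i<n. \<forall>c :: 'v set \<Rightarrow> 'k.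
        (\<forall>G\<in>X. card G = Suc i \<longrightarrow> cob \<nu> (\<lambda>_. 1) X c G = 0) \<longrightarrow>
        (\<exists>b. \<forall>G\<in>X. card G = i \<longrightarrow> c G = cob \<nu> (\<lambda>_. 1) X b G))"

lemma exact_belowI:
  assumes "\<And>i (c :: 'v set \<Rightarrow> 'k::field). i < n \<Longrightarrow> (\<And>G. G \<in> X \<Longrightarrow> card G = Suc i \<Longrightarrow> cob \<nu> (\<lambda>_. 1) X c G = 0) \<Longrightarrow>
      \<exists>b. \<forall>G\<in>X. card G = i \<longrightarrow> c G = cob \<nu> (\<lambda>_. 1) X b G"
  shows "exact_below TYPE('k) \<nu> X n"
  using assms unfolding exact_below_def by blast

lemma exact_belowE:
  fixes c :: "'v set \<Rightarrow> 'k::field"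
  assumes "exact_below TYPE('k) \<nu> X n" "i < n"
    and "\<And>G. G \<in> X \<Longrightarrow> card G = Suc i \<Longrightarrow> cob \<nu> (\<lambda>_. 1) X c G = 0"
  obtains b where "\<And>G. G \<in> X \<Longrightarrow> card G = i \<Longrightarrow> c G = cob \<nu> (\<lambda>_. 1) X b G"
  using assms unfolding exact_below_def by blast

lemma exact_below_mono: "exact_below TYPE('k::field) \<nu> X n \<Longrightarrow> m \<le> n \<Longrightarrow> exact_below TYPE('k) \<nu> X m"
  by (auto simp: exact_below_def)

lemma exact_below_empty: "exact_below TYPE('k::field) \<nu> {} n"
  by (auto simp: exact_below_def)

lemma cob_restrict:
  assumes "Y \<subseteq> X" "\<And>v. v \<in> G \<Longrightarrow> G - {v} \<in> X - Y \<Longrightarrow> c (G - {v}) = 0" "finite G"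
  shows "cob \<nu> x X c G = cob \<nu> x Y c G"
  unfolding cob_def by (rule sum.mono_neutral_right) (use assms in auto)

lemma card_minus_singleton:
  assumes "finite G" "v \<in> G" "card G = Suc i" shows "card (G - {v}) = i"
  using assms by simp

text \<open>Cochains supported on the upper part \<open>Z\<close> form a subcomplex with quotient
  the cochains of \<open>Y\<close>, since no member of \<open>Y\<close> loses a vertex into
  \<open>Z\<close>. The lemmas on \<open>exact_below\<close> here are the three vanishing statements
  read off the long exact sequence; the degree shifts in their hypotheses are those of the
  connecting map from degree \<open>i\<close> of \<open>Y\<close> to degree \<open>i + 1\<close> of
  \<open>Z\<close>.\<close>

context
  fixes \<nu> :: "'v \<Rightarrow> nat" and X Y Z :: "'v set set"
  assumes oriented: "oriented \<nu> X" and convex: "convex_family X"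
    and split: "X = Y \<union> Z" "Y \<inter> Z = {}"
    and down: "\<And>G v. G \<in> Y \<Longrightarrow> v \<in> G \<Longrightarrow> G - {v} \<notin> Z"
begin

lemma finite_member: "G \<in> X \<Longrightarrow> finite G"
  using oriented by (auto simp: oriented_def)

lemma pieces_subset: "Y \<subseteq> X" "Z \<subseteq> X"
  using split by auto

lemma cob_lower: "G \<in> Y \<Longrightarrow> cob \<nu> x X c G = cob \<nu> x Y c G"
  by (rule cob_restrict) (use split down finite_member in auto)

lemma cob_upper:
  assumes "G \<in> Z" "card G = Suc i" "\<And>H. H \<in> Y \<Longrightarrow> card H = i \<Longrightarrow> c H = 0"
  shows "cob \<nu> x X c G = cob \<nu> x Z c G"
  by (rule cob_restrict)
     (use assms split finite_member in \<open>auto dest!: card_minus_singleton[of G _ i, rotated 2]\<close>)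

lemma cob_upper_zero:
  assumes "G \<in> Z" "\<And>H. H \<in> Y \<Longrightarrow> c H = 0"
  shows "cob \<nu> x X c G = cob \<nu> x Z c G"
  by (rule cob_restrict) (use assms split finite_member in auto)

lemma cob_supported_upper:
  assumes "G \<in> Y" "\<And>H. H \<in> Y \<Longrightarrow> c H = 0"
  shows "cob \<nu> x X c G = 0"
  by (rule cob_eq_0) (use assms split down in auto)

lemma exact_below_union:
  assumes Y: "exact_below TYPE('k::field) \<nu> Y n" and Z: "exact_below TYPE('k) \<nu> Z n"
  shows "exact_below TYPE('k) \<nu> X n"
proof (rule exact_belowI)
  fix i and c :: "'v set \<Rightarrow> 'k"
  assume i: "i < n" and c: "\<And>G. G \<in> X \<Longrightarrow> card G = Suc i \<Longrightarrow> cob \<nu> (\<lambda>_. 1) X c G = 0"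
  obtain b where b: "\<And>G. G \<in> Y \<Longrightarrow> card G = i \<Longrightarrow> c G = cob \<nu> (\<lambda>_. 1) Y b G"
    by (rule exact_belowE[OF Y i, of c]) (use c pieces_subset in \<open>auto simp: cob_lower[symmetric]\<close>)
  define u where "u G = c G - cob \<nu> (\<lambda>_. 1) X b G" for G
  have u0: "u G = 0" if "G \<in> Y" "card G = i" for G
    using b[OF that] by (simp add: u_def cob_lower[OF that(1)])
  have "cob \<nu> (\<lambda>_. 1) Z u G = 0" if "G \<in> Z" "card G = Suc i" for G
  proof -
    have GX: "G \<in> X" using that split by auto
    have "cob \<nu> (\<lambda>_. 1) Z u G = cob \<nu> (\<lambda>_. 1) X u G"
      using cob_upper[OF that u0] by simp
    also have "\<dots> = 0"
      unfolding u_def cob_diff using c[OF GX that(2)] cob_cob[OF oriented convex GX] by simp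
    finally show ?thesis .
  qed
  then obtain e where e: "\<And>G. G \<in> Z \<Longrightarrow> card G = i \<Longrightarrow> u G = cob \<nu> (\<lambda>_. 1) Z e G"
    using exact_belowE[OF Z i, of u] by blast
  \<comment> \<open>Extension by zero across \<open>Y\<close> embeds the cochains of
    \<open>Z\<close> as a subcomplex of those of \<open>X\<close>.\<close>
  define e' where "e' G = (if G \<in> Y then 0 else e G)" for G
  have "c G = cob \<nu> (\<lambda>_. 1) X (\<lambda>G. b G + e' G) G" if "G \<in> X" "card G = i" for G
  proof (cases "G \<in> Y")
    case True
    then have "cob \<nu> (\<lambda>_. 1) X e' G = 0" by (rule cob_supported_upper) (simp add: e'_def)
    then show ?thesis using u0[OF True that(2)] by (simp add: cob_add u_def)
  next
    case False
    then have GZ: "G \<in> Z" using that split by auto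
    have "cob \<nu> (\<lambda>_. 1) X e' G = cob \<nu> (\<lambda>_. 1) Z e' G"
      by (rule cob_upper_zero[OF GZ]) (simp add: e'_def)
    also have "\<dots> = cob \<nu> (\<lambda>_. 1) Z e G"
      by (rule cob_cong) (use split in \<open>auto simp: e'_def\<close>)
    finally show ?thesis using e[OF GZ that(2)] by (simp add: cob_add u_def algebra_simps)
  qed
  then show "\<exists>b. \<forall>G\<in>X. card G = i \<longrightarrow> c G = cob \<nu> (\<lambda>_. 1) X b G" by blast
qed

lemma exact_below_upper:
  assumes X: "exact_below TYPE('k::field) \<nu> X n" and Y: "exact_below TYPE('k) \<nu> Y (n - 1)"
  shows "exact_below TYPE('k) \<nu> Z n"
proof (rule exact_belowI)
  fix i and c :: "'v set \<Rightarrow> 'k"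
  assume i: "i < n" and c: "\<And>G. G \<in> Z \<Longrightarrow> card G = Suc i \<Longrightarrow> cob \<nu> (\<lambda>_. 1) Z c G = 0"
  define c' where "c' G = (if G \<in> Y then 0 else c G)" for G
  have cc: "cob \<nu> (\<lambda>_. 1) Z c' G = cob \<nu> (\<lambda>_. 1) Z c G" for G
    by (rule cob_cong) (use split in \<open>auto simp: c'_def\<close>)
  have "cob \<nu> (\<lambda>_. 1) X c' G = 0" if "G \<in> X" "card G = Suc i" for G
  proof (cases "G \<in> Y")
    case True
    then show ?thesis by (rule cob_supported_upper) (simp add: c'_def)
  next
    case False
    then have GZ: "G \<in> Z" using that split by auto
    have "cob \<nu> (\<lambda>_. 1) X c' G = cob \<nu> (\<lambda>_. 1) Z c' G"
      by (rule cob_upper_zero[OF GZ]) (simp add: c'_def)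
    then show ?thesis using c[OF GZ that(2)] cc by simp
  qed
  then obtain b where b: "\<And>G. G \<in> X \<Longrightarrow> card G = i \<Longrightarrow> c' G = cob \<nu> (\<lambda>_. 1) X b G"
    using exact_belowE[OF X i, of c'] by blast
  show "\<exists>b. \<forall>G\<in>Z. card G = i \<longrightarrow> c G = cob \<nu> (\<lambda>_. 1) Z b G"
  \<comment> \<open>In degree 0 there is no lower degree of \<open>Y\<close> to correct in: the only
    possible member is the empty set, where every coboundary is an empty sum.\<close>
  proof (cases i)
    case 0
    have "c G = cob \<nu> (\<lambda>_. 1) Z b G" if "G \<in> Z" "card G = i" for G
    proof -
      have "G = {}" using that 0 split finite_member[of G] by auto
      moreover have "G \<in> X" "G \<notin> Y" using that split by auto
      ultimately show ?thesis using b[of G] that by (simp add: c'_def cob_def)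
    qed
    then show ?thesis by blast
  next
    case (Suc j)
    have "cob \<nu> (\<lambda>_. 1) Y b G = 0" if "G \<in> Y" "card G = Suc j" for G
    proof -
      have "c' G = 0" using that by (simp add: c'_def)
      then show ?thesis using b[of G] that Suc pieces_subset by (auto simp: cob_lower[OF that(1)])
    qed
    then obtain e where e: "\<And>G. G \<in> Y \<Longrightarrow> card G = j \<Longrightarrow> b G = cob \<nu> (\<lambda>_. 1) Y e G"
      using exact_belowE[OF Y, of j b] i Suc by (metis Suc_less_eq diff_Suc_1 less_diff_conv plus_1_eq_Suc add.commute)
    define u where "u G = b G - cob \<nu> (\<lambda>_. 1) X e G" for G
    have "c G = cob \<nu> (\<lambda>_. 1) Z u G" if "G \<in> Z" "card G = i" for G
    proof -
      have GX: "G \<in> X" "G \<notin> Y" using that split by auto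
      have "cob \<nu> (\<lambda>_. 1) Z u G = cob \<nu> (\<lambda>_. 1) X u G"
        by (rule cob_upper[symmetric, OF that(1) that(2)[unfolded Suc]])
           (use e in \<open>auto simp: u_def cob_lower\<close>)
      also have "\<dots> = cob \<nu> (\<lambda>_. 1) X b G"
        unfolding u_def cob_diff using cob_cob[OF oriented convex GX(1)] by simp
      also have "\<dots> = c G" using b[OF GX(1) that(2)] GX by (simp add: c'_def)
      finally show ?thesis by simp
    qed
    then show ?thesis by blast
  qed
qed

lemma exact_below_lower:
  assumes X: "exact_below TYPE('k::field) \<nu> X n" and Z: "exact_below TYPE('k) \<nu> Z (Suc n)"
  shows "exact_below TYPE('k) \<nu> Y n"
proof (rule exact_belowI)
  fix i and c :: "'v set \<Rightarrow> 'k"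
  assume i: "i < n" and c: "\<And>G. G \<in> Y \<Longrightarrow> card G = Suc i \<Longrightarrow> cob \<nu> (\<lambda>_. 1) Y c G = 0"
  \<comment> \<open>The connecting map: \<open>u\<close> measures how far \<open>c\<close>, a
    cocycle on \<open>Y\<close> only, is from being one on \<open>X\<close>. It lives on
    \<open>Z\<close>, and a primitive of it there is subtracted from \<open>c\<close>.\<close>
  define u where "u = cob \<nu> (\<lambda>_. 1) X c"
  have u0: "u G = 0" if "G \<in> Y" "card G = Suc i" for G
    using c[OF that] by (simp add: u_def cob_lower[OF that(1)])
  have "cob \<nu> (\<lambda>_. 1) Z u G = 0" if "G \<in> Z" "card G = Suc (Suc i)" for G
  proof -
    have "cob \<nu> (\<lambda>_. 1) Z u G = cob \<nu> (\<lambda>_. 1) X u G"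
      by (rule cob_upper[symmetric, OF that u0])
    then show ?thesis unfolding u_def using cob_cob[OF oriented convex] that split by auto
  qed
  then obtain b where b: "\<And>G. G \<in> Z \<Longrightarrow> card G = Suc i \<Longrightarrow> u G = cob \<nu> (\<lambda>_. 1) Z b G"
    using exact_belowE[OF Z, of "Suc i" u] i by auto
  define b' where "b' G = (if G \<in> Y then 0 else b G)" for G
  have "cob \<nu> (\<lambda>_. 1) X (\<lambda>G. c G - b' G) G = 0" if "G \<in> X" "card G = Suc i" for G
  proof (cases "G \<in> Y")
    case True
    then have "cob \<nu> (\<lambda>_. 1) X b' G = 0" by (rule cob_supported_upper) (simp add: b'_def)
    then show ?thesis using u0[OF True that(2)] by (simp add: cob_diff u_def)
  next
    case False
    then have GZ: "G \<in> Z" using that split by auto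
    have "cob \<nu> (\<lambda>_. 1) X b' G = cob \<nu> (\<lambda>_. 1) Z b' G"
      by (rule cob_upper_zero[OF GZ]) (simp add: b'_def)
    also have "\<dots> = cob \<nu> (\<lambda>_. 1) Z b G"
      by (rule cob_cong) (use split in \<open>auto simp: b'_def\<close>)
    finally show ?thesis using b[OF GZ that(2)] by (simp add: cob_diff u_def)
  qed
  then obtain e where e: "\<And>G. G \<in> X \<Longrightarrow> card G = i \<Longrightarrow> c G - b' G = cob \<nu> (\<lambda>_. 1) X e G"
    using exact_belowE[OF X i, of "\<lambda>G. c G - b' G"] by blast
  have "c G = cob \<nu> (\<lambda>_. 1) Y e G" if "G \<in> Y" "card G = i" for G
    using e[of G] that pieces_subset by (auto simp: b'_def cob_lower[OF that(1)])
  then show "\<exists>b. \<forall>G\<in>Y. card G = i \<longrightarrow> c G = cob \<nu> (\<lambda>_. 1) Y b G" by blast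
qed

end

text \<open>A cone with apex \<open>u\<close>: contraction by \<open>u\<close> is a null-homotopy,
  in all degrees.\<close>

lemma exact_below_toggle:
  fixes X :: "'v set set"
  assumes "oriented \<nu> X" "\<And>G. G \<in> X \<Longrightarrow> insert u G \<in> X" "\<And>G. G \<in> X \<Longrightarrow> G - {u} \<in> X"
  shows "exact_below TYPE('k::field) \<nu> X n"
proof (rule exact_belowI)
  fix i and c :: "'v set \<Rightarrow> 'k"
  assume c: "\<And>G. G \<in> X \<Longrightarrow> card G = Suc i \<Longrightarrow> cob \<nu> (\<lambda>_. 1) X c G = 0"
  have "c G = cob \<nu> (\<lambda>_. 1) X (cob_homotopy \<nu> u c) G" if "G \<in> X" "card G = i" for G
  proof -
    have "cob_homotopy \<nu> u (cob \<nu> (\<lambda>_. 1) X c) G = 0"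
      using assms that c[of "insert u G"] by (auto simp: cob_homotopy_def oriented_def)
    then show ?thesis using cob_homotopy_formula[OF assms that(1), of "\<lambda>_. 1" c] by simp
  qed
  then show "\<exists>b. \<forall>G\<in>X. card G = i \<longrightarrow> c G = cob \<nu> (\<lambda>_. 1) X b G" by blast
qed

text \<open>The levels are glued one at a time by \<open>exact_below_union\<close>. Monotonicity of
  \<open>\<phi>\<close> ensures that removing a vertex never leads to a higher level. This is the
  patchwork principle of discrete Morse theory in cohomological form.\<close>

lemma exact_below_filter:
  fixes \<phi> :: "'v set \<Rightarrow> nat"
  assumes "oriented \<nu> X" "convex_family X" "finite X"
    and mono: "\<And>G H. G \<in> X \<Longrightarrow> H \<in> X \<Longrightarrow> G \<subseteq> H \<Longrightarrow> \<phi> G \<le> \<phi> H"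
    and lev: "\<And>t. exact_below TYPE('k::field) \<nu> {G \<in> X. \<phi> G = t} n"
  shows "exact_below TYPE('k) \<nu> X n"
proof -
  have *: "exact_below TYPE('k) \<nu> {G \<in> X. \<phi> G < t} n" for t
  proof (induction t)
    case 0
    then show ?case by (simp add: exact_below_empty)
  next
    case (Suc t)
    show ?case
    proof (rule exact_below_union[OF _ _ _ _ _ Suc.IH lev[of t]])
      show "oriented \<nu> {G \<in> X. \<phi> G < Suc t}" using assms(1) by (auto simp: oriented_def)
      show "convex_family {G \<in> X. \<phi> G < Suc t}"
        unfolding convex_family_def
      proof clarify
        fix A C B assume h: "A \<in> X" "C \<in> X" "\<phi> C < Suc t" "A \<subseteq> B" "B \<subseteq> C"
        then have "B \<in> X" using assms(2) unfolding convex_family_def by blast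
        then show "B \<in> X \<and> \<phi> B < Suc t" using mono[of B C] h by auto
      qed
    next
      fix G v assume "G \<in> {G \<in> X. \<phi> G < t}" "v \<in> G"
      then show "G - {v} \<notin> {G \<in> X. \<phi> G = t}" using mono[of "G - {v}" G] by auto
    qed auto
  qed
  obtain t where "\<And>G. G \<in> X \<Longrightarrow> \<phi> G < t"
    using finite_imageI[OF assms(3), of \<phi>] by (metis finite_nat_set_iff_bounded imageI)
  then have "{G \<in> X. \<phi> G < t} = X" by auto
  then show ?thesis using *[of t] by simp
qed

text \<open>An isomorphism of cochain complexes with degree shift \<open>s\<close>. The map
  \<open>\<tau>\<close> matches the removable vertices, and the signs need to agree only after each
  basis cochain is rescaled by \<open>e H\<close>, a square root of 1.\<close>

lemma exact_below_transfer:
  fixes f :: "'v set \<Rightarrow> 'w set" and e :: "'v set \<Rightarrow> 'k::field"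
  assumes ex: "exact_below TYPE('k) \<nu> X n"
    and X': "X' = f ` X" and inj: "inj_on f X"
    and card: "\<And>H. H \<in> X \<Longrightarrow> card (f H) = card H + s"
    and rem: "\<And>H. H \<in> X \<Longrightarrow> {v'. v' \<in> f H \<and> f H - {v'} \<in> X'} = \<tau> ` {v. v \<in> H \<and> H - {v} \<in> X}"
    and inj\<tau>: "\<And>H. H \<in> X \<Longrightarrow> inj_on \<tau> H"
    and f\<tau>: "\<And>H v. H \<in> X \<Longrightarrow> v \<in> H \<Longrightarrow> H - {v} \<in> X \<Longrightarrow> f H - {\<tau> v} = f (H - {v})"
    and sg: "\<And>H v. H \<in> X \<Longrightarrow> v \<in> H \<Longrightarrow> H - {v} \<in> X \<Longrightarrow> osgn \<nu>' (\<tau> v) (f H) = e H * osgn \<nu> v H * e (H - {v})"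
    and e: "\<And>H. e H * e H = 1"
  shows "exact_below TYPE('k) \<nu>' X' (n + s)"
proof (rule exact_belowI)
  fix i and c :: "'w set \<Rightarrow> 'k"
  assume i: "i < n + s" and c: "\<And>G. G \<in> X' \<Longrightarrow> card G = Suc i \<Longrightarrow> cob \<nu>' (\<lambda>_. 1) X' c G = 0"
  have ee: "e H * (e H * a) = a" for H a using e[of H] by (simp flip: mult.assoc)
  have tr: "cob \<nu>' (\<lambda>_. 1) X' d (f H) = e H * cob \<nu> (\<lambda>_. 1) X (\<lambda>K. e K * d (f K)) H" if "H \<in> X" for H d
  proof -
    have "cob \<nu>' (\<lambda>_. 1) X' d (f H) = (\<Sum>v | v \<in> H \<and> H - {v} \<in> X. osgn \<nu>' (\<tau> v) (f H) * d (f H - {\<tau> v}))"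
      unfolding cob_def rem[OF that]
      by (subst sum.reindex) (auto intro: inj_on_subset[OF inj\<tau>[OF that]])
    also have "\<dots> = (\<Sum>v | v \<in> H \<and> H - {v} \<in> X. e H * (osgn \<nu> v H * (e (H - {v}) * d (f (H - {v})))))"
      by (rule sum.cong) (use f\<tau> sg that in auto)
    finally show ?thesis by (simp add: cob_def sum_distrib_left)
  qed
  show "\<exists>b. \<forall>G\<in>X'. card G = i \<longrightarrow> c G = cob \<nu>' (\<lambda>_. 1) X' b G"
  proof (cases "s \<le> i")
    case False
    then show ?thesis using card X' by auto
  next
    case True
    define j where "j = i - s"
    have j: "j < n" "i = j + s" using True i by (auto simp: j_def)
    obtain b where b: "\<And>H. H \<in> X \<Longrightarrow> card H = j \<Longrightarrow> e H * c (f H) = cob \<nu> (\<lambda>_. 1) X b H"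
    proof (rule exact_belowE[OF ex j(1), of "\<lambda>H. e H * c (f H)"])
      fix H assume H: "H \<in> X" "card H = Suc j"
      then have "e H * cob \<nu> (\<lambda>_. 1) X (\<lambda>H. e H * c (f H)) H = 0"
        using c[of "f H"] tr[of H c] card[of H] j X' by auto
      then show "cob \<nu> (\<lambda>_. 1) X (\<lambda>H. e H * c (f H)) H = 0" using e[of H] by auto
    qed auto
    define b' where "b' G = e (inv_into X f G) * b (inv_into X f G)" for G
    have "c G = cob \<nu>' (\<lambda>_. 1) X' b' G" if G: "G \<in> X'" "card G = i" for G
    proof -
      obtain H where H: "H \<in> X" "G = f H" using G X' by auto
      have "cob \<nu>' (\<lambda>_. 1) X' b' G = e H * cob \<nu> (\<lambda>_. 1) X (\<lambda>K. e K * b' (f K)) H" using tr H by simp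
      also have "cob \<nu> (\<lambda>_. 1) X (\<lambda>K. e K * b' (f K)) H = cob \<nu> (\<lambda>_. 1) X b H"
        by (rule cob_cong) (simp add: b'_def inj ee)
      also have "\<dots> = e H * c (f H)" using b[OF H(1)] H G card[OF H(1)] j by simp
      finally show ?thesis using H ee by simp
    qed
    then show ?thesis by blast
  qed
qed

lemma exact_below_osgn_cong:
  fixes X :: "'v set set"
  assumes "exact_below TYPE('k::field) \<nu> X n"
    and "\<And>G v. G \<in> X \<Longrightarrow> v \<in> G \<Longrightarrow> osgn \<nu>' v G = (osgn \<nu> v G :: 'k)"
  shows "exact_below TYPE('k) \<nu>' X n"
proof -
  have "cob \<nu>' (\<lambda>_. 1) X c G = cob \<nu> (\<lambda>_. 1) X c G" if "G \<in> X" for c :: "'v set \<Rightarrow> 'k" and G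
    unfolding cob_def by (rule sum.cong) (use that assms in auto)
  then show ?thesis using assms(1) unfolding exact_below_def by simp
qed

section \<open>Ideals, depth and Krull dimension\<close>

lemma is_idealD:
  assumes "is_ideal I"
  shows "0 \<in> I" "a \<in> I \<Longrightarrow> b \<in> I \<Longrightarrow> a + b \<in> I" "a \<in> I \<Longrightarrow> r * a \<in> I" "a \<in> I \<Longrightarrow> a * r \<in> I"
  using assms by (auto simp: is_ideal_def mult.commute[of a])

lemma is_ideal_uminus: "is_ideal I \<Longrightarrow> a \<in> I \<Longrightarrow> - a \<in> I"
  using is_idealD(3)[of I a "-1"] by simp

lemma is_ideal_diff: "is_ideal I \<Longrightarrow> a \<in> I \<Longrightarrow> b \<in> I \<Longrightarrow> a - b \<in> I"
  using is_idealD(2)[of I a "- b"] is_ideal_uminus[of I b] by simp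

lemma is_ideal_sum: "is_ideal I \<Longrightarrow> (\<And>x. x \<in> A \<Longrightarrow> f x \<in> I) \<Longrightarrow> sum f A \<in> I"
  by (induction A rule: infinite_finite_induct) (auto intro: is_idealD)

lemma is_ideal_gen_ideal: "is_ideal (gen_ideal A)"
  by (auto simp: gen_ideal_def is_ideal_def)

lemma gen_ideal_superset: "A \<subseteq> gen_ideal A"
  by (auto simp: gen_ideal_def)

lemma gen_ideal_least: "is_ideal I \<Longrightarrow> A \<subseteq> I \<Longrightarrow> gen_ideal A \<subseteq> I"
  by (auto simp: gen_ideal_def)

lemma gen_ideal_mono: "A \<subseteq> B \<Longrightarrow> gen_ideal A \<subseteq> gen_ideal B"
  by (auto simp: gen_ideal_def)

lemma gen_ideal_of_ideal: "is_ideal I \<Longrightarrow> gen_ideal I = I"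
  using gen_ideal_least[of I I] gen_ideal_superset[of I] by auto

lemma gen_ideal_insert_iff: "a \<in> gen_ideal (insert f S) \<longleftrightarrow> (\<exists>g. a - f * g \<in> gen_ideal S)"
proof
  let ?J = "{a. \<exists>g. a - f * g \<in> gen_ideal S}"
  have "is_ideal ?J"
    unfolding is_ideal_def
  proof (intro conjI ballI allI)
    show "0 \<in> ?J" using is_idealD(1)[OF is_ideal_gen_ideal[of S]] by (auto intro!: exI[of _ 0])
  next
    fix a b assume "a \<in> ?J" "b \<in> ?J"
    then obtain g h where "a - f * g \<in> gen_ideal S" "b - f * h \<in> gen_ideal S" by auto
    then have "(a - f * g) + (b - f * h) \<in> gen_ideal S" by (rule is_idealD(2)[OF is_ideal_gen_ideal])
    then show "a + b \<in> ?J" by (auto intro!: exI[of _ "g + h"] simp: algebra_simps)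
  next
    fix r a assume "a \<in> ?J"
    then obtain g where "a - f * g \<in> gen_ideal S" by auto
    then have "r * (a - f * g) \<in> gen_ideal S" by (rule is_idealD(3)[OF is_ideal_gen_ideal])
    then show "r * a \<in> ?J" by (auto intro!: exI[of _ "r * g"] simp: algebra_simps)
  qed
  moreover have "insert f S \<subseteq> ?J"
  proof
    fix x assume "x \<in> insert f S"
    then show "x \<in> ?J"
      using gen_ideal_superset[of S] is_idealD(1)[OF is_ideal_gen_ideal[of S]]
      by (cases "x = f") (force intro: exI[of _ 1], force intro: exI[of _ 0])
  qed
  ultimately have "gen_ideal (insert f S) \<subseteq> ?J" by (rule gen_ideal_least)
  then show "a \<in> gen_ideal (insert f S) \<Longrightarrow> \<exists>g. a - f * g \<in> gen_ideal S" by auto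
next
  assume "\<exists>g. a - f * g \<in> gen_ideal S"
  then obtain g where "a - f * g \<in> gen_ideal (insert f S)"
    using gen_ideal_mono[of S "insert f S"] by auto
  moreover have "f * g \<in> gen_ideal (insert f S)"
    using gen_ideal_superset[of "insert f S"] by (intro is_idealD(4)[OF is_ideal_gen_ideal]) auto
  ultimately have "(a - f * g) + f * g \<in> gen_ideal (insert f S)"
    by (rule is_idealD(2)[OF is_ideal_gen_ideal])
  then show "a \<in> gen_ideal (insert f S)" by simp
qed

lemma gen_ideal_Un_image_Suc:
  "gen_ideal (I \<union> f ` {..<Suc i}) = gen_ideal (insert (f i) (I \<union> f ` {..<i}))"
  by (simp add: lessThan_Suc)

lemma gen_ideal_Un_image_iff:
  fixes f :: "nat \<Rightarrow> 'r::comm_ring_1"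
  assumes "is_ideal I"
  shows "a \<in> gen_ideal (I \<union> f ` {..<n}) \<longleftrightarrow> (\<exists>h. a - (\<Sum>i<n. f i * h i) \<in> I)"
proof (induction n arbitrary: a)
  case 0
  then show ?case using assms by (simp add: gen_ideal_of_ideal)
next
  case (Suc n)
  have "a \<in> gen_ideal (I \<union> f ` {..<Suc n}) \<longleftrightarrow> (\<exists>g h. a - f n * g - (\<Sum>i<n. f i * h i) \<in> I)"
    unfolding gen_ideal_Un_image_Suc gen_ideal_insert_iff Suc.IH ..
  also have "\<dots> \<longleftrightarrow> (\<exists>h. a - (\<Sum>i<Suc n. f i * h i) \<in> I)"
  proof
    assume "\<exists>g h. a - f n * g - (\<Sum>i<n. f i * h i) \<in> I"
    then obtain g h where *: "a - f n * g - (\<Sum>i<n. f i * h i) \<in> I" by blast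
    have "(\<Sum>i<n. f i * (h(n := g)) i) = (\<Sum>i<n. f i * h i)" by (rule sum.cong) auto
    then have "a - (\<Sum>i<Suc n. f i * (h(n := g)) i) \<in> I" using * by (simp add: algebra_simps)
    then show "\<exists>h. a - (\<Sum>i<Suc n. f i * h i) \<in> I" by blast
  next
    assume "\<exists>h. a - (\<Sum>i<Suc n. f i * h i) \<in> I"
    then obtain h where "a - f n * h n - (\<Sum>i<n. f i * h i) \<in> I" by (auto simp: algebra_simps)
    then show "\<exists>g h. a - f n * g - (\<Sum>i<n. f i * h i) \<in> I" by blast
  qed
  finally show ?case .
qed

text \<open>Zorn gives an ideal maximal among those that contain \<open>J\<close> and miss the
  multiplicative set \<open>S\<close>; such an ideal is prime.\<close>

lemma prime_ideal_avoiding: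
  fixes J S :: "'r::comm_ring_1 set"
  assumes J: "is_ideal J" and S: "1 \<in> S" "\<And>a b. a \<in> S \<Longrightarrow> b \<in> S \<Longrightarrow> a * b \<in> S" and disj: "J \<inter> S = {}"
  obtains q where "is_prime_ideal q" "J \<subseteq> q" "q \<inter> S = {}"
proof -
  let ?A = "{I. is_ideal I \<and> J \<subseteq> I \<and> I \<inter> S = {}}"
  have "\<exists>q\<in>?A. \<forall>I\<in>?A. q \<subseteq> I \<longrightarrow> I = q"
  proof (rule subset_Zorn_nonempty)
    show "?A \<noteq> {}" using J disj by auto
    fix C assume C: "C \<noteq> {}" "subset.chain ?A C"
    have CA: "I \<in> ?A" if "I \<in> C" for I using C(2) that by (auto simp: subset_chain_def)
    have "is_ideal (\<Union>C)"
      unfolding is_ideal_def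
    proof (intro conjI ballI allI)
      show "0 \<in> \<Union>C" using C(1) CA is_idealD(1) by blast
    next
      fix a b assume "a \<in> \<Union>C" "b \<in> \<Union>C"
      then obtain A B where AB: "A \<in> C" "B \<in> C" "a \<in> A" "b \<in> B" by auto
      then have "A \<subseteq> B \<or> B \<subseteq> A" using C(2) by (auto simp: subset_chain_def)
      then obtain D where "D \<in> C" "a \<in> D" "b \<in> D" using AB by auto
      then show "a + b \<in> \<Union>C" using CA[of D] is_idealD(2)[of D a b] by auto
    next
      fix r a assume "a \<in> \<Union>C"
      then show "r * a \<in> \<Union>C" using CA is_idealD(3) by blast
    qed
    moreover have "J \<subseteq> \<Union>C" using C(1) CA by auto
    ultimately show "\<Union>C \<in> ?A" using CA by auto
  qed
  then obtain q where q: "is_ideal q" "J \<subseteq> q" "q \<inter> S = {}"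
    and max: "\<And>I. is_ideal I \<Longrightarrow> q \<subseteq> I \<Longrightarrow> I \<inter> S = {} \<Longrightarrow> I = q"
    by (auto dest: subset_trans)
  have meet: "\<exists>s g. s \<in> S \<and> s - a * g \<in> q" if "a \<notin> q" for a
  proof -
    have "gen_ideal (insert a q) \<noteq> q" using that gen_ideal_superset[of "insert a q"] by auto
    then have "gen_ideal (insert a q) \<inter> S \<noteq> {}"
      using max[OF is_ideal_gen_ideal] gen_ideal_superset[of "insert a q"] by blast
    then obtain s where s: "s \<in> S" "s \<in> gen_ideal (insert a q)" by auto
    then show ?thesis using gen_ideal_of_ideal[OF q(1)] by (auto simp: gen_ideal_insert_iff)
  qed
  have "a \<in> q \<or> b \<in> q" if ab: "a * b \<in> q" for a b
  proof (rule ccontr)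
    assume "\<not> (a \<in> q \<or> b \<in> q)"
    then obtain s g t h where *: "s \<in> S" "s - a * g \<in> q" "t \<in> S" "t - b * h \<in> q"
      using meet by metis
    \<comment> \<open>If neither factor lay in \<open>q\<close>, maximality would give elements
      \<open>s\<close> and \<open>t\<close> of \<open>S\<close> congruent to multiples of
      \<open>a\<close> and \<open>b\<close> modulo \<open>q\<close>; this expression equals
      \<open>s * t\<close>.\<close>
    have "(s - a * g) * t + a * g * (t - b * h) + g * h * (a * b) \<in> q"
      using is_idealD(4)[OF q(1) *(2), of t] is_idealD(3)[OF q(1) *(4), of "a * g"] is_idealD(3)[OF q(1) ab, of "g * h"]
      by (intro is_idealD(2)[OF q(1)])
    then have "s * t \<in> q" by (simp add: algebra_simps)
    then show False using S(2)[OF *(1,3)] q(3) by auto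
  qed
  moreover have "q \<noteq> UNIV" using q(3) S(1) by auto
  ultimately have "is_prime_ideal q" using q(1) by (auto simp: is_prime_ideal_def)
  then show ?thesis using that q by auto
qed

text \<open>The chain is built downwards: \<open>p n\<close> is any prime over the whole sequence,
  and each step finds a prime strictly inside the previous one. \<open>j\<close> counts the steps
  made. No Noetherian assumption enters, in contrast to the usual argument with associated or
  minimal primes.\<close>

lemma regular_seq_imp_prime_chain:
  assumes reg: "regular_seq_quot I m n f"
  shows "j \<le> n \<Longrightarrow> \<exists>p. (\<forall>i. n - j \<le> i \<and> i \<le> n \<longrightarrow> is_prime_ideal (p i) \<and> gen_ideal (I \<union> f ` {..<i}) \<subseteq> p i)
     \<and> (\<forall>i. n - j \<le> i \<and> i < n \<longrightarrow> p i \<subset> p (Suc i))"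
proof (induction j)
  case 0
  have "1 \<notin> gen_ideal (I \<union> f ` {..<n})"
    using reg is_idealD(3)[OF is_ideal_gen_ideal, of 1 "I \<union> f ` {..<n}"] by (auto simp: regular_seq_quot_def)
  then obtain q where "is_prime_ideal q" "gen_ideal (I \<union> f ` {..<n}) \<subseteq> q"
    using prime_ideal_avoiding[OF is_ideal_gen_ideal, of "{1}" "I \<union> f ` {..<n}"] by auto
  then show ?case by (intro exI[of _ "\<lambda>_. q"]) auto
next
  case (Suc j)
  then obtain p where p: "\<And>i. n - j \<le> i \<Longrightarrow> i \<le> n \<Longrightarrow> is_prime_ideal (p i) \<and> gen_ideal (I \<union> f ` {..<i}) \<subseteq> p i"
    "\<And>i. n - j \<le> i \<Longrightarrow> i < n \<Longrightarrow> p i \<subset> p (Suc i)" by (metis Suc_leD)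
  define l where "l = n - Suc j"
  have l: "Suc l = n - j" "l < n" using Suc.prems by (auto simp: l_def)
  let ?J = "gen_ideal (I \<union> f ` {..<l})"
  let ?P = "p (Suc l)"
  have P: "is_prime_ideal ?P" "gen_ideal (I \<union> f ` {..<Suc l}) \<subseteq> ?P" using p(1)[of "Suc l"] l by auto
  have "?J \<subseteq> gen_ideal (I \<union> f ` {..<Suc l})" by (rule gen_ideal_mono) auto
  then have JP: "?J \<subseteq> ?P" using P(2) by simp
  have fP: "f l \<in> ?P" using P(2) gen_ideal_superset[of "I \<union> f ` {..<Suc l}"] by auto
  have cancel: "s \<in> ?J" if "f l ^ k * s \<in> ?J" for k s
    using that
  proof (induction k)
    case (Suc k)
    then have "f l * (f l ^ k * s) \<in> ?J" by (simp add: mult.assoc)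
    then have "f l ^ k * s \<in> ?J" using reg l unfolding regular_seq_quot_def by blast
    then show ?case by (rule Suc.IH)
  qed simp
  \<comment> \<open>A prime missing this set lies inside \<open>?P\<close> (take
    \<open>k = 0\<close>) and omits \<open>f l\<close> (take \<open>k = 1\<close>,
    \<open>s = 1\<close>). The set misses \<open>?J\<close> because \<open>f l\<close> can be
    cancelled modulo \<open>?J\<close> and \<open>?J\<close> lies in \<open>?P\<close>.\<close>
  let ?S = "{f l ^ k * s |k s. s \<notin> ?P}"
  have inS: "f l ^ k * s \<in> ?S" if "s \<notin> ?P" for k s using that by blast
  have one: "1 \<notin> ?P" using P(1) is_idealD(3)[of ?P 1] by (auto simp: is_prime_ideal_def)
  have disj: "?J \<inter> ?S = {}" using cancel JP by auto
  have "1 \<in> ?S" using inS[OF one, of 0] by simp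
  moreover have "a * b \<in> ?S" if ab: "a \<in> ?S" "b \<in> ?S" for a b
  proof -
    obtain k s where a: "a = f l ^ k * s" "s \<notin> ?P" using ab(1) by blast
    obtain k' s' where b: "b = f l ^ k' * s'" "s' \<notin> ?P" using ab(2) by blast
    have "s * s' \<notin> ?P" using a(2) b(2) P(1) unfolding is_prime_ideal_def by blast
    moreover have "a * b = f l ^ (k + k') * (s * s')" by (simp add: a b power_add ac_simps)
    ultimately show ?thesis by blast
  qed
  ultimately obtain q where q: "is_prime_ideal q" "?J \<subseteq> q" "q \<inter> ?S = {}"
    by (rule prime_ideal_avoiding[OF is_ideal_gen_ideal _ _ disj]) blast+
  have "q \<subseteq> ?P" using q(3) inS[of _ 0] by auto
  moreover have "f l \<notin> q" using q(3) inS[OF one, of 1] by auto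
  ultimately have qP: "q \<subset> ?P" using fP by auto
  have "\<forall>i. n - Suc j \<le> i \<and> i \<le> n \<longrightarrow> is_prime_ideal ((p(l := q)) i) \<and> gen_ideal (I \<union> f ` {..<i}) \<subseteq> (p(l := q)) i"
    using p(1) q l by (auto simp: l_def[symmetric])
  moreover have "\<forall>i. n - Suc j \<le> i \<and> i < n \<longrightarrow> (p(l := q)) i \<subset> (p(l := q)) (Suc i)"
  proof (intro allI impI)
    fix i assume i: "n - Suc j \<le> i \<and> i < n"
    show "(p(l := q)) i \<subset> (p(l := q)) (Suc i)"
    proof (cases "i = l")
      case False
      then show ?thesis using p(2)[of i] i l by (auto simp: l_def[symmetric])
    qed (use qP in auto)
  qed
  ultimately show ?case by blast
qed

lemma depth_quot_le_krull_dim_quot: "depth_quot I m \<le> krull_dim_quot I"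
  unfolding depth_quot_def
proof (rule Sup_least, clarify)
  fix n f assume "regular_seq_quot I m n f"
  from regular_seq_imp_prime_chain[OF this, of n] obtain p
    where p: "\<And>i. i \<le> n \<Longrightarrow> is_prime_ideal (p i) \<and> gen_ideal (I \<union> f ` {..<i}) \<subseteq> p i" "\<And>i. i < n \<Longrightarrow> p i \<subset> p (Suc i)"
    by auto
  have "I \<subseteq> p i" if "i \<le> n" for i
    using p(1)[OF that] gen_ideal_superset[of "I \<union> f ` {..<i}"] by auto
  then show "enat n \<le> krull_dim_quot I"
    unfolding krull_dim_quot_def using p by (intro Sup_upper CollectI exI[of _ n] conjI exI[of _ p]) simp_all
qed

lemma krull_dim_quot_antimono:
  assumes "I \<subseteq> J" shows "krull_dim_quot J \<le> krull_dim_quot I"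
  unfolding krull_dim_quot_def
proof (rule Sup_subset_mono, rule Collect_mono, clarify)
  fix n p assume "\<forall>i\<le>n. is_prime_ideal (p i) \<and> J \<subseteq> p i" "\<forall>i<n. p i \<subset> p (Suc i)"
  then show "\<exists>m. enat n = enat m \<and> (\<exists>p. (\<forall>i\<le>m. is_prime_ideal (p i) \<and> I \<subseteq> p i) \<and> (\<forall>i<m. p i \<subset> p (Suc i)))"
    using subset_trans[OF assms] by (intro exI[of _ n] conjI exI[of _ p]) simp_all
qed

text \<open>The supremum need not be attained, but it exceeds \<open>k\<close> strictly, so some
  regular sequence has length at least \<open>Suc k\<close>; an initial segment of it is again
  regular.\<close>

lemma depth_quot_ge_imp_regular_seq:
  assumes "enat (Suc k) \<le> depth_quot I m"
  obtains f where "regular_seq_quot I m (Suc k) f"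
proof -
  have "enat k < depth_quot I m" using assms by (metis Suc_ile_eq)
  then obtain l f where l: "enat k < enat l" "regular_seq_quot I m l f"
    unfolding depth_quot_def less_Sup_iff by auto
  then have "Suc k \<le> l" by simp
  then have "gen_ideal (I \<union> f ` {..<Suc k}) \<subseteq> gen_ideal (I \<union> f ` {..<l})" by (intro gen_ideal_mono) auto
  then have "gen_ideal (I \<union> f ` {..<Suc k}) \<noteq> UNIV" using l(2) unfolding regular_seq_quot_def by force
  moreover have "\<forall>i<Suc k. f i \<in> m \<and> (\<forall>g. f i * g \<in> gen_ideal (I \<union> f ` {..<i}) \<longrightarrow> g \<in> gen_ideal (I \<union> f ` {..<i}))"
    using l(2) \<open>Suc k \<le> l\<close> unfolding regular_seq_quot_def by (meson less_le_trans)
  ultimately have "regular_seq_quot I m (Suc k) f" unfolding regular_seq_quot_def by blast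
  then show ?thesis by (rule that)
qed

section \<open>Stanley--Reisner ideals\<close>

abbreviation lookup :: "('a \<Rightarrow>\<^sub>0 'b::zero) \<Rightarrow> 'a \<Rightarrow> 'b" where
  "lookup \<equiv> Poly_Mapping.lookup"

abbreviation keys :: "('a \<Rightarrow>\<^sub>0 'b::zero) \<Rightarrow> 'a set" where
  "keys \<equiv> Poly_Mapping.keys"

definition sqf :: "'v set \<Rightarrow> 'v \<Rightarrow>\<^sub>0 nat" where
  "sqf F = (\<Sum>v\<in>F. Poly_Mapping.single v 1)"

lemma lookup_sqf: "finite F \<Longrightarrow> lookup (sqf F) v = (if v \<in> F then 1 else 0)"
  by (auto simp: sqf_def lookup_sum lookup_single when_def)

lemma keys_sqf [simp]: "finite F \<Longrightarrow> keys (sqf F) = F"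
  by (auto simp: in_keys_iff lookup_sqf split: if_splits)

lemma keys_add_nat: "keys (a + b :: 'v \<Rightarrow>\<^sub>0 nat) = keys a \<union> keys b"
  by (auto simp: in_keys_iff lookup_add)

lemma keys_minus_single_subset: "keys (m - Poly_Mapping.single v 1 :: 'v \<Rightarrow>\<^sub>0 nat) \<subseteq> keys m"
  by (auto simp: in_keys_iff lookup_minus)

lemma single_plus_minus_single:
  "v \<in> keys m \<Longrightarrow> Poly_Mapping.single v 1 + (m - Poly_Mapping.single v 1) = (m :: 'v \<Rightarrow>\<^sub>0 nat)"
  by (rule poly_mapping_eqI) (auto simp: lookup_add lookup_minus lookup_single in_keys_iff when_def)

lemma sqf_minus_single:
  "finite F \<Longrightarrow> v \<in> F \<Longrightarrow> sqf F - Poly_Mapping.single v 1 = sqf (F - {v})"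
  by (rule poly_mapping_eqI) (auto simp: lookup_minus lookup_sqf lookup_single when_def)

lemma prod_pvar: "finite F \<Longrightarrow> (\<Prod>v\<in>F. pvar v) = (Poly_Mapping.single (sqf F) 1 :: ('v, 'k::field) mpoly)"
  by (induction F rule: finite_induct) (auto simp: sqf_def pvar_def mult_single)

lemma lookup_single_times:
  fixes p :: "('v, 'k::field) mpoly"
  shows "lookup (Poly_Mapping.single a c * p) (a + b) = c * lookup p b"
  by (simp add: lookup_mult lookup_single when_mult)

lemma lookup_single_times_eq_0:
  fixes p :: "('v, 'k::field) mpoly"
  assumes "\<And>b. m \<noteq> a + b"
  shows "lookup (Poly_Mapping.single a c * p) m = 0"
  using assms by (simp add: lookup_mult lookup_single when_mult)

lemma lookup_pvar_times:
  fixes p :: "('v, 'k::field) mpoly"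
  shows "lookup (pvar v * p) m = (if v \<in> keys m then lookup p (m - Poly_Mapping.single v 1) else 0)"
proof (cases "v \<in> keys m")
  case True
  then show ?thesis
    using lookup_single_times[of "Poly_Mapping.single v 1" 1 p "m - Poly_Mapping.single v 1"]
    by (simp add: single_plus_minus_single[OF True, unfolded One_nat_def] pvar_def)
next
  case False
  have "m \<noteq> Poly_Mapping.single v 1 + b" for b
    using False by (auto simp: keys_add_nat)
  then show ?thesis using False by (simp add: pvar_def lookup_single_times_eq_0)
qed

lemma lookup_sum_pvar_times:
  fixes p :: "('v, 'k::field) mpoly"
  assumes "finite A"
  shows "lookup ((\<Sum>v\<in>A. pvar v) * p) m = (\<Sum>v\<in>A \<inter> keys m. lookup p (m - Poly_Mapping.single v 1))"
proof -
  have "lookup ((\<Sum>v\<in>A. pvar v) * p) m = (\<Sum>v\<in>A. if v \<in> keys m then lookup p (m - Poly_Mapping.single v 1) else 0)"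
    by (simp add: sum_distrib_right lookup_sum lookup_pvar_times)
  also have "\<dots> = (\<Sum>v\<in>A \<inter> keys m. lookup p (m - Poly_Mapping.single v 1))"
    by (rule sum.inter_restrict[symmetric, OF assms])
  finally show ?thesis .
qed

lemma poly_mapping_eq_sum_single:
  fixes p :: "'a \<Rightarrow>\<^sub>0 'b::comm_monoid_add"
  shows "p = (\<Sum>m\<in>keys p. Poly_Mapping.single m (lookup p m))"
  by (rule poly_mapping_eqI)
     (auto simp: lookup_sum lookup_single when_def in_keys_iff)

definition simplicial :: "'v set set \<Rightarrow> bool" where
  "simplicial \<Delta> \<longleftrightarrow> {} \<in> \<Delta> \<and> (\<forall>G\<in>\<Delta>. \<forall>F. F \<subseteq> G \<longrightarrow> F \<in> \<Delta>)"

lemma simplicialD: "simplicial \<Delta> \<Longrightarrow> G \<in> \<Delta> \<Longrightarrow> F \<subseteq> G \<Longrightarrow> F \<in> \<Delta>"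
  by (auto simp: simplicial_def)

text \<open>A monomial ideal is determined coefficientwise, and a monomial lies in this one iff its
  support is a non-face. All later computations modulo the ideal compare coefficients at exponents
  supported on faces.\<close>

lemma SR_ideal_iff:
  fixes p :: "('v, 'k::field) mpoly"
  assumes "simplicial \<Delta>"
  shows "p \<in> SR_ideal \<Delta> \<longleftrightarrow> (\<forall>m. keys m \<in> \<Delta> \<longrightarrow> lookup p m = 0)"
proof
  let ?J = "{p :: ('v, 'k) mpoly. \<forall>m. keys m \<in> \<Delta> \<longrightarrow> lookup p m = 0}"
  have "r * p \<in> ?J" if p: "p \<in> ?J" for r p
  proof (clarify, rule ccontr)
    fix m assume m: "keys m \<in> \<Delta>" "lookup (r * p) m \<noteq> 0"
    then obtain a b where ab: "m = a + b" "b \<in> keys p"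
      using keys_mult[of r p] by (auto simp: in_keys_iff)
    then have "keys b \<in> \<Delta>" using simplicialD[OF assms m(1)] by (simp add: keys_add_nat)
    then show False using p ab(2) by (auto simp: in_keys_iff)
  qed
  then have "is_ideal ?J" by (auto simp: is_ideal_def lookup_add)
  moreover have "{\<Prod>v\<in>F. pvar v |F. finite F \<and> F \<notin> \<Delta>} \<subseteq> ?J"
    by (auto simp: prod_pvar lookup_single when_def)
  ultimately have "SR_ideal \<Delta> \<subseteq> ?J" unfolding SR_ideal_def by (rule gen_ideal_least)
  then show "p \<in> SR_ideal \<Delta> \<Longrightarrow> \<forall>m. keys m \<in> \<Delta> \<longrightarrow> lookup p m = 0" by auto
next
  assume *: "\<forall>m. keys m \<in> \<Delta> \<longrightarrow> lookup p m = 0"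
  have "Poly_Mapping.single m (lookup p m) \<in> SR_ideal \<Delta>" if "m \<in> keys p" for m
  proof -
    have "keys m \<notin> \<Delta>" using * that by (auto simp: in_keys_iff)
    then have "(\<Prod>v\<in>keys m. pvar v) \<in> (SR_ideal \<Delta> :: ('v, 'k) mpoly set)"
      unfolding SR_ideal_def using gen_ideal_superset by fastforce
    then have mem: "Poly_Mapping.single (sqf (keys m)) 1 \<in> (SR_ideal \<Delta> :: ('v, 'k) mpoly set)"
      by (simp add: prod_pvar)
    have eq: "Poly_Mapping.single m (lookup p m) =
        Poly_Mapping.single (m - sqf (keys m)) (lookup p m) * Poly_Mapping.single (sqf (keys m)) 1"
    proof -
      have "m - sqf (keys m) + sqf (keys m) = m"
        by (rule poly_mapping_eqI) (auto simp: lookup_add lookup_minus lookup_sqf in_keys_iff)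
      then show ?thesis by (simp add: mult_single)
    qed
    show ?thesis
      unfolding eq using mem unfolding SR_ideal_def by (rule is_idealD(3)[OF is_ideal_gen_ideal])
  qed
  then have "(\<Sum>m\<in>keys p. Poly_Mapping.single m (lookup p m)) \<in> SR_ideal \<Delta>"
    unfolding SR_ideal_def by (intro is_ideal_sum is_ideal_gen_ideal)
  then show "p \<in> SR_ideal \<Delta>" using poly_mapping_eq_sum_single[of p] by simp
qed

lemma is_ideal_SR_ideal: "is_ideal (SR_ideal \<Delta>)"
  unfolding SR_ideal_def by (rule is_ideal_gen_ideal)

section \<open>From regular sequences to exactness\<close>

text \<open>Exactness of the Koszul complex over the quotient by \<open>J\<close>, with
  representatives in the ring itself: equations become memberships in \<open>J\<close>, so that no
  quotient ring has to be formed as \<open>J\<close> varies.\<close>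

definition koszul_exact :: "('v \<Rightarrow> nat) \<Rightarrow> ('v \<Rightarrow> 'r::comm_ring_1) \<Rightarrow> 'v set \<Rightarrow> 'r set \<Rightarrow> nat \<Rightarrow> bool" where
  "koszul_exact \<nu> x V J n \<longleftrightarrow>
     (\<forall>i<n. \<forall>c. (\<forall>W. W \<subseteq> V \<and> card W = Suc i \<longrightarrow> cob \<nu> x (Pow V) c W \<in> J) \<longrightarrow>
        (\<exists>b. \<forall>W. W \<subseteq> V \<and> card W = i \<longrightarrow> c W - cob \<nu> x (Pow V) b W \<in> J))"

lemma cob_in_ideal:
  assumes "is_ideal J" "finite W" "card W = Suc j" "W \<subseteq> V"
    and "\<And>W. W \<subseteq> V \<Longrightarrow> card W = j \<Longrightarrow> c W \<in> J"
  shows "cob \<nu> x (Pow V) c W \<in> J"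
  unfolding cob_def
  by (rule is_ideal_sum[OF assms(1)], rule is_idealD(3)[OF assms(1)]) (use assms in auto)

lemma cob_sum_scale: "cob \<nu> x X (\<lambda>G. \<Sum>u\<in>A. g u * c u G) G = (\<Sum>u\<in>A. g u * cob \<nu> x X (c u) G)"
  unfolding cob_def sum_distrib_left
  by (subst sum.swap) (auto intro!: sum.cong simp: algebra_simps)

text \<open>Multiplication by an element of the ideal of the \<open>x u\<close> is null-homotopic on the Koszul complex.
  If it is also injective, cocycles are lifted from the quotient, at the cost of one degree.\<close>

lemma koszul_exact_step:
  fixes f :: "'r::comm_ring_1" and V :: "'v set"
  assumes fin: "finite V" and inj: "inj_on \<nu> V" and J: "is_ideal J"
    and f: "f - (\<Sum>u\<in>V. g u * x u) \<in> J" and reg: "\<And>a. f * a \<in> J \<Longrightarrow> a \<in> J"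
    and ex: "koszul_exact \<nu> x V (gen_ideal (insert f J)) n"
  shows "koszul_exact \<nu> x V J (Suc n)"
  unfolding koszul_exact_def
proof (intro allI impI)
  fix i and c :: "'v set \<Rightarrow> 'r"
  assume i: "i < Suc n" and c: "\<forall>W. W \<subseteq> V \<and> card W = Suc i \<longrightarrow> cob \<nu> x (Pow V) c W \<in> J"
  have or: "oriented \<nu> (Pow V)" using fin inj by (auto simp: oriented_def finite_subset inj_on_subset)
  have conv: "convex_family (Pow V)" by (auto simp: convex_family_def)
  \<comment> \<open>The null-homotopy for multiplication by \<open>f\<close>, namely the combination
    of the contractions with the coefficients of \<open>f\<close>. Since \<open>c\<close> is a
    cocycle modulo \<open>J\<close>, \<open>f * c\<close> is the coboundary of \<open>b\<close>
    modulo \<open>J\<close>.\<close>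
  define b where "b W = (\<Sum>u\<in>V. g u * cob_homotopy \<nu> u c W)" for W
  have fc: "f * c W - cob \<nu> x (Pow V) b W \<in> J" if W: "W \<subseteq> V" "card W = i" for W
  proof -
    have hJ: "cob_homotopy \<nu> u (cob \<nu> x (Pow V) c) W \<in> J" if "u \<in> V" for u
      using c W that finite_subset[OF W(1) fin]
      by (auto simp: cob_homotopy_def is_idealD(1)[OF J] intro!: is_idealD(3)[OF J])
    have "cob \<nu> x (Pow V) (cob_homotopy \<nu> u c) W = x u * c W - cob_homotopy \<nu> u (cob \<nu> x (Pow V) c) W" if "u \<in> V" for u
      using cob_homotopy_formula[OF or, of u W x c] W that by (auto simp: algebra_simps)
    then have "cob \<nu> x (Pow V) b W = (\<Sum>u\<in>V. g u * (x u * c W - cob_homotopy \<nu> u (cob \<nu> x (Pow V) c) W))"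
      unfolding b_def[abs_def] cob_sum_scale by (intro sum.cong) auto
    also have "\<dots> = (\<Sum>u\<in>V. g u * x u) * c W - (\<Sum>u\<in>V. g u * cob_homotopy \<nu> u (cob \<nu> x (Pow V) c) W)"
      by (simp add: algebra_simps sum_subtractf sum_distrib_left)
    finally have "f * c W - cob \<nu> x (Pow V) b W =
        (f - (\<Sum>u\<in>V. g u * x u)) * c W + (\<Sum>u\<in>V. g u * cob_homotopy \<nu> u (cob \<nu> x (Pow V) c) W)"
      by (simp add: algebra_simps)
    also have "\<dots> \<in> J"
      using f hJ by (intro is_idealD(2)[OF J] is_ideal_sum[OF J] is_idealD(4)[OF J f] is_idealD(3)[OF J])
    finally show ?thesis .
  qed
  show "\<exists>b. \<forall>W. W \<subseteq> V \<and> card W = i \<longrightarrow> c W - cob \<nu> x (Pow V) b W \<in> J"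
  proof (cases i)
    case 0
    have "c W - cob \<nu> x (Pow V) b W \<in> J" if W: "W \<subseteq> V" "card W = i" for W
    proof -
      have "W = {}" using W 0 finite_subset[OF W(1) fin] by simp
      then show ?thesis using fc[OF W] reg by (simp add: cob_def)
    qed
    then show ?thesis by blast
  next
    case (Suc j)
    let ?K = "gen_ideal (insert f J)"
    have K: "is_ideal ?K" "J \<subseteq> ?K" "f \<in> ?K" using is_ideal_gen_ideal gen_ideal_superset[of "insert f J"] by auto
    \<comment> \<open>As \<open>f\<close> lies in \<open>?K\<close>, so does \<open>f * c\<close>;
      hence \<open>b\<close> is a cocycle over the smaller quotient, one degree below
      \<open>c\<close>, where exactness is already available.\<close>
    have "cob \<nu> x (Pow V) b W \<in> ?K" if W: "W \<subseteq> V" "card W = Suc j" for W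
    proof -
      have "f * c W - (f * c W - cob \<nu> x (Pow V) b W) \<in> ?K"
        using fc[of W] W Suc K(2) is_idealD(4)[OF K(1,3)] by - (rule is_ideal_diff[OF K(1)], auto)
      then show ?thesis by simp
    qed
    then obtain e where e: "\<And>W. W \<subseteq> V \<Longrightarrow> card W = j \<Longrightarrow> b W - cob \<nu> x (Pow V) e W \<in> ?K"
      using ex i Suc unfolding koszul_exact_def by (metis Suc_less_eq)
    have "\<forall>W. \<exists>u. W \<subseteq> V \<and> card W = j \<longrightarrow> b W - cob \<nu> x (Pow V) e W - f * u \<in> J"
      using e unfolding gen_ideal_insert_iff gen_ideal_of_ideal[OF J] by blast
    then obtain u where u: "\<And>W. W \<subseteq> V \<Longrightarrow> card W = j \<Longrightarrow> b W - cob \<nu> x (Pow V) e W - f * u W \<in> J"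
      by metis
    \<comment> \<open>Applying the coboundary to \<open>b\<close>, which is
      \<open>cob e + f * u\<close> modulo \<open>J\<close>, removes \<open>e\<close>. Thus
      \<open>f * (c - cob u)\<close> lies in \<open>J\<close>, and \<open>f\<close> is
      cancelled.\<close>
    have "c W - cob \<nu> x (Pow V) u W \<in> J" if W: "W \<subseteq> V" "card W = i" for W
    proof -
      have "cob \<nu> x (Pow V) (\<lambda>W. b W - cob \<nu> x (Pow V) e W - f * u W) W \<in> J"
        using W Suc u by (intro cob_in_ideal[OF J finite_subset[OF W(1) fin]]) auto
      then have "cob \<nu> x (Pow V) b W - f * cob \<nu> x (Pow V) u W \<in> J"
        using cob_cob[OF or conv, of W x e] W by (simp add: cob_diff cob_scale)
      then have "(f * c W - cob \<nu> x (Pow V) b W) + (cob \<nu> x (Pow V) b W - f * cob \<nu> x (Pow V) u W) \<in> J"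
        by (rule is_idealD(2)[OF J fc[OF W]])
      then show ?thesis using reg[of "c W - cob \<nu> x (Pow V) u W"] by (simp add: algebra_simps)
    qed
    then show ?thesis by blast
  qed
qed

text \<open>Start with the quotient by all of \<open>f\<close>, where nothing is claimed, and drop
  the members from the last to the first; each one dropped gains a degree by
  \<open>koszul_exact_step\<close>.\<close>

lemma koszul_exact_of_regular_seq:
  assumes fin: "finite V" and inj: "inj_on \<nu> V" and I: "is_ideal I"
    and reg: "regular_seq_quot I m n f"
    and m: "\<And>a. a \<in> m \<Longrightarrow> \<exists>g. a - (\<Sum>u\<in>V. g u * x u) \<in> I"
  shows "koszul_exact \<nu> x V I n"
proof -
  have "koszul_exact \<nu> x V (gen_ideal (I \<union> f ` {..<n - j})) j" if "j \<le> n" for j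
    using that
  proof (induction j)
    case 0
    then show ?case by (simp add: koszul_exact_def)
  next
    case (Suc j)
    define l where "l = n - Suc j"
    have l: "l < n" "n - j = Suc l" using Suc.prems by (auto simp: l_def)
    let ?J = "gen_ideal (I \<union> f ` {..<l})"
    have "f l \<in> m" using reg l by (auto simp: regular_seq_quot_def)
    then obtain g where "f l - (\<Sum>u\<in>V. g u * x u) \<in> I" using m by blast
    then have g: "f l - (\<Sum>u\<in>V. g u * x u) \<in> ?J" using gen_ideal_superset[of "I \<union> f ` {..<l}"] by auto
    have "gen_ideal (insert (f l) ?J) = gen_ideal (insert (f l) (I \<union> f ` {..<l}))"
      by (auto simp: gen_ideal_insert_iff gen_ideal_of_ideal[OF is_ideal_gen_ideal])
    then have "koszul_exact \<nu> x V (gen_ideal (insert (f l) ?J)) j"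
      using Suc l by (simp add: gen_ideal_Un_image_Suc)
    moreover have "a \<in> ?J" if "f l * a \<in> ?J" for a using reg l that unfolding regular_seq_quot_def by blast
    ultimately have "koszul_exact \<nu> x V ?J (Suc j)"
      by (intro koszul_exact_step[OF fin inj is_ideal_gen_ideal g])
    then show ?case by (simp add: l_def)
  qed
  from this[of n] show ?thesis using I by (simp add: gen_ideal_of_ideal)
qed

text \<open>\<open>osgn\<close> is polymorphic: the same sign occurs in the polynomial ring and in
  \<open>k\<close>, and coefficient extraction must identify the two.\<close>

lemma osgn_eq_1_or_minus_1:
  "((osgn \<nu> v W :: 'r::comm_ring_1) = 1 \<and> (osgn \<nu> v W :: 's::comm_ring_1) = 1) \<or>
   ((osgn \<nu> v W :: 'r) = - 1 \<and> (osgn \<nu> v W :: 's) = - 1)"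
  by (cases "even (card {w \<in> W. \<nu> w < \<nu> v})") (auto simp: osgn_def)

lemma lookup_osgn_times:
  fixes p :: "('v, 'k::field) mpoly"
  shows "lookup (osgn \<nu> v W * p) m = osgn \<nu> v W * lookup p m"
  using osgn_eq_1_or_minus_1[of \<nu> v W, where ?'r = "('v, 'k) mpoly" and ?'s = 'k] by auto

text \<open>A face \<open>G\<close> disjoint from \<open>U\<close> corresponds to the monomial
  \<open>x^G\<close> placed at the index \<open>G \<union> U\<close>. Modulo the ideal this monomial
  survives exactly for faces, and the index has \<open>card U\<close> more elements, which is the
  loss in degree.\<close>

lemma exact_deletion_of_koszul_exact:
  fixes \<Delta> :: "'v set set"
  assumes fin: "finite V" and inj: "inj_on \<nu> V" and \<Delta>: "simplicial \<Delta>" "\<And>G. G \<in> \<Delta> \<Longrightarrow> G \<subseteq> V"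
    and ex: "koszul_exact \<nu> pvar V (SR_ideal \<Delta> :: ('v, 'k::field) mpoly set) d" and U: "U \<subseteq> V"
  shows "exact_below TYPE('k) \<nu> {G \<in> \<Delta>. G \<inter> U = {}} (d - card U)"
proof (rule exact_belowI)
  fix i and c :: "'v set \<Rightarrow> 'k"
  let ?X = "{G \<in> \<Delta>. G \<inter> U = {}}"
  assume i: "i < d - card U" and c: "\<And>G. G \<in> ?X \<Longrightarrow> card G = Suc i \<Longrightarrow> cob \<nu> (\<lambda>_. 1) ?X c G = 0"
  have finU: "finite U" using U fin finite_subset by auto
  \<comment> \<open>\<open>t v\<close> is the sign that the elements of \<open>U\<close> preceding
    \<open>v\<close> contribute to \<open>osgn \<nu> v (G \<union> U)\<close>. Multiplying the value
    at \<open>G\<close> by the product \<open>\<epsilon> G\<close> absorbs it.\<close>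
  define t :: "'v \<Rightarrow> 'k" where "t v = (-1) ^ card {u \<in> U. \<nu> u < \<nu> v}" for v
  define \<epsilon> where "\<epsilon> F = prod t F" for F
  have t2: "t v * t v = 1" for v by (simp add: t_def flip: power_mult_distrib)
  have \<epsilon>2: "\<epsilon> F * \<epsilon> F = 1" for F by (simp add: \<epsilon>_def t2 flip: prod.distrib)
  have \<epsilon>2': "\<epsilon> F * (\<epsilon> F * a) = a" for F a by (simp add: \<epsilon>2 flip: mult.assoc)
  have \<epsilon>rem: "t v * \<epsilon> (G - {v}) = \<epsilon> G" if "finite G" "v \<in> G" for G v
    using that by (simp add: \<epsilon>_def prod.remove)
  have sgU: "osgn \<nu> v (G \<union> U) = osgn \<nu> v G * t v" if "finite G" "G \<inter> U = {}" for v G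
  proof -
    have "{w \<in> G \<union> U. \<nu> w < \<nu> v} = {w \<in> G. \<nu> w < \<nu> v} \<union> {u \<in> U. \<nu> u < \<nu> v}" by auto
    then have "card {w \<in> G \<union> U. \<nu> w < \<nu> v} = card {w \<in> G. \<nu> w < \<nu> v} + card {u \<in> U. \<nu> u < \<nu> v}"
      using that finU by (subst card_Un_disjoint[symmetric]) auto
    then show ?thesis by (simp add: osgn_def t_def power_add)
  qed
  have finG: "finite G" if "G \<in> \<Delta>" for G using \<Delta>(2)[OF that] fin finite_subset by auto
  have lowX: "{v. v \<in> G \<and> G - {v} \<in> ?X} = G" if "G \<in> ?X" for G
    using that simplicialD[OF \<Delta>(1), of G] by auto
  have lowV: "{v. v \<in> W \<and> W - {v} \<in> Pow V} = W" if "W \<subseteq> V" for W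
    using that by auto
  \<comment> \<open>These cochains live in the multidegree of the Koszul complex that is \<open>-1\<close> on \<open>U\<close> and \<open>0\<close> elsewhere.\<close>
  define C :: "'v set \<Rightarrow> ('v, 'k) mpoly" where
    "C W = (if U \<subseteq> W then Poly_Mapping.single (sqf (W - U)) (\<epsilon> (W - U) * c (W - U)) else 0)" for W
  have "cob \<nu> pvar (Pow V) C W \<in> SR_ideal \<Delta>" if W: "W \<subseteq> V" "card W = Suc (i + card U)" for W
    unfolding SR_ideal_iff[OF \<Delta>(1)]
  proof (intro allI impI)
    fix m :: "'v \<Rightarrow>\<^sub>0 nat" assume m: "keys m \<in> \<Delta>"
    have finW: "finite W" using W fin finite_subset by auto
    have lk: "lookup (cob \<nu> pvar (Pow V) C W) m = (\<Sum>v\<in>W. osgn \<nu> v W * lookup (pvar v * C (W - {v})) m)"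
      unfolding cob_def lowV[OF W(1)] by (simp add: lookup_sum lookup_osgn_times mult.assoc)
    define G where "G = W - U"
    have pv: "pvar v * C (W - {v}) = (if v \<in> G \<and> U \<subseteq> W then Poly_Mapping.single (sqf G) (\<epsilon> (G - {v}) * c (G - {v})) else 0)"
      if "v \<in> W" for v
    proof (cases "v \<in> G \<and> U \<subseteq> W")
      case True
      have "Poly_Mapping.single v 1 + sqf (G - {v}) = sqf G"
        using True finW sum.remove[of G v "\<lambda>v. Poly_Mapping.single v (1::nat)"] by (simp add: sqf_def G_def)
      moreover have "W - {v} - U = G - {v}" by (auto simp: G_def)
      moreover have "U \<subseteq> W - {v}" using True by (auto simp: G_def)
      ultimately show ?thesis using True by (simp add: C_def pvar_def mult_single)
    next
      case False
      then have "\<not> U \<subseteq> W - {v}" using that by (auto simp: G_def)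
      then show ?thesis using False by (auto simp: C_def)
    qed
    show "lookup (cob \<nu> pvar (Pow V) C W) m = 0"
    proof (cases "U \<subseteq> W \<and> sqf G = m")
      case False
      then show ?thesis unfolding lk by (intro sum.neutral) (auto simp: pv lookup_single when_def)
    next
      case True
      have finG': "finite G" using finW by (simp add: G_def)
      have GX: "G \<in> ?X" using m True finG' by (auto simp: G_def)
      have "card G = Suc i" using True W(2) finW finU by (simp add: G_def card_Diff_subset)
      have WG: "W = G \<union> U" using True by (auto simp: G_def)
      have "(\<Sum>v\<in>W. osgn \<nu> v W * lookup (pvar v * C (W - {v})) m) =
          (\<Sum>v\<in>G. osgn \<nu> v W * (\<epsilon> (G - {v}) * c (G - {v})))"
        using True finW by (intro sum.mono_neutral_cong_right) (auto simp: pv G_def)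
      also have "\<dots> = (\<Sum>v\<in>G. \<epsilon> G * (osgn \<nu> v G * c (G - {v})))"
      proof (rule sum.cong, simp)
        fix v assume v: "v \<in> G"
        have "osgn \<nu> v W = osgn \<nu> v G * t v" unfolding WG using finG' by (rule sgU) (auto simp: G_def)
        then show "osgn \<nu> v W * (\<epsilon> (G - {v}) * c (G - {v})) = \<epsilon> G * (osgn \<nu> v G * c (G - {v}))"
          using \<epsilon>rem[OF finG' v, symmetric] by (simp add: ac_simps)
      qed
      also have "\<dots> = \<epsilon> G * cob \<nu> (\<lambda>_. 1) ?X c G"
        unfolding cob_def lowX[OF GX] by (simp add: sum_distrib_left)
      finally show ?thesis using c[OF GX \<open>card G = Suc i\<close>] lk by simp
    qed
  qed
  moreover have "i + card U < d" using i by simp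
  ultimately obtain B where B: "\<And>W. W \<subseteq> V \<Longrightarrow> card W = i + card U \<Longrightarrow> C W - cob \<nu> pvar (Pow V) B W \<in> SR_ideal \<Delta>"
    using ex unfolding koszul_exact_def by metis
  \<comment> \<open>Only the component of \<open>B\<close> in the chosen multidegree matters; it is
    read off as one coefficient for each face.\<close>
  define b where "b H = \<epsilon> H * lookup (B (H \<union> U)) (sqf H)" for H
  have "c G = cob \<nu> (\<lambda>_. 1) ?X b G" if GX: "G \<in> ?X" "card G = i" for G
  proof -
    define W where "W = G \<union> U"
    have finG': "finite G" using finG GX by auto
    have W: "W \<subseteq> V" "card W = i + card U" "U \<subseteq> W" "W - U = G"
      using GX \<Delta>(2)[of G] U finG' finU by (auto simp: W_def card_Un_disjoint)
    have "lookup (C W - cob \<nu> pvar (Pow V) B W) (sqf G) = 0"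
      using B[OF W(1,2)] GX finG' unfolding SR_ideal_iff[OF \<Delta>(1)] by simp
    then have "\<epsilon> G * c G = lookup (cob \<nu> pvar (Pow V) B W) (sqf G)"
      by (simp add: lookup_minus C_def W)
    also have "\<dots> = (\<Sum>v\<in>W. osgn \<nu> v W * lookup (pvar v * B (W - {v})) (sqf G))"
      unfolding cob_def lowV[OF W(1)] by (simp add: lookup_sum lookup_osgn_times mult.assoc)
    also have "\<dots> = (\<Sum>v\<in>G. osgn \<nu> v W * lookup (B (W - {v})) (sqf (G - {v})))"
      using finG' finU
      by (intro sum.mono_neutral_cong_right) (auto simp: W_def lookup_pvar_times sqf_minus_single[unfolded One_nat_def])
    also have "\<dots> = (\<Sum>v\<in>G. \<epsilon> G * (osgn \<nu> v G * b (G - {v})))"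
    proof (rule sum.cong, simp)
      fix v assume v: "v \<in> G"
      have 1: "osgn \<nu> v W = osgn \<nu> v G * t v" unfolding W_def using finG' GX by (intro sgU) auto
      have "W - {v} = (G - {v}) \<union> U" using v GX by (auto simp: W_def)
      then have "\<epsilon> (G - {v}) * b (G - {v}) = lookup (B (W - {v})) (sqf (G - {v}))"
        by (simp add: b_def \<epsilon>2')
      then show "osgn \<nu> v W * lookup (B (W - {v})) (sqf (G - {v})) = \<epsilon> G * (osgn \<nu> v G * b (G - {v}))"
        using \<epsilon>rem[OF finG' v, symmetric] 1 by (simp add: ac_simps)
    qed
    also have "\<dots> = \<epsilon> G * cob \<nu> (\<lambda>_. 1) ?X b G"
      unfolding cob_def lowX[OF GX(1)] by (simp add: sum_distrib_left)
    finally have "\<epsilon> G * (\<epsilon> G * c G) = \<epsilon> G * (\<epsilon> G * cob \<nu> (\<lambda>_. 1) ?X b G)" by simp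
    then show ?thesis by (simp add: \<epsilon>2')
  qed
  then show "\<exists>b. \<forall>G\<in>?X. card G = i \<longrightarrow> c G = cob \<nu> (\<lambda>_. 1) ?X b G" by blast
qed

text \<open>Vertices are moved one by one from "allowed" to "required". The faces over
  \<open>F\<close> avoiding \<open>U\<close> split by whether they contain \<open>v\<close>; those
  that do not have \<open>v\<close> deleted as well, which costs one degree, exactly what
  \<open>exact_below_upper\<close> permits. This is why \<open>U\<close> is carried along although
  the target is \<open>U = {}\<close>.\<close>

lemma exact_star_of_exact_deletion:
  fixes \<Delta> :: "'v set set"
  assumes fin: "finite V" and inj: "inj_on \<nu> V" and \<Delta>: "simplicial \<Delta>" "\<And>G. G \<in> \<Delta> \<Longrightarrow> G \<subseteq> V"
    and ex: "\<And>U. U \<subseteq> V \<Longrightarrow> exact_below TYPE('k::field) \<nu> {G \<in> \<Delta>. G \<inter> U = {}} (d - card U)"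
    and F: "finite F" "F \<subseteq> V"
  shows "U \<subseteq> V - F \<Longrightarrow> exact_below TYPE('k) \<nu> {G \<in> \<Delta>. F \<subseteq> G \<and> G \<inter> U = {}} (d - card U)"
  using F
proof (induction F arbitrary: U rule: finite_induct)
  case empty
  then show ?case using ex by simp
next
  case (insert v F)
  have fU: "finite U" using insert.prems fin by (meson Diff_subset finite_subset)
  show ?case
  proof (rule exact_below_upper)
    show "oriented \<nu> {G \<in> \<Delta>. F \<subseteq> G \<and> G \<inter> U = {}}"
      unfolding oriented_def using \<Delta>(2) fin inj by (auto intro: finite_subset inj_on_subset)
    show "convex_family {G \<in> \<Delta>. F \<subseteq> G \<and> G \<inter> U = {}}"
      unfolding convex_family_def using simplicialD[OF \<Delta>(1)] by blast
    show "exact_below TYPE('k) \<nu> {G \<in> \<Delta>. F \<subseteq> G \<and> G \<inter> U = {}} (d - card U)"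
      using insert by auto
    have "exact_below TYPE('k) \<nu> {G \<in> \<Delta>. F \<subseteq> G \<and> G \<inter> insert v U = {}} (d - card (insert v U))"
      using insert by (intro insert.IH) auto
    moreover have "d - card (insert v U) = d - card U - 1" using insert.prems fU by (subst card_insert_disjoint) auto
    ultimately show "exact_below TYPE('k) \<nu> {G \<in> \<Delta>. F \<subseteq> G \<and> G \<inter> insert v U = {}} (d - card U - 1)"
      by simp
  qed auto
qed

section \<open>From exactness to regular sequences\<close>

lemma convex_family_simplicial:
  assumes "simplicial \<Gamma>" and P: "\<And>A B C. A \<subseteq> B \<Longrightarrow> B \<subseteq> C \<Longrightarrow> P A \<Longrightarrow> P C \<Longrightarrow> P B"
  shows "convex_family {G \<in> \<Gamma>. P G}"
  unfolding convex_family_def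
proof (intro ballI allI impI)
  fix A B C assume "A \<in> {G \<in> \<Gamma>. P G}" "C \<in> {G \<in> \<Gamma>. P G}" "A \<subseteq> B \<and> B \<subseteq> C"
  then show "B \<in> {G \<in> \<Gamma>. P G}" using simplicialD[OF assms(1), of C B] P[of A B C] by simp
qed

text \<open>Balanced complexes, except that facets need not use all \<open>n\<close> colours. The
  colouring also serves as the vertex order for signs.\<close>

definition coloured :: "('v \<Rightarrow> nat) \<Rightarrow> nat \<Rightarrow> 'v set \<Rightarrow> 'v set set \<Rightarrow> bool" where
  "coloured \<rho> n V \<Gamma> \<longleftrightarrow> finite V \<and> simplicial \<Gamma> \<and> \<rho> ` V \<subseteq> {..<n} \<and> (\<forall>G\<in>\<Gamma>. G \<subseteq> V \<and> inj_on \<rho> G)"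

lemma colouredD:
  assumes "coloured \<rho> n V \<Gamma>"
  shows "finite V" "simplicial \<Gamma>" "G \<in> \<Gamma> \<Longrightarrow> G \<subseteq> V" "G \<in> \<Gamma> \<Longrightarrow> inj_on \<rho> G" "G \<in> \<Gamma> \<Longrightarrow> finite G"
    "v \<in> V \<Longrightarrow> \<rho> v < n" "finite \<Gamma>" "oriented \<rho> \<Gamma>"
proof -
  show V: "finite V" and "simplicial \<Gamma>" and "v \<in> V \<Longrightarrow> \<rho> v < n"
    and sub: "\<And>G. G \<in> \<Gamma> \<Longrightarrow> G \<subseteq> V" and inj: "\<And>G. G \<in> \<Gamma> \<Longrightarrow> inj_on \<rho> G"
    using assms by (auto simp: coloured_def)
  show fin: "G \<in> \<Gamma> \<Longrightarrow> finite G" for G using sub V by (blast intro: finite_subset)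
  show "finite \<Gamma>" using sub V by (intro finite_subset[of \<Gamma> "Pow V"]) auto
  show "oriented \<rho> \<Gamma>" using fin inj by (simp add: oriented_def)
qed

text \<open>Rank selection, discarding one colour \<open>j\<close> at a time. The faces using
  \<open>j\<close> fall into stars of the vertices of colour \<open>j\<close>, for which the
  induction hypothesis holds with a larger \<open>F\<close>; \<open>exact_below_lower\<close> then
  passes to the faces without \<open>j\<close>, at the price of one degree.\<close>

lemma exact_colour_selection:
  fixes \<Gamma> :: "'v set set"
  assumes col: "coloured \<rho> n V \<Gamma>"
    and ex: "\<And>F. F \<in> \<Gamma> \<Longrightarrow> exact_below TYPE('k::field) \<rho> {G \<in> \<Gamma>. F \<subseteq> G} n"
    and T: "T \<subseteq> {..<n}" and F: "F \<in> \<Gamma>" "\<rho> ` F \<subseteq> T"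
  shows "exact_below TYPE('k) \<rho> {G \<in> \<Gamma>. F \<subseteq> G \<and> \<rho> ` G \<subseteq> T} (card T)"
proof -
  note C = colouredD[OF col]
  obtain g :: "'v \<Rightarrow> nat" where g: "inj_on g V" using finite_imp_inj_to_nat_seg[OF C(1)] by auto
  have main: "exact_below TYPE('k) \<rho> {G \<in> \<Gamma>. F \<subseteq> G \<and> \<rho> ` G \<subseteq> {..<n} - S} (card ({..<n} - S))"
    if "finite S" "S \<subseteq> {..<n}" "F \<in> \<Gamma>" "\<rho> ` F \<subseteq> {..<n} - S" for S F
    using that
  proof (induction S arbitrary: F rule: finite_induct)
    case empty
    have "{G \<in> \<Gamma>. F \<subseteq> G \<and> \<rho> ` G \<subseteq> {..<n} - {}} = {G \<in> \<Gamma>. F \<subseteq> G}" using C(3,6) by auto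
    then show ?case using ex[of F] empty by simp
  next
    case (insert j S)
    let ?TT = "{..<n} - S" and ?T = "{..<n} - insert j S"
    have jT: "j \<in> ?TT" using insert.hyps insert.prems by auto
    have "?T = ?TT - {j}" by auto
    then have cT: "card ?TT = Suc (card ?T)" using card_Suc_Diff1[of ?TT j] jT by simp
    let ?X = "{G \<in> \<Gamma>. F \<subseteq> G \<and> \<rho> ` G \<subseteq> ?TT}"
    let ?Y = "{G \<in> \<Gamma>. F \<subseteq> G \<and> \<rho> ` G \<subseteq> ?T}"
    let ?Z = "{G \<in> \<Gamma>. F \<subseteq> G \<and> \<rho> ` G \<subseteq> ?TT \<and> j \<in> \<rho> ` G}"
    have or: "oriented \<rho> {G \<in> \<Gamma>. P G}" for P using C(8) by (auto simp: oriented_def)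
    have conv: "convex_family ?X" "convex_family ?Z"
      by (rule convex_family_simplicial[OF C(2)], blast)+
    \<comment> \<open>On \<open>?Z\<close> the sum has one term, the number \<open>g v\<close> of
      the unique vertex of colour \<open>j\<close>, so that a level is the star of one vertex.
      Writing it as a sum makes monotonicity immediate.\<close>
    have "exact_below TYPE('k) \<rho> ?Z (card ?TT)"
    proof (rule exact_below_filter[OF or conv(2), where \<phi> = "\<lambda>G. \<Sum>v | v \<in> G \<and> \<rho> v = j. g v"])
      show "finite ?Z" using C(7) by auto
      show "(\<Sum>v | v \<in> G \<and> \<rho> v = j. g v) \<le> (\<Sum>v | v \<in> H \<and> \<rho> v = j. g v)" if "G \<in> ?Z" "H \<in> ?Z" "G \<subseteq> H" for G H
        using that C(5)[of H] by (intro sum_mono2) auto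
    next
      fix t
      let ?L = "{G \<in> ?Z. (\<Sum>v | v \<in> G \<and> \<rho> v = j. g v) = t}"
      have phi: "(\<Sum>v | v \<in> G \<and> \<rho> v = j. g v) = g v" if "G \<in> \<Gamma>" "v \<in> G" "\<rho> v = j" for G v
      proof -
        have "{v. v \<in> G \<and> \<rho> v = j} = {v}" using C(4)[OF that(1)] that by (auto simp: inj_on_def)
        then show ?thesis by simp
      qed
      show "exact_below TYPE('k) \<rho> ?L (card ?TT)"
      proof (cases "?L = {}")
        case True
        then show ?thesis by (simp add: exact_below_empty del: Collect_empty_eq)
      next
        case False
        then obtain G0 where "G0 \<in> ?L" by auto
        then obtain v where G0: "G0 \<in> \<Gamma>" "F \<subseteq> G0" "v \<in> G0" "\<rho> v = j" "\<rho> ` G0 \<subseteq> ?TT" and gv: "g v = t"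
          using phi by auto
        have vF: "insert v F \<in> \<Gamma>" using simplicialD[OF C(2) G0(1)] G0 by auto
        have "v \<in> V" using G0 C(3) by auto
        have "?L = {G \<in> \<Gamma>. insert v F \<subseteq> G \<and> \<rho> ` G \<subseteq> ?TT}"
        proof (intro equalityI subsetI)
          fix G assume "G \<in> ?L"
          then obtain w where w: "w \<in> G" "\<rho> w = j" "G \<in> \<Gamma>" "F \<subseteq> G" "\<rho> ` G \<subseteq> ?TT" "g w = t"
            using phi by auto
          then have "w = v" using gv \<open>v \<in> V\<close> C(3)[of G] by (intro inj_onD[OF g]) auto
          then show "G \<in> {G \<in> \<Gamma>. insert v F \<subseteq> G \<and> \<rho> ` G \<subseteq> ?TT}" using w by auto
        next
          fix G assume "G \<in> {G \<in> \<Gamma>. insert v F \<subseteq> G \<and> \<rho> ` G \<subseteq> ?TT}"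
          then show "G \<in> ?L" using phi[of G v] G0 gv by auto
        qed
        moreover have "exact_below TYPE('k) \<rho> {G \<in> \<Gamma>. insert v F \<subseteq> G \<and> \<rho> ` G \<subseteq> ?TT} (card ?TT)"
          using insert vF G0 by (intro insert.IH) auto
        ultimately show ?thesis by simp
      qed
    qed
    then have Z: "exact_below TYPE('k) \<rho> ?Z (Suc (card ?T))" using cT by simp
    have "exact_below TYPE('k) \<rho> ?X (card ?TT)" using insert by (intro insert.IH) auto
    then have X: "exact_below TYPE('k) \<rho> ?X (card ?T)" using cT exact_below_mono by fastforce
    show ?case
      by (rule exact_below_lower[OF or conv(1) _ _ _ X Z]) auto
  qed
  have "{..<n} - ({..<n} - T) = T" using T by auto
  then show ?thesis using main[of "{..<n} - T" F] F by auto
qed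

section \<open>Relations between the colour sums\<close>

definition vertex_of_colour :: "('v \<Rightarrow> nat) \<Rightarrow> 'v set \<Rightarrow> nat \<Rightarrow> 'v" where
  "vertex_of_colour \<rho> G l = (THE v. v \<in> G \<and> \<rho> v = l)"

lemma vertex_of_colour: "inj_on \<rho> G \<Longrightarrow> v \<in> G \<Longrightarrow> \<rho> v = l \<Longrightarrow> vertex_of_colour \<rho> G l = v"
  unfolding vertex_of_colour_def by (rule the_equality) (auto simp: inj_on_def)

abbreviation xv :: "'v \<Rightarrow> 'v \<Rightarrow>\<^sub>0 nat" where "xv v \<equiv> Poly_Mapping.single v 1"

lemma lookup_xv: "lookup (xv v) w = (if w = v then 1 else 0)"
  by (auto simp: lookup_single when_def)

definition colour_degree :: "('v \<Rightarrow> nat) \<Rightarrow> ('v \<Rightarrow>\<^sub>0 nat) \<Rightarrow> nat \<Rightarrow> nat" where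
  "colour_degree \<rho> m l = (\<Sum>v | v \<in> keys m \<and> \<rho> v = l. lookup m v)"

text \<open>The colour sums of index at most \<open>j\<close> do not touch exponents at colours
  above \<open>j\<close>, so this part is constant along the relations considered and may be fixed
  together with the colour degree.\<close>

definition upper_part :: "('v \<Rightarrow> nat) \<Rightarrow> nat \<Rightarrow> ('v \<Rightarrow>\<^sub>0 nat) \<Rightarrow> 'v \<Rightarrow> nat" where
  "upper_part \<rho> j m v = (if j < \<rho> v then lookup m v else 0)"

lemma colour_degree_vertex:
  assumes "inj_on \<rho> (keys m)" "v \<in> keys m"
  shows "colour_degree \<rho> m (\<rho> v) = lookup m v"
proof -
  have "{w. w \<in> keys m \<and> \<rho> w = \<rho> v} = {v}" using assms by (auto simp: inj_on_def)
  then show ?thesis by (simp add: colour_degree_def)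
qed

lemma colour_degree_pos_iff: "0 < colour_degree \<rho> m l \<longleftrightarrow> l \<in> \<rho> ` keys m"
proof -
  have "colour_degree \<rho> m l = 0 \<longleftrightarrow> (\<forall>v\<in>{v \<in> keys m. \<rho> v = l}. lookup m v = 0)"
    unfolding colour_degree_def by (rule sum_eq_0_iff) simp
  also have "\<dots> \<longleftrightarrow> l \<notin> \<rho> ` keys m" by (auto simp: in_keys_iff)
  finally show ?thesis by auto
qed

lemma colour_degree_minus:
  assumes "v \<in> keys m" "inj_on \<rho> (keys m)"
  shows "(colour_degree \<rho> (m - xv v))(\<rho> v := Suc (colour_degree \<rho> (m - xv v) (\<rho> v))) = colour_degree \<rho> m"
proof
  fix l
  have alt: "colour_degree \<rho> (m - xv v) l = (\<Sum>w | w \<in> keys m \<and> \<rho> w = l. lookup (m - xv v) w)" for l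
    unfolding colour_degree_def
    by (intro sum.mono_neutral_left) (auto simp: in_keys_iff lookup_minus)
  show "((colour_degree \<rho> (m - xv v))(\<rho> v := Suc (colour_degree \<rho> (m - xv v) (\<rho> v)))) l = colour_degree \<rho> m l"
  proof (cases "l = \<rho> v")
    case True
    have "{w. w \<in> keys m \<and> \<rho> w = l} = {v}" using assms True by (auto simp: inj_on_def)
    moreover have "lookup m v > 0" using assms(1) by (simp add: in_keys_iff)
    ultimately show ?thesis using True by (simp add: alt[unfolded One_nat_def]) (simp add: colour_degree_def lookup_minus)
  next
    case False
    have "lookup (m - xv v) w = lookup m w" if "\<rho> w = l" for w
      using that False by (auto simp: lookup_minus lookup_xv[unfolded One_nat_def])
    then show ?thesis using False unfolding fun_upd_other[OF False] alt colour_degree_def[of \<rho> m] by simp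
  qed
qed

lemma upper_part_minus: "\<rho> v \<le> j \<Longrightarrow> upper_part \<rho> j (m - xv v) = upper_part \<rho> j m"
  by (auto simp: upper_part_def lookup_minus lookup_xv[unfolded One_nat_def])

lemma lookup_minus_xv: "lookup (m - xv v) w = (if w = v then lookup m w - 1 else lookup m w)"
  by (simp add: lookup_minus lookup_xv[unfolded One_nat_def])

lemma osgn_eq_image:
  assumes "inj_on \<rho> G" "v \<in> G"
  shows "osgn \<rho> v G = (-1) ^ card {l \<in> \<rho> ` G. l < \<rho> v}"
proof -
  have "\<rho> ` {w \<in> G. \<rho> w < \<rho> v} = {l \<in> \<rho> ` G. l < \<rho> v}" by auto
  moreover have "inj_on \<rho> {w \<in> G. \<rho> w < \<rho> v}" using assms(1) by (rule inj_on_subset) auto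
  ultimately have "card {l \<in> \<rho> ` G. l < \<rho> v} = card {w \<in> G. \<rho> w < \<rho> v}" using card_image by fastforce
  then show ?thesis by (simp add: osgn_def)
qed

text \<open>Modulo the Stanley--Reisner ideal, the coefficient of \<open>(\<Sum>v of colour i. x\<^sub>v) * p\<close> at a monomial \<open>m\<close>
  supported on a face is the coefficient of \<open>p\<close> at \<open>m / x\<^sub>v\<close>, where \<open>v\<close> is the only vertex of colour \<open>i\<close>
  in that face (and \<open>0\<close> if there is none). The hypothesis \<open>rel\<close> is therefore a relation between the
  colour sums, read off coefficient by coefficient, and \<open>h\<close> below expresses its last coefficient by the
  other sums. The monomials fall into classes of equal colour degree, which can be treated one by one.\<close>

context
  fixes \<Gamma> :: "'v set set" and \<rho> :: "'v \<Rightarrow> nat" and n j :: nat and V :: "'v set"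
    and \<gamma> :: "nat \<Rightarrow> ('v \<Rightarrow>\<^sub>0 nat) \<Rightarrow> 'k::field"
  assumes col: "coloured \<rho> n V \<Gamma>"
    and rel: "\<And>m. keys m \<in> \<Gamma> \<Longrightarrow> (\<Sum>v | v \<in> keys m \<and> \<rho> v \<le> j. \<gamma> (\<rho> v) (m - xv v)) = 0"
begin

text \<open>On a face, \<open>x\<^sub>v\<close> times the sum of colour \<open>l\<close> is
  \<open>x\<^sub>v\<close> squared when \<open>v\<close> has colour \<open>l\<close>. A monomial of
  degree at least 2 in colour \<open>l\<close> is therefore a multiple of that sum, and
  \<open>v\<close> can be recovered from the quotient monomial, where it still occurs.\<close>

lemma syzygy_lift_square:
  assumes l: "l < j"
  shows "\<exists>h. \<forall>m. keys m \<in> \<Gamma> \<and> 2 \<le> colour_degree \<rho> m l \<longrightarrow>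
    \<gamma> j m = (\<Sum>v | v \<in> keys m \<and> \<rho> v < j. h (\<rho> v) (m - xv v))"
proof (intro exI allI impI)
  let ?h = "\<lambda>i m. if i = l then \<gamma> j (m + xv (vertex_of_colour \<rho> (keys m) l)) else 0"
  fix m assume m: "keys m \<in> \<Gamma> \<and> 2 \<le> colour_degree \<rho> m l"
  have inj: "inj_on \<rho> (keys m)" using colouredD(4)[OF col] m by auto
  have "l \<in> \<rho> ` keys m" using m colour_degree_pos_iff[of \<rho> m l] by auto
  then obtain v where v: "v \<in> keys m" "\<rho> v = l" by auto
  have lv: "2 \<le> lookup m v" using colour_degree_vertex[OF inj v(1)] v m by simp
  have k: "keys (m - xv v) = keys m"
    using lv by (auto simp: in_keys_iff lookup_minus_xv[unfolded One_nat_def] split: if_splits)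
  have "m - xv v + xv v = m" using single_plus_minus_single[OF v(1)] by (simp add: add.commute)
  then have hv: "?h (\<rho> v) (m - xv v) = \<gamma> j m"
    using vertex_of_colour[OF inj v] v k by simp
  have "(\<Sum>w | w \<in> keys m \<and> \<rho> w < j. ?h (\<rho> w) (m - xv w)) = (\<Sum>w\<in>{v}. ?h (\<rho> w) (m - xv w))"
    using v l inj by (intro sum.mono_neutral_right) (auto simp: inj_on_def)
  then show "\<gamma> j m = (\<Sum>w | w \<in> keys m \<and> \<rho> w < j. ?h (\<rho> w) (m - xv w))" using hv by simp
qed

text \<open>On monomials containing a vertex \<open>w\<close> of colour \<open>j\<close>, the sum of
  colour \<open>j\<close> acts as multiplication by \<open>x\<^sub>w\<close>. The relation at
  \<open>m * x\<^sub>w\<close> thus expresses \<open>\<gamma> j m\<close> by the other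
  coefficients.\<close>

lemma syzygy_lift_present:
  "\<exists>h. \<forall>m. keys m \<in> \<Gamma> \<and> 0 < colour_degree \<rho> m j \<longrightarrow>
    \<gamma> j m = (\<Sum>v | v \<in> keys m \<and> \<rho> v < j. h (\<rho> v) (m - xv v))"
proof (intro exI allI impI)
  let ?h = "\<lambda>i m. - \<gamma> i (m + xv (vertex_of_colour \<rho> (keys m) j))"
  fix m assume m: "keys m \<in> \<Gamma> \<and> 0 < colour_degree \<rho> m j"
  have inj: "inj_on \<rho> (keys m)" using colouredD(4)[OF col] m by auto
  have "j \<in> \<rho> ` keys m" using m colour_degree_pos_iff[of \<rho> m j] by auto
  then obtain w where w: "w \<in> keys m" "\<rho> w = j" by auto
  have k: "keys (m + xv w) = keys m" using w by (auto simp: keys_add_nat)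
  have "{v. v \<in> keys m \<and> \<rho> v \<le> j} = insert w {v. v \<in> keys m \<and> \<rho> v < j}"
  proof (rule set_eqI)
    fix x show "x \<in> {v. v \<in> keys m \<and> \<rho> v \<le> j} \<longleftrightarrow> x \<in> insert w {v. v \<in> keys m \<and> \<rho> v < j}"
      using w inj_onD[OF inj, of x w] by (cases "\<rho> x = j") auto
  qed
  then have "\<gamma> j m + (\<Sum>v | v \<in> keys m \<and> \<rho> v < j. \<gamma> (\<rho> v) (m + xv w - xv v)) = 0"
    using rel[of "m + xv w"] m w k by simp
  moreover have "(\<Sum>v | v \<in> keys m \<and> \<rho> v < j. ?h (\<rho> v) (m - xv v)) =
      (\<Sum>v | v \<in> keys m \<and> \<rho> v < j. - \<gamma> (\<rho> v) (m + xv w - xv v))"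
  proof (rule sum.cong, simp, clarify)
    fix v assume v: "v \<in> keys m" "\<rho> v < j"
    have "w \<in> keys (m - xv v)" using w v by (auto simp: in_keys_iff lookup_minus_xv[unfolded One_nat_def])
    then have "vertex_of_colour \<rho> (keys (m - xv v)) j = w"
      using w inj_on_subset[OF inj keys_minus_single_subset] by (intro vertex_of_colour) auto
    moreover have "m - xv v + xv w = m + xv w - xv v"
      using v by (intro poly_mapping_eqI) (auto simp: lookup_add lookup_minus_xv[unfolded One_nat_def] in_keys_iff)
    ultimately show "?h (\<rho> v) (m - xv v) = - \<gamma> (\<rho> v) (m + xv w - xv v)" by simp
  qed
  ultimately show "\<gamma> j m = (\<Sum>v | v \<in> keys m \<and> \<rho> v < j. ?h (\<rho> v) (m - xv v))"
    by (simp add: sum_negf eq_neg_iff_add_eq_0)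
qed

text \<open>In the remaining classes the part in colours up to \<open>j\<close> is squarefree and
  omits \<open>j\<close>, so monomials become faces over the fixed face \<open>F\<close> of higher
  colours. The relation then says that the signed coefficients form a cocycle, and a primitive of it
  yields \<open>h\<close>. This is the only case that uses exactness.\<close>

lemma syzygy_lift_squarefree:
  assumes ex: "\<And>F. F \<in> \<Gamma> \<Longrightarrow> exact_below TYPE('k) \<rho> {G \<in> \<Gamma>. F \<subseteq> G} n" and j: "j < n"
    and m0: "keys m0 \<in> \<Gamma>" "colour_degree \<rho> m0 j = 0" "\<And>l. l < j \<Longrightarrow> colour_degree \<rho> m0 l \<le> 1"
  shows "\<exists>h. \<forall>m. keys m \<in> \<Gamma> \<and> colour_degree \<rho> m = colour_degree \<rho> m0 \<and> upper_part \<rho> j m = upper_part \<rho> j m0 \<longrightarrow>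
    \<gamma> j m = (\<Sum>v | v \<in> keys m \<and> \<rho> v < j. h (\<rho> v) (m - xv v))"
proof -
  note C = colouredD[OF col]
  define F where "F = {v \<in> keys m0. j < \<rho> v}"
  define \<mu> where "\<mu> = (\<Sum>v\<in>F. Poly_Mapping.single v (lookup m0 v))"
  \<comment> \<open>The colours of the product monomials: those of the class plus \<open>j\<close>.
    Faces with all colours of \<open>T\<close> index the relations; faces with one colour missing
    index the coefficients.\<close>
  define T where "T = insert j (\<rho> ` keys m0)"
  define M where "M G = sqf (G - F) + \<mu>" for G
  define \<sigma> :: "nat \<Rightarrow> 'k" where "\<sigma> l = (-1) ^ card {i \<in> T. i < l}" for l
  let ?X = "{G \<in> \<Gamma>. F \<subseteq> G \<and> \<rho> ` G \<subseteq> T}"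
  have \<sigma>\<sigma>: "\<sigma> l * \<sigma> l = 1" for l by (simp add: \<sigma>_def flip: power_mult_distrib)
  have \<sigma>\<sigma>': "\<sigma> l * (\<sigma> l * a) = a" for l a by (simp add: \<sigma>\<sigma> flip: mult.assoc)
  have Fless: "j < \<rho> v" if "v \<in> F" for v using that by (simp add: F_def)
  have finF: "finite F" by (simp add: F_def)
  have jm0: "j \<notin> \<rho> ` keys m0" using colour_degree_pos_iff[of \<rho> m0 j] m0(2) by auto
  have finT: "finite T" by (simp add: T_def)
  have cardT: "card T = Suc (card (keys m0))"
    using jm0 C(4)[OF m0(1)] by (simp add: T_def card_image)
  have F\<Gamma>: "F \<in> \<Gamma>" using simplicialD[OF C(2) m0(1)] by (auto simp: F_def)
  have "exact_below TYPE('k) \<rho> ?X (card T)"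
    using C(3)[OF m0(1)] C(6) j by (intro exact_colour_selection[OF col ex _ F\<Gamma>]) (auto simp: T_def F_def)
  then have X: "exact_below TYPE('k) \<rho> ?X (Suc (card (keys m0)))" using cardT by simp
  have lk\<mu>: "lookup \<mu> v = (if v \<in> F then lookup m0 v else 0)" for v
    using finF by (auto simp: \<mu>_def lookup_sum lookup_single when_def)
  have lkM: "lookup (M G) v = (if v \<in> F then lookup m0 v else if v \<in> G then 1 else 0)" if "finite G" for G v
    using that by (simp add: M_def lookup_add lk\<mu> lookup_sqf)
  have keysM: "keys (M G) = G" if "finite G" "F \<subseteq> G" for G
  proof -
    have "lookup m0 v \<noteq> 0" if "v \<in> F" for v using that by (simp add: F_def in_keys_iff)
    then show ?thesis using that by (auto simp: in_keys_iff lkM split: if_splits)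
  qed
  have Mminus: "M G - xv v = M (G - {v})" if "finite G" "v \<in> G - F" for G v
  proof (rule poly_mapping_eqI)
    fix w show "lookup (M G - xv v) w = lookup (M (G - {v})) w"
      using that by (cases "w = v") (simp_all add: lookup_minus_xv[unfolded One_nat_def] lkM)
  qed
  have low: "{v. v \<in> G \<and> G - {v} \<in> ?X} = G - F" if "G \<in> ?X" for G
    using that simplicialD[OF C(2), of G] by auto
  have colF: "\<rho> v \<le> j" if G: "G \<in> ?X" "v \<in> G - F" for G v
  proof (rule ccontr)
    assume *: "\<not> \<rho> v \<le> j"
    then obtain w where w: "w \<in> keys m0" "\<rho> w = \<rho> v" using G by (auto simp: T_def)
    then have "w \<in> F" using * by (auto simp: F_def)
    then have "w = v" using w(2) G by (intro inj_onD[OF C(4)[of G]]) auto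
    then show False using \<open>w \<in> F\<close> G by simp
  qed
  \<comment> \<open>The missing colour \<open>l\<close> tells which coefficient family is meant, and
    \<open>\<sigma> l\<close> is the sign with which a vertex of colour \<open>l\<close> enters the
    coboundary at a face using all of \<open>T\<close>.\<close>
  define c where "c G = (let l = (THE l. l \<in> T - \<rho> ` G) in \<sigma> l * \<gamma> l (M G))" for G
  have c_eq: "c G = \<sigma> l * \<gamma> l (M G)" if "T - \<rho> ` G = {l}" for G l
    unfolding c_def that by (simp add: Let_def)
  have full: "\<rho> ` G = T" if "G \<in> ?X" "card G = Suc (card (keys m0))" for G
    using that cardT finT C(4)[of G] by (intro card_subset_eq) (auto simp: card_image)
  obtain b where b: "\<And>G. G \<in> ?X \<Longrightarrow> card G = card (keys m0) \<Longrightarrow> c G = cob \<rho> (\<lambda>_. 1) ?X b G"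
  proof (rule exact_belowE[OF X lessI, of c])
    fix G assume G: "G \<in> ?X" "card G = Suc (card (keys m0))"
    have fin: "finite G" and inj: "inj_on \<rho> G" and FG: "F \<subseteq> G" using G C(4,5) by auto
    have "cob \<rho> (\<lambda>_. 1) ?X c G = (\<Sum>v\<in>G - F. osgn \<rho> v G * c (G - {v}))"
      unfolding cob_def low[OF G(1)] by simp
    also have "\<dots> = (\<Sum>v\<in>G - F. \<gamma> (\<rho> v) (M G - xv v))"
    proof (rule sum.cong, simp)
      fix v assume v: "v \<in> G - F"
      have "T - \<rho> ` (G - {v}) = {\<rho> v}"
        unfolding full[OF G, symmetric] using v inj by (auto simp: inj_on_def)
      then have "c (G - {v}) = \<sigma> (\<rho> v) * \<gamma> (\<rho> v) (M G - xv v)"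
        using Mminus[OF fin v] by (simp add: c_eq)
      moreover have "osgn \<rho> v G = \<sigma> (\<rho> v)"
        using v by (simp add: osgn_eq_image[OF inj] full[OF G] \<sigma>_def)
      ultimately show "osgn \<rho> v G * c (G - {v}) = \<gamma> (\<rho> v) (M G - xv v)" by (simp add: \<sigma>\<sigma>')
    qed
    also have "G - F = {v. v \<in> keys (M G) \<and> \<rho> v \<le> j}"
      unfolding keysM[OF fin FG] using colF[OF G(1)] Fless by (auto simp: not_le[symmetric])
    also have "(\<Sum>v | v \<in> keys (M G) \<and> \<rho> v \<le> j. \<gamma> (\<rho> v) (M G - xv v)) = 0"
      using rel[of "M G"] keysM[OF fin FG] G by simp
    finally show "cob \<rho> (\<lambda>_. 1) ?X c G = 0" .
  qed blast
  \<comment> \<open>The sign of \<open>v\<close> in \<open>keys m\<close> depends only on its colour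
    and on the colour set, which is that of \<open>m0\<close> throughout the class; this is why it
    can be written with \<open>i\<close> alone.\<close>
  define h where "h i m = \<sigma> j * ((-1) ^ card {l \<in> \<rho> ` keys m0. l < i} * b (keys m))" for i and m :: "'v \<Rightarrow>\<^sub>0 nat"
  have "\<gamma> j m = (\<Sum>v | v \<in> keys m \<and> \<rho> v < j. h (\<rho> v) (m - xv v))"
    if m: "keys m \<in> \<Gamma>" "colour_degree \<rho> m = colour_degree \<rho> m0" "upper_part \<rho> j m = upper_part \<rho> j m0" for m
  proof -
    let ?G = "keys m"
    have inj: "inj_on \<rho> ?G" using C(4) m by auto
    have "l \<in> \<rho> ` ?G \<longleftrightarrow> l \<in> \<rho> ` keys m0" for l
      using m(2) colour_degree_pos_iff[of \<rho> m l] colour_degree_pos_iff[of \<rho> m0 l] by simp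
    then have im: "\<rho> ` ?G = \<rho> ` keys m0" by blast
    have up: "lookup m v = lookup m0 v" if "j < \<rho> v" for v
      using fun_cong[OF m(3), of v] that by (simp add: upper_part_def)
    have F: "F = {v \<in> ?G. j < \<rho> v}" using up by (auto simp: F_def in_keys_iff)
    have G: "?G \<in> ?X" using m(1) F im by (auto simp: T_def)
    have cG: "card ?G = card (keys m0)" using im card_image[OF inj] card_image[OF C(4)[OF m0(1)]] by simp
    have less: "\<rho> v < j" if "v \<in> ?G - F" for v
      using that im jm0 F by (metis DiffE image_eqI linorder_neqE_nat mem_Collect_eq)
    have one: "lookup m v = 1" if "v \<in> ?G - F" for v
      using colour_degree_vertex[OF inj, of v] m0(3)[OF less[OF that]] that m(2) by (simp add: in_keys_iff)
    have Mm: "M ?G = m"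
    proof (rule poly_mapping_eqI)
      fix v
      consider "v \<in> F" | "v \<in> ?G - F" | "v \<notin> F" "v \<notin> ?G" by blast
      then show "lookup (M ?G) v = lookup m v"
      proof cases
        case 1 then show ?thesis using up[OF Fless] by (simp add: lkM)
      next
        case 2 then show ?thesis using one[OF 2] by (simp add: lkM)
      next
        case 3 then show ?thesis by (simp add: lkM in_keys_iff)
      qed
    qed
    have "T - \<rho> ` ?G = {j}" using im jm0 by (auto simp: T_def)
    then have "\<sigma> j * \<gamma> j m = c ?G" using Mm by (simp add: c_eq)
    also have "\<dots> = cob \<rho> (\<lambda>_. 1) ?X b ?G" by (rule b[OF G cG])
    also have "\<dots> = (\<Sum>v\<in>?G - F. osgn \<rho> v ?G * b (?G - {v}))"
      unfolding cob_def low[OF G] by simp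
    also have "\<dots> = (\<Sum>v\<in>?G - F. \<sigma> j * h (\<rho> v) (m - xv v))"
    proof (rule sum.cong, simp)
      fix v assume v: "v \<in> ?G - F"
      have "keys (m - xv v) = ?G - {v}"
        using one[OF v] by (auto simp: in_keys_iff lookup_minus_xv[unfolded One_nat_def] split: if_splits)
      then show "osgn \<rho> v ?G * b (?G - {v}) = \<sigma> j * h (\<rho> v) (m - xv v)"
        using v by (simp add: osgn_eq_image[OF inj] im h_def \<sigma>\<sigma>')
    qed
    finally have "\<sigma> j * (\<sigma> j * \<gamma> j m) = \<sigma> j * (\<sigma> j * (\<Sum>v\<in>?G - F. h (\<rho> v) (m - xv v)))"
      by (simp add: sum_distrib_left)
    then have "\<gamma> j m = (\<Sum>v\<in>?G - F. h (\<rho> v) (m - xv v))" by (simp add: \<sigma>\<sigma>')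
    moreover have "?G - F = {v. v \<in> keys m \<and> \<rho> v < j}" using less F by auto
    ultimately show ?thesis by simp
  qed
  then show ?thesis by blast
qed

text \<open>Some colour below \<open>j\<close> has degree at least 2, or colour \<open>j\<close>
  occurs, or neither: each class of monomials falls under one of the three preceding cases.\<close>

lemma syzygy_lift:
  assumes ex: "\<And>F. F \<in> \<Gamma> \<Longrightarrow> exact_below TYPE('k) \<rho> {G \<in> \<Gamma>. F \<subseteq> G} n" and j: "j < n"
  shows "\<exists>h. \<forall>m. keys m \<in> \<Gamma> \<longrightarrow> \<gamma> j m = (\<Sum>v | v \<in> keys m \<and> \<rho> v < j. h (\<rho> v) (m - xv v))"
proof -
  let ?P = "\<lambda>a u h. \<forall>m. keys m \<in> \<Gamma> \<and> colour_degree \<rho> m = a \<and> upper_part \<rho> j m = u \<longrightarrow>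
      \<gamma> j m = (\<Sum>v | v \<in> keys m \<and> \<rho> v < j. h (\<rho> v) (m - xv v))"
  have exP: "\<exists>h. ?P a u h" for a u
  proof (cases "\<exists>m0. keys m0 \<in> \<Gamma> \<and> colour_degree \<rho> m0 = a \<and> upper_part \<rho> j m0 = u")
    case True
    then obtain m0 where m0: "keys m0 \<in> \<Gamma>" "colour_degree \<rho> m0 = a" "upper_part \<rho> j m0 = u" by blast
    consider l where "l < j" "2 \<le> a l" | "0 < a j" | "a j = 0" "\<And>l. l < j \<Longrightarrow> a l \<le> 1"
      by fastforce
    then show ?thesis
    proof cases
      case 1
      obtain h where "\<And>m. keys m \<in> \<Gamma> \<Longrightarrow> 2 \<le> colour_degree \<rho> m l \<Longrightarrow>
          \<gamma> j m = (\<Sum>v | v \<in> keys m \<and> \<rho> v < j. h (\<rho> v) (m - xv v))"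
        using syzygy_lift_square[OF 1(1)] by auto
      then show ?thesis using 1(2) by (intro exI[of _ h]) auto
    next
      case 2
      obtain h where "\<And>m. keys m \<in> \<Gamma> \<Longrightarrow> 0 < colour_degree \<rho> m j \<Longrightarrow>
          \<gamma> j m = (\<Sum>v | v \<in> keys m \<and> \<rho> v < j. h (\<rho> v) (m - xv v))"
        using syzygy_lift_present by auto
      then show ?thesis using 2 by (intro exI[of _ h]) auto
    next
      case 3
      then show ?thesis using syzygy_lift_squarefree[OF ex j m0(1)] m0 by simp
    qed
  next
    case False
    then have "?P a u h" for h by blast
    then show ?thesis by (rule exI)
  qed
  define H where "H a u = (SOME h. ?P a u h)" for a u
  have PH: "?P a u (H a u)" for a u unfolding H_def using exP by (rule someI_ex)
  have H: "\<gamma> j m = (\<Sum>v | v \<in> keys m \<and> \<rho> v < j. H (colour_degree \<rho> m) (upper_part \<rho> j m) (\<rho> v) (m - xv v))"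
    if "keys m \<in> \<Gamma>" for m
    using PH[of "colour_degree \<rho> m" "upper_part \<rho> j m"] that by simp
  \<comment> \<open>The argument here is a quotient \<open>m / x\<^sub>v\<close>; raising its degree
    in colour \<open>i\<close> by one recovers the class of \<open>m\<close>, so the separate
    choices fit together.\<close>
  define h where "h i m = H ((colour_degree \<rho> m)(i := Suc (colour_degree \<rho> m i))) (upper_part \<rho> j m) i m" for i m
  have "\<gamma> j m = (\<Sum>v | v \<in> keys m \<and> \<rho> v < j. h (\<rho> v) (m - xv v))" if "keys m \<in> \<Gamma>" for m
    unfolding H[OF that]
  proof (rule sum.cong[OF refl])
    fix v assume "v \<in> {v. v \<in> keys m \<and> \<rho> v < j}"
    then show "H (colour_degree \<rho> m) (upper_part \<rho> j m) (\<rho> v) (m - xv v) = h (\<rho> v) (m - xv v)"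
      unfolding h_def using colour_degree_minus[of v m \<rho>] colouredD(4)[OF col that] upper_part_minus[of \<rho> v j m] by simp
  qed
  then show ?thesis by blast
qed

end

lemma exponent_box:
  assumes "finite V"
  shows "finite {m :: 'v \<Rightarrow>\<^sub>0 nat. keys m \<subseteq> V \<and> (\<forall>v. lookup m v \<le> L)}" (is "finite ?B")
    and "card {m :: 'v \<Rightarrow>\<^sub>0 nat. keys m \<subseteq> V \<and> (\<forall>v. lookup m v \<le> L)} \<le> Suc L ^ card V"
proof -
  let ?f = "\<lambda>m :: 'v \<Rightarrow>\<^sub>0 nat. restrict (lookup m) V"
  have inj: "inj_on ?f ?B"
  proof (rule inj_onI, rule poly_mapping_eqI)
    fix m m' v assume *: "m \<in> ?B" "m' \<in> ?B" "?f m = ?f m'"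
    show "lookup m v = lookup m' v"
    proof (cases "v \<in> V")
      case True
      then show ?thesis using fun_cong[OF *(3), of v] by simp
    next
      case False
      then have "v \<notin> keys m" "v \<notin> keys m'" using * by auto
      then show ?thesis by (simp add: in_keys_iff)
    qed
  qed
  have sub: "?f ` ?B \<subseteq> PiE V (\<lambda>_. {..L})" by auto
  have fin: "finite (PiE V (\<lambda>_. {..L}))" using assms by (intro finite_PiE) auto
  show "finite ?B" using inj finite_subset[OF sub fin] by (rule finite_imageD[rotated])
  have "card ?B \<le> card (PiE V (\<lambda>_. {..L}))" using inj sub fin by (rule card_inj_on_le)
  then show "card ?B \<le> Suc L ^ card V" using assms by (simp add: card_PiE)
qed

lemma sum_by_colour:
  fixes \<rho> :: "'v \<Rightarrow> nat"
  assumes "finite V" "K \<subseteq> V"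
  shows "(\<Sum>i<k. \<Sum>v\<in>{v \<in> V. \<rho> v = i} \<inter> K. f i v) = (\<Sum>v | v \<in> K \<and> \<rho> v < k. f (\<rho> v) v)"
proof -
  have fin: "finite K" using assms finite_subset by auto
  have "(\<Sum>i<k. \<Sum>v\<in>{v \<in> V. \<rho> v = i} \<inter> K. f i v) = (\<Sum>i<k. \<Sum>v | v \<in> {v. v \<in> K \<and> \<rho> v < k} \<and> \<rho> v = i. f (\<rho> v) v)"
    using assms by (intro sum.cong) auto
  also have "\<dots> = (\<Sum>v | v \<in> K \<and> \<rho> v < k. f (\<rho> v) v)"
    using fin by (intro sum.group) auto
  finally show ?thesis .
qed

text \<open>A zero-divisor equation is a relation with \<open>g\<close> as last coefficient, and
  \<open>syzygy_lift\<close> rewrites the coefficients of \<open>g\<close> through the earlier sums.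
  The solution it gives is an arbitrary function on exponents and has to be cut down to a
  polynomial.\<close>

lemma regular_seq_colour_sums:
  fixes \<Gamma> :: "'v set set"
  assumes col: "coloured \<rho> n V \<Gamma>"
    and ex: "\<And>F. F \<in> \<Gamma> \<Longrightarrow> exact_below TYPE('k::field) \<rho> {G \<in> \<Gamma>. F \<subseteq> G} n"
  shows "regular_seq_quot (SR_ideal \<Gamma> :: ('v, 'k) mpoly set) var_ideal n (\<lambda>j. \<Sum>v | v \<in> V \<and> \<rho> v = j. pvar v)"
proof -
  note C = colouredD[OF col]
  let ?I = "SR_ideal \<Gamma> :: ('v, 'k) mpoly set"
  define \<theta> :: "nat \<Rightarrow> ('v, 'k) mpoly" where "\<theta> j = (\<Sum>v | v \<in> V \<and> \<rho> v = j. pvar v)" for j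
  have \<theta>lookup: "lookup (\<theta> i * p) m = (\<Sum>v\<in>{v \<in> V. \<rho> v = i} \<inter> keys m. lookup p (m - xv v))" for i p m
    unfolding \<theta>_def using C(1) by (intro lookup_sum_pvar_times) auto
  have lookup_comb: "lookup (\<Sum>i<k. \<theta> i * h i) m = (\<Sum>v | v \<in> keys m \<and> \<rho> v < k. lookup (h (\<rho> v)) (m - xv v))"
    if "keys m \<in> \<Gamma>" for k h m
    unfolding lookup_sum \<theta>lookup using C(3)[OF that] C(1) by (intro sum_by_colour)
  have "\<theta> j \<in> var_ideal" for j
    unfolding \<theta>_def var_ideal_def
    using gen_ideal_superset by (intro is_ideal_sum is_ideal_gen_ideal) blast
  moreover have "g \<in> gen_ideal (?I \<union> \<theta> ` {..<j})" if j: "j < n" and g: "\<theta> j * g \<in> gen_ideal (?I \<union> \<theta> ` {..<j})" for j g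
  proof -
    obtain h where h: "\<theta> j * g - (\<Sum>i<j. \<theta> i * h i) \<in> ?I"
      using g unfolding gen_ideal_Un_image_iff[OF is_ideal_SR_ideal] by blast
    define q where "q i = (if i = j then g else - h i)" for i
    have "(\<Sum>i<Suc j. \<theta> i * q i) = \<theta> j * g - (\<Sum>i<j. \<theta> i * h i)"
      by (simp add: q_def sum_negf)
    then have qI: "(\<Sum>i<Suc j. \<theta> i * q i) \<in> ?I" using h by simp
    have "(\<Sum>v | v \<in> keys m \<and> \<rho> v \<le> j. lookup (q (\<rho> v)) (m - xv v)) = 0" if m: "keys m \<in> \<Gamma>" for m
      using qI m lookup_comb[OF m, where k = "Suc j" and h = q] unfolding SR_ideal_iff[OF C(2)] by (simp add: less_Suc_eq_le)
    from syzygy_lift[where \<gamma> = "\<lambda>i. lookup (q i)", OF col this ex j] obtain u where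
      u: "\<And>m. keys m \<in> \<Gamma> \<Longrightarrow> lookup g m = (\<Sum>v | v \<in> keys m \<and> \<rho> v < j. u (\<rho> v) (m - xv v))"
      by (auto simp: q_def)
    \<comment> \<open>Multiplication by a colour sum raises the total degree by one. Dropping the
      part of \<open>u\<close> in degrees from \<open>D\<close> on changes the right-hand side only
      above degree \<open>D\<close>, where \<open>g\<close> has no coefficients.\<close>
    define deg where "deg m = (\<Sum>v\<in>V. lookup m v)" for m :: "'v \<Rightarrow>\<^sub>0 nat"
    obtain D where D: "\<And>m. m \<in> keys g \<Longrightarrow> deg m \<le> D"
      using finite_imageI[of "keys g" deg] by (meson finite_keys finite_nat_set_iff_bounded_le imageI)
    define B where "B = {m :: 'v \<Rightarrow>\<^sub>0 nat. keys m \<subseteq> V \<and> deg m < D}"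
    have "B \<subseteq> {m. keys m \<subseteq> V \<and> (\<forall>v. lookup m v \<le> D)}"
    proof (clarsimp simp: B_def)
      fix m :: "'v \<Rightarrow>\<^sub>0 nat" and v assume m: "keys m \<subseteq> V" "deg m < D"
      show "lookup m v \<le> D"
      proof (cases "v \<in> V")
        case True
        then have "lookup m v \<le> deg m" unfolding deg_def using C(1) by (intro member_le_sum) auto
        then show ?thesis using m by simp
      next
        case False
        then have "v \<notin> keys m" using m by auto
        then show ?thesis by (simp add: in_keys_iff)
      qed
    qed
    then have finB: "finite B" by (rule finite_subset) (rule exponent_box[OF C(1)])
    define p where "p i = (\<Sum>m\<in>B. Poly_Mapping.single m (u i m))" for i
    have lp: "lookup (p i) m = (if m \<in> B then u i m else 0)" for i m
      using finB by (simp add: p_def lookup_sum lookup_single when_def)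
    have "g - (\<Sum>i<j. \<theta> i * p i) \<in> ?I"
      unfolding SR_ideal_iff[OF C(2)]
    proof (intro allI impI)
      fix m :: "'v \<Rightarrow>\<^sub>0 nat" assume m: "keys m \<in> \<Gamma>"
      have inB: "m - xv v \<in> B \<longleftrightarrow> deg m \<le> D" if v: "v \<in> keys m" for v
      proof -
        have vV: "v \<in> V" using v C(3)[OF m] by auto
        have "deg m = Suc (deg (m - xv v))"
        proof -
          have "deg m = lookup m v + (\<Sum>w\<in>V - {v}. lookup m w)" unfolding deg_def using C(1) vV by (rule sum.remove)
          moreover have "deg (m - xv v) = lookup m v - 1 + (\<Sum>w\<in>V - {v}. lookup m w)"
            unfolding deg_def using C(1) vV by (simp add: sum.remove lookup_minus_xv[unfolded One_nat_def])
          moreover have "lookup m v > 0" using v by (simp add: in_keys_iff)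
          ultimately show ?thesis by simp
        qed
        moreover have "keys (m - xv v) \<subseteq> V" using keys_minus_single_subset[of m v] C(3)[OF m] by auto
        ultimately show ?thesis by (auto simp: B_def)
      qed
      have "(\<Sum>v | v \<in> keys m \<and> \<rho> v < j. lookup (p (\<rho> v)) (m - xv v)) = lookup g m"
      proof (cases "deg m \<le> D")
        case True
        then have "(\<Sum>v | v \<in> keys m \<and> \<rho> v < j. lookup (p (\<rho> v)) (m - xv v)) = (\<Sum>v | v \<in> keys m \<and> \<rho> v < j. u (\<rho> v) (m - xv v))"
          by (intro sum.cong refl) (simp add: lp inB[unfolded One_nat_def])
        then show ?thesis using u[OF m] by simp
      next
        case False
        then have "m \<notin> keys g" using D by blast
        then have "lookup g m = 0" by (simp add: in_keys_iff)
        then show ?thesis using False by (simp add: lp inB[unfolded One_nat_def])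
      qed
      then show "lookup (g - (\<Sum>i<j. \<theta> i * p i)) m = 0"
        using lookup_comb[OF m, where k = j and h = p] by (simp add: lookup_minus)
    qed
    then show ?thesis unfolding gen_ideal_Un_image_iff[OF is_ideal_SR_ideal] by blast
  qed
  moreover have "gen_ideal (?I \<union> \<theta> ` {..<n}) \<noteq> UNIV"
  proof
    assume *: "gen_ideal (?I \<union> \<theta> ` {..<n}) = UNIV"
    have "(1 :: ('v, 'k) mpoly) \<in> gen_ideal (?I \<union> \<theta> ` {..<n})" unfolding * by simp
    then obtain h where h: "1 - (\<Sum>i<n. \<theta> i * h i) \<in> ?I"
      unfolding gen_ideal_Un_image_iff[OF is_ideal_SR_ideal] by blast
    \<comment> \<open>Constant coefficients: the empty face belongs to the complex, and colour sums
      contribute nothing at exponent 0.\<close>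
    have k0: "keys (0 :: 'v \<Rightarrow>\<^sub>0 nat) \<in> \<Gamma>" using C(2) by (simp add: simplicial_def)
    then have "lookup (1 - (\<Sum>i<n. \<theta> i * h i)) 0 = 0" using h unfolding SR_ideal_iff[OF C(2)] by blast
    then show False using lookup_comb[OF k0, where k = n and h = h] by (simp add: lookup_minus)
  qed
  ultimately have "regular_seq_quot ?I var_ideal n \<theta>" unfolding regular_seq_quot_def by blast
  then show ?thesis unfolding \<theta>_def .
qed

lemma depth_quot_ge_of_exact:
  fixes \<Gamma> :: "'v set set"
  assumes "coloured \<rho> n V \<Gamma>"
    and "\<And>F. F \<in> \<Gamma> \<Longrightarrow> exact_below TYPE('k::field) \<rho> {G \<in> \<Gamma>. F \<subseteq> G} n"
  shows "enat n \<le> depth_quot (SR_ideal \<Gamma> :: ('v, 'k) mpoly set) var_ideal"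
  unfolding depth_quot_def using regular_seq_colour_sums[OF assms] by (intro Sup_upper) blast

text \<open>The quotient for the full simplex on \<open>F\<close> is a polynomial ring in
  \<open>card F\<close> variables. Colouring its vertices injectively gives a regular sequence of
  that length, hence a chain of primes, which also contain the smaller ideal of
  \<open>\<Delta>\<close>.\<close>

lemma krull_dim_quot_ge_card_face:
  fixes \<Delta> :: "'v set set"
  assumes \<Delta>: "simplicial \<Delta>" and F: "F \<in> \<Delta>" "finite F"
  shows "enat (card F) \<le> krull_dim_quot (SR_ideal \<Delta> :: ('v, 'k::field) mpoly set)"
proof -
  obtain \<rho> :: "'v \<Rightarrow> nat" where \<rho>: "\<rho> ` F = {i. i < card F}" "inj_on \<rho> F"
  proof -
    obtain f :: "'v \<Rightarrow> nat" and k where f: "f ` F = {i. i < k}" "inj_on f F"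
      using finite_imp_inj_to_nat_seg[OF F(2)] by auto
    then have "k = card F" using card_image[OF f(2)] by simp
    then show ?thesis using that f by simp
  qed
  have col: "coloured \<rho> (card F) F (Pow F)"
    using F \<rho> by (auto simp: coloured_def simplicial_def intro: inj_on_subset)
  have "exact_below TYPE('k) \<rho> {G \<in> Pow F. A \<subseteq> G} (card F)" if A: "A \<in> Pow F" for A
  \<comment> \<open>The star of \<open>F\<close> is \<open>{F}\<close>; its only degree is
    \<open>card F\<close>, just outside the range. All other stars are cones.\<close>
  proof (cases "A = F")
    case True
    then have "{G \<in> Pow F. A \<subseteq> G} = {F}" by auto
    then show ?thesis by (auto simp: exact_below_def)
  next
    case False
    then obtain u where u: "u \<in> F" "u \<notin> A" using A by auto
    have "oriented \<rho> {G \<in> Pow F. A \<subseteq> G}"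
      using colouredD(8)[OF col] by (auto simp: oriented_def)
    then show ?thesis by (rule exact_below_toggle[where u = u]) (use u in auto)
  qed
  then have "enat (card F) \<le> depth_quot (SR_ideal (Pow F) :: ('v, 'k) mpoly set) var_ideal"
    by (rule depth_quot_ge_of_exact[OF col])
  also have "\<dots> \<le> krull_dim_quot (SR_ideal (Pow F) :: ('v, 'k) mpoly set)"
    by (rule depth_quot_le_krull_dim_quot)
  also have "\<dots> \<le> krull_dim_quot (SR_ideal \<Delta> :: ('v, 'k) mpoly set)"
  proof (rule krull_dim_quot_antimono, rule subsetI)
    fix p :: "('v, 'k) mpoly" assume "p \<in> SR_ideal \<Delta>"
    then show "p \<in> SR_ideal (Pow F)"
      using simplicialD[OF \<Delta> F(1)] unfolding SR_ideal_iff[OF \<Delta>] SR_ideal_iff[OF colouredD(2)[OF col]] by auto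
  qed
  finally show ?thesis .
qed

section \<open>An upper bound for the Krull dimension\<close>

text \<open>Gaussian elimination: a coordinate on which some vector does not vanish is cleared from
  the others, using up one coordinate and one vector.\<close>

lemma linear_dependence:
  fixes u :: "'a \<Rightarrow> 'b \<Rightarrow> 'k::field"
  assumes "finite B" "finite A" "card B < card A"
  shows "\<exists>c. (\<exists>\<alpha>\<in>A. c \<alpha> \<noteq> 0) \<and> (\<forall>m\<in>B. (\<Sum>\<alpha>\<in>A. c \<alpha> * u \<alpha> m) = 0)"
  using assms
proof (induction B arbitrary: A u rule: finite_induct)
  case empty
  then have "A \<noteq> {}" by auto
  then show ?case by (intro exI[of _ "\<lambda>_. 1"]) auto
next
  case (insert m B)
  show ?case
  proof (cases "\<forall>\<alpha>\<in>A. u \<alpha> m = 0")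
    case True
    have "card B < card A" using insert by simp
    from insert.IH[OF insert.prems(1) this] obtain c where
      c: "\<exists>\<alpha>\<in>A. c \<alpha> \<noteq> 0" "\<forall>m\<in>B. (\<Sum>\<alpha>\<in>A. c \<alpha> * u \<alpha> m) = 0" by blast
    then show ?thesis using True by (intro exI[of _ c]) simp
  next
    case False
    then obtain \<beta> where \<beta>: "\<beta> \<in> A" "u \<beta> m \<noteq> 0" by blast
    let ?A = "A - {\<beta>}"
    have "card B < card ?A" "finite ?A" using insert \<beta> by auto
    from insert.IH[OF this(2,1), of "\<lambda>\<alpha> b. u \<alpha> b - u \<alpha> m / u \<beta> m * u \<beta> b"] obtain c where
      c: "\<exists>\<alpha>\<in>?A. c \<alpha> \<noteq> 0" "\<And>b. b \<in> B \<Longrightarrow> (\<Sum>\<alpha>\<in>?A. c \<alpha> * (u \<alpha> b - u \<alpha> m / u \<beta> m * u \<beta> b)) = 0" by blast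
    define e where "e = - (\<Sum>\<alpha>\<in>?A. c \<alpha> * u \<alpha> m / u \<beta> m)"
    have split: "(\<Sum>\<alpha>\<in>A. (c(\<beta> := e)) \<alpha> * u \<alpha> b) = e * u \<beta> b + (\<Sum>\<alpha>\<in>?A. c \<alpha> * u \<alpha> b)" for b
    proof -
      have "(\<Sum>\<alpha>\<in>?A. (c(\<beta> := e)) \<alpha> * u \<alpha> b) = (\<Sum>\<alpha>\<in>?A. c \<alpha> * u \<alpha> b)" by (rule sum.cong) auto
      then show ?thesis using sum.remove[OF insert.prems(1) \<beta>(1), of "\<lambda>\<alpha>. (c(\<beta> := e)) \<alpha> * u \<alpha> b"] by simp
    qed
    have "(\<Sum>\<alpha>\<in>A. (c(\<beta> := e)) \<alpha> * u \<alpha> b) = 0" if "b \<in> insert m B" for b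
    proof (cases "b = m")
      case True
      then show ?thesis unfolding split using \<beta>(2) by (simp add: e_def sum_distrib_right)
    next
      case False
      then have "(\<Sum>\<alpha>\<in>?A. c \<alpha> * (u \<alpha> b - u \<alpha> m / u \<beta> m * u \<beta> b)) = 0" using c(2) that by simp
      then show ?thesis unfolding split
        by (simp add: e_def sum_distrib_right right_diff_distrib sum_subtractf mult.assoc)
    qed
    moreover have "\<exists>\<alpha>\<in>A. (c(\<beta> := e)) \<alpha> \<noteq> 0" using c(1) by auto
    ultimately show ?thesis by blast
  qed
qed

lemma is_prime_idealD:
  assumes "is_prime_ideal p"
  shows "is_ideal p" "1 \<notin> p" "a * b \<in> p \<Longrightarrow> a \<in> p \<or> b \<in> p"
  using assms is_idealD(3)[of p 1] by (auto simp: is_prime_ideal_def)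

lemma prime_ideal_power: "is_prime_ideal p \<Longrightarrow> a \<notin> p \<Longrightarrow> a ^ t \<notin> p"
  by (induction t) (auto dest: is_prime_idealD)

text \<open>A polynomial relation between elements \<open>a\<^sub>i \<in> p\<^sub>i\<^sub>+\<^sub>1 - p\<^sub>i\<close> of a chain of primes is impossible:
  cancelling, one prime after the other, the lowest power of \<open>a\<^sub>i\<close>, puts the coefficient of the
  lexicographically smallest monomial into the last prime.\<close>

lemma prime_chain_no_relation:
  fixes a :: "nat \<Rightarrow> 'r::comm_ring_1" and p :: "nat \<Rightarrow> 'r set"
  assumes p: "\<And>i. i \<le> N \<Longrightarrow> is_prime_ideal (p i)" and mono: "\<And>i. i < N \<Longrightarrow> p i \<subseteq> p (Suc i)"
    and a: "\<And>i. i < N \<Longrightarrow> a i \<in> p (Suc i) - p i"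
    and S: "finite S" "S \<noteq> {}" "S \<subseteq> extensional {..<N}" "\<And>\<alpha>. \<alpha> \<in> S \<Longrightarrow> c \<alpha> \<notin> p N"
    and "l + k = N" "\<And>\<alpha> \<beta> i. \<alpha> \<in> S \<Longrightarrow> \<beta> \<in> S \<Longrightarrow> i < l \<Longrightarrow> \<alpha> i = \<beta> i"
  shows "(\<Sum>\<alpha>\<in>S. c \<alpha> * (\<Prod>i\<in>{l..<N}. a i ^ \<alpha> i)) \<notin> p l"
  using assms(4-)
proof (induction k arbitrary: l S)
  case 0
  then have l: "l = N" by simp
  obtain \<alpha> where \<alpha>: "\<alpha> \<in> S" using 0 by auto
  have "\<beta> = \<alpha>" if "\<beta> \<in> S" for \<beta>
    using 0(3,6) that \<alpha> l by (intro extensionalityI[of \<beta> "{..<N}" \<alpha>]) auto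
  then have "S = {\<alpha>}" using \<alpha> by blast
  then show ?case using 0(4)[OF \<alpha>] l by simp
next
  case (Suc k)
  have l: "l < N" using Suc.prems by simp
  note pl = is_prime_idealD[OF p[OF less_imp_le[OF l]]]
  have pl': "is_ideal (p (Suc l))" using is_prime_idealD(1)[OF p[of "Suc l"]] l by simp
  define t where "t = Min ((\<lambda>\<alpha>. \<alpha> l) ` S)"
  define S' where "S' = {\<alpha> \<in> S. \<alpha> l = t}"
  have tmin: "t \<le> \<alpha> l" if "\<alpha> \<in> S" for \<alpha> unfolding t_def using Suc.prems that by (intro Min_le) auto
  have "t \<in> (\<lambda>\<alpha>. \<alpha> l) ` S" unfolding t_def using Suc.prems by (intro Min_in) auto
  then have S': "finite S'" "S' \<noteq> {}" "S' \<subseteq> S" using Suc.prems by (auto simp: S'_def)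
  let ?R = "\<lambda>\<alpha>. \<Prod>i\<in>{Suc l..<N}. a i ^ \<alpha> i"
  let ?Q = "\<Sum>\<alpha>\<in>S. c \<alpha> * (a l ^ (\<alpha> l - t) * ?R \<alpha>)"
  have eq: "(\<Sum>\<alpha>\<in>S. c \<alpha> * (\<Prod>i\<in>{l..<N}. a i ^ \<alpha> i)) = a l ^ t * ?Q"
    unfolding sum_distrib_left
  proof (rule sum.cong[OF refl])
    fix \<alpha> assume "\<alpha> \<in> S"
    then have "a l ^ \<alpha> l = a l ^ t * a l ^ (\<alpha> l - t)" using tmin by (simp flip: power_add)
    then show "c \<alpha> * (\<Prod>i\<in>{l..<N}. a i ^ \<alpha> i) = a l ^ t * (c \<alpha> * (a l ^ (\<alpha> l - t) * ?R \<alpha>))"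
      using l by (simp add: prod.atLeast_Suc_lessThan mult_ac)
  qed
  have "?Q \<notin> p l"
  proof
    assume Q: "?Q \<in> p l"
    have "(\<Sum>\<alpha>\<in>S - S'. c \<alpha> * (a l ^ (\<alpha> l - t) * ?R \<alpha>)) \<in> p (Suc l)"
    proof (rule is_ideal_sum[OF pl'])
      fix \<alpha> assume "\<alpha> \<in> S - S'"
      then have "t < \<alpha> l" using tmin[of \<alpha>] by (auto simp: S'_def)
      then have "\<alpha> l - t = Suc (\<alpha> l - t - 1)" by simp
      then have "a l ^ (\<alpha> l - t) = a l * a l ^ (\<alpha> l - t - 1)" using power_Suc[of "a l" "\<alpha> l - t - 1"] by simp
      then have "a l ^ (\<alpha> l - t) \<in> p (Suc l)" using a[OF l] is_idealD(4)[OF pl'] by simp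
      then show "c \<alpha> * (a l ^ (\<alpha> l - t) * ?R \<alpha>) \<in> p (Suc l)"
        by (intro is_idealD(3)[OF pl'] is_idealD(4)[OF pl'])
    qed
    moreover have "?Q \<in> p (Suc l)" using Q mono[OF l] by auto
    moreover have "?Q = (\<Sum>\<alpha>\<in>S - S'. c \<alpha> * (a l ^ (\<alpha> l - t) * ?R \<alpha>)) + (\<Sum>\<alpha>\<in>S'. c \<alpha> * ?R \<alpha>)"
    proof -
      have "(\<Sum>\<alpha>\<in>S'. c \<alpha> * ?R \<alpha>) = (\<Sum>\<alpha>\<in>S'. c \<alpha> * (a l ^ (\<alpha> l - t) * ?R \<alpha>))"
        by (rule sum.cong) (auto simp: S'_def)
      then show ?thesis using sum.subset_diff[OF S'(3) Suc.prems(1)] by simp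
    qed
    ultimately have "(\<Sum>\<alpha>\<in>S'. c \<alpha> * ?R \<alpha>) \<in> p (Suc l)"
      using is_ideal_diff[OF pl', of ?Q "\<Sum>\<alpha>\<in>S - S'. c \<alpha> * (a l ^ (\<alpha> l - t) * ?R \<alpha>)"] by simp
    moreover have "(\<Sum>\<alpha>\<in>S'. c \<alpha> * ?R \<alpha>) \<notin> p (Suc l)"
    proof (rule Suc.IH[OF S'(1,2)])
      fix \<alpha> \<beta> i assume "\<alpha> \<in> S'" "\<beta> \<in> S'" "i < Suc l"
      then show "\<alpha> i = \<beta> i" using Suc.prems(6)[of \<alpha> \<beta> i] by (cases "i = l") (auto simp: S'_def)
    qed (use Suc.prems S' in auto)
    ultimately show False by simp
  qed
  moreover have "a l ^ t \<notin> p l" using prime_ideal_power[OF p[of l]] a[OF l] l by simp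
  ultimately show ?case unfolding eq using pl(3) by blast
qed

lemma ideal_cong_mult:
  assumes "is_ideal J" "x - y \<in> J" "x' - y' \<in> J" shows "x * x' - y * y' \<in> J"
proof -
  have "(x - y) * x' + y * (x' - y') \<in> J"
    using assms by (intro is_idealD(2)[OF assms(1)] is_idealD(3)[OF assms(1) assms(3)] is_idealD(4)[OF assms(1) assms(2)])
  then show ?thesis by (simp add: algebra_simps)
qed

lemma ideal_cong_power: "is_ideal J \<Longrightarrow> x - y \<in> J \<Longrightarrow> x ^ t - y ^ t \<in> J"
  by (induction t) (auto intro: ideal_cong_mult is_idealD(1))

lemma ideal_cong_prod:
  "is_ideal J \<Longrightarrow> (\<And>i. i \<in> A \<Longrightarrow> f i - g i \<in> J) \<Longrightarrow> prod f A - prod g A \<in> J"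
  by (induction A rule: infinite_finite_induct) (auto intro: ideal_cong_mult is_idealD(1))

definition in_box :: "'v set \<Rightarrow> nat \<Rightarrow> ('v, 'k::field) mpoly \<Rightarrow> bool" where
  "in_box F L q \<longleftrightarrow> (\<forall>m\<in>keys q. keys m \<subseteq> F \<and> (\<forall>v. lookup m v \<le> L))"

lemma in_box_one: "in_box F 0 1"
  by (simp add: in_box_def)

lemma in_box_mult:
  assumes "in_box F L q" "in_box F L' r" shows "in_box F (L + L') (q * r)"
  unfolding in_box_def
proof
  fix m assume "m \<in> keys (q * r)"
  then obtain a b where ab: "m = a + b" "a \<in> keys q" "b \<in> keys r" using keys_mult[of q r] by auto
  then show "keys m \<subseteq> F \<and> (\<forall>v. lookup m v \<le> L + L')"
    using assms by (auto simp: in_box_def keys_add_nat lookup_add intro: add_mono)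
qed

lemma in_box_power: "in_box F L q \<Longrightarrow> in_box F (t * L) (q ^ t)"
  by (induction t) (auto intro: in_box_mult simp: in_box_one)

lemma in_box_prod: "(\<And>i. i \<in> A \<Longrightarrow> in_box F (L i) (q i)) \<Longrightarrow> in_box F (sum L A) (prod q A)"
  by (induction A rule: infinite_finite_induct) (auto intro: in_box_mult simp: in_box_one)

lemma in_box_mono: "in_box F L q \<Longrightarrow> L \<le> L' \<Longrightarrow> in_box F L' q"
  by (auto simp: in_box_def intro: order_trans)

text \<open>A longer chain gives \<open>n + 1\<close> elements \<open>a i\<close> that satisfy no
  polynomial relation modulo \<open>p 0\<close>, by \<open>prime_chain_no_relation\<close>. But
  modulo \<open>p 0\<close> only the variables of one face survive, at most \<open>n\<close> of
  them, and counting monomials forces a relation.\<close>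

lemma krull_dim_quot_SR_ideal_le:
  fixes \<Delta> :: "'v set set"
  assumes \<Delta>: "simplicial \<Delta>" and V: "finite V" and face: "\<And>G. G \<in> \<Delta> \<Longrightarrow> G \<subseteq> V \<and> card G \<le> n"
  shows "krull_dim_quot (SR_ideal \<Delta> :: ('v, 'k::field) mpoly set) \<le> enat n"
  unfolding krull_dim_quot_def
proof (rule Sup_least, clarify, rule ccontr)
  fix N and p :: "nat \<Rightarrow> ('v, 'k) mpoly set"
  assume p: "\<forall>i\<le>N. is_prime_ideal (p i) \<and> SR_ideal \<Delta> \<subseteq> p i" "\<forall>i<N. p i \<subset> p (Suc i)"
    and "\<not> enat N \<le> enat n"
  then have N: "Suc n \<le> N" by simp
  have pr: "is_prime_ideal (p i)" if "i \<le> Suc n" for i using p N that by auto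
  have sub: "p i \<subset> p (Suc i)" if "i < Suc n" for i using p N that by auto
  note p0 = is_prime_idealD[OF pr[of 0, simplified]]
  have I0: "SR_ideal \<Delta> \<subseteq> p 0" using p by auto
  have "\<exists>a. \<forall>i<Suc n. a i \<in> p (Suc i) - p i" using sub by (intro choice allI) blast
  then obtain a where a: "\<And>i. i < Suc n \<Longrightarrow> a i \<in> p (Suc i) - p i" by blast
  \<comment> \<open>Non-faces have their monomial in \<open>p 0\<close>, while primality keeps
    products of variables outside \<open>p 0\<close> outside; hence \<open>F\<close> is a
    face.\<close>
  define F where "F = {v. pvar v \<notin> p 0}"
  have nonface: "(\<Prod>v\<in>G. pvar v) \<in> p 0" if "finite G" "G \<notin> \<Delta>" for G
    using I0 gen_ideal_superset[of "{\<Prod>v\<in>F. pvar v |F. finite F \<and> F \<notin> \<Delta>}"] that unfolding SR_ideal_def by blast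
  have FV: "F \<subseteq> V"
  proof
    fix v assume "v \<in> F"
    then have "{v} \<in> \<Delta>" using nonface[of "{v}"] by (auto simp: F_def)
    then show "v \<in> V" using face by auto
  qed
  then have finF: "finite F" using V finite_subset by auto
  have "(\<Prod>v\<in>G. pvar v) \<notin> p 0" if "G \<subseteq> F" for G
    using finite_subset[OF that finF] that
  proof (induction G rule: finite_induct)
    case empty then show ?case using p0(2) by simp
  next
    case (insert v G) then show ?case using p0(3) by (auto simp: F_def)
  qed
  then have "F \<in> \<Delta>" using nonface[OF finF] by blast
  then have cardF: "card F \<le> n" using face by auto
  define pj where "pj q = (\<Sum>m\<in>{m \<in> keys q. keys m \<subseteq> F}. Poly_Mapping.single m (lookup q m))" for q :: "('v, 'k) mpoly"
  have pj: "q - pj q \<in> p 0" for q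
  proof -
    have qeq: "q = pj q + (\<Sum>m\<in>{m \<in> keys q. \<not> keys m \<subseteq> F}. Poly_Mapping.single m (lookup q m))"
    proof -
      have "keys q = {m \<in> keys q. keys m \<subseteq> F} \<union> {m \<in> keys q. \<not> keys m \<subseteq> F}" by auto
      then have "(\<Sum>m\<in>keys q. Poly_Mapping.single m (lookup q m)) =
          pj q + (\<Sum>m\<in>{m \<in> keys q. \<not> keys m \<subseteq> F}. Poly_Mapping.single m (lookup q m))"
        unfolding pj_def by (subst sum.union_disjoint[symmetric]) auto
      then show ?thesis using poly_mapping_eq_sum_single[of q] by simp
    qed
    have rest: "(\<Sum>m\<in>{m \<in> keys q. \<not> keys m \<subseteq> F}. Poly_Mapping.single m (lookup q m)) \<in> p 0"
    proof (rule is_ideal_sum[OF p0(1)])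
      fix m assume "m \<in> {m \<in> keys q. \<not> keys m \<subseteq> F}"
      then obtain v where v: "v \<in> keys m" "pvar v \<in> p 0" by (auto simp: F_def)
      have "pvar v * Poly_Mapping.single (m - xv v) (lookup q m) = Poly_Mapping.single m (lookup q m)"
        unfolding pvar_def mult_single using single_plus_minus_single[OF v(1)] by simp
      then show "Poly_Mapping.single m (lookup q m) \<in> p 0"
        using is_idealD(4)[OF p0(1) v(2), of "Poly_Mapping.single (m - xv v) (lookup q m)"] by simp
    qed
    have "q - pj q = (\<Sum>m\<in>{m \<in> keys q. \<not> keys m \<subseteq> F}. Poly_Mapping.single m (lookup q m))"
      unfolding diff_eq_eq by (subst add.commute) (rule qeq)
    then show ?thesis using rest by simp
  qed
  have "\<exists>D. in_box F D (pj q)" for q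
  proof (intro exI)
    let ?D = "\<Sum>m\<in>keys q. \<Sum>v\<in>keys m. lookup m v"
    have "lookup m v \<le> ?D" if "m \<in> keys q" for m v
    proof (cases "v \<in> keys m")
      case True
      then have "lookup m v \<le> (\<Sum>v\<in>keys m. lookup m v)" by (intro member_le_sum) auto
      also have "\<dots> \<le> ?D" using that by (intro member_le_sum) auto
      finally show ?thesis .
    qed (simp add: in_keys_iff)
    moreover have "keys (pj q) \<subseteq> {m \<in> keys q. keys m \<subseteq> F}"
      unfolding pj_def by (rule subset_trans[OF keys_sum]) (auto split: if_splits)
    ultimately show "in_box F ?D (pj q)" unfolding in_box_def by blast
  qed
  then obtain d where d: "\<And>q. in_box F (d q) (pj q)" by metis
  define D where "D = (\<Sum>i<Suc n. d (a i))"
  have D: "in_box F D (pj (a i))" if "i < Suc n" for i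
  proof (rule in_box_mono[OF d])
    show "d (a i) \<le> D" unfolding D_def using that by (intro member_le_sum[of i _ "\<lambda>i. d (a i)"]) auto
  qed
  \<comment> \<open>Products of the \<open>n + 1\<close> elements with exponents below
    \<open>M\<close> have exponent at most \<open>L\<close> in every variable, and
    \<open>Suc L \<le> M * E\<close>. There are \<open>M ^ Suc n\<close> products and at most
    \<open>(M * E) ^ n\<close> monomials; \<open>M > E ^ n\<close> makes the former more
    numerous.\<close>
  define E where "E = Suc (Suc n * D)"
  define M where "M = Suc (E ^ n)"
  define L where "L = Suc n * (M * D)"
  let ?A = "PiE {..<Suc n} (\<lambda>_. {..<M})"
  let ?B = "{m :: 'v \<Rightarrow>\<^sub>0 nat. keys m \<subseteq> F \<and> (\<forall>v. lookup m v \<le> L)}"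
  have finA: "finite ?A" by (intro finite_PiE) auto
  have LE: "Suc L \<le> M * E" by (simp add: L_def E_def M_def algebra_simps)
  have "card ?B \<le> Suc L ^ card F" by (rule exponent_box[OF finF])
  also have "\<dots> \<le> (M * E) ^ card F" using LE by (rule power_mono) simp
  also have "\<dots> \<le> (M * E) ^ n" using cardF by (intro power_increasing) (auto simp: M_def E_def)
  also have "\<dots> = M ^ n * E ^ n" by (rule power_mult_distrib)
  also have "\<dots> < M ^ n * M" by (rule mult_strict_left_mono) (auto simp: M_def)
  also have "\<dots> = card ?A" by (simp add: card_PiE)
  finally have lt: "card ?B < card ?A" .
  let ?b = "\<lambda>\<alpha>. \<Prod>i<Suc n. pj (a i) ^ \<alpha> i"
  obtain c :: "(nat \<Rightarrow> nat) \<Rightarrow> 'k" where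
    c: "\<exists>\<alpha>\<in>?A. c \<alpha> \<noteq> 0" "\<And>m. m \<in> ?B \<Longrightarrow> (\<Sum>\<alpha>\<in>?A. c \<alpha> * lookup (?b \<alpha>) m) = 0"
    using linear_dependence[OF exponent_box(1)[OF finF] finA lt, of "\<lambda>\<alpha>. lookup (?b \<alpha>)"] by blast
  let ?c = "\<lambda>\<alpha>. Poly_Mapping.single 0 (c \<alpha>) :: ('v, 'k) mpoly"
  have box: "in_box F L (?b \<alpha>)" if \<alpha>: "\<alpha> \<in> ?A" for \<alpha>
  proof -
    have "in_box F (\<Sum>i<Suc n. \<alpha> i * D) (?b \<alpha>)" using D by (intro in_box_prod in_box_power) auto
    moreover have "(\<Sum>i<Suc n. \<alpha> i * D) \<le> (\<Sum>i<Suc n. M * D)"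
      using \<alpha> by (intro sum_mono mult_right_mono) (auto simp: PiE_iff less_imp_le)
    ultimately have "in_box F (\<Sum>i<Suc n. M * D) (?b \<alpha>)" by (rule in_box_mono)
    then show ?thesis by (simp add: L_def)
  qed
  have "(\<Sum>\<alpha>\<in>?A. ?c \<alpha> * ?b \<alpha>) = 0"
  proof (rule poly_mapping_eqI)
    fix m :: "'v \<Rightarrow>\<^sub>0 nat"
    have "lookup (?c \<alpha> * q) m = c \<alpha> * lookup q m" for \<alpha> and q :: "('v, 'k) mpoly"
      using lookup_single_times[of 0 "c \<alpha>" q m] by simp
    then have "lookup (\<Sum>\<alpha>\<in>?A. ?c \<alpha> * ?b \<alpha>) m = (\<Sum>\<alpha>\<in>?A. c \<alpha> * lookup (?b \<alpha>) m)" by (simp add: lookup_sum)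
    also have "\<dots> = 0"
    proof (cases "m \<in> ?B")
      case True then show ?thesis by (rule c(2))
    next
      case False
      then have "lookup (?b \<alpha>) m = 0" if "\<alpha> \<in> ?A" for \<alpha>
        using box[OF that] unfolding in_box_def by (auto simp: in_keys_iff)
      then show ?thesis by simp
    qed
    finally show "lookup (\<Sum>\<alpha>\<in>?A. ?c \<alpha> * ?b \<alpha>) m = lookup 0 m" by simp
  qed
  moreover have "(\<Sum>\<alpha>\<in>?A. ?c \<alpha> * (\<Prod>i<Suc n. a i ^ \<alpha> i)) - (\<Sum>\<alpha>\<in>?A. ?c \<alpha> * ?b \<alpha>) \<in> p 0"
    unfolding sum_subtractf[symmetric] right_diff_distrib[symmetric]
    using pj by (intro is_ideal_sum[OF p0(1)] is_idealD(3)[OF p0(1)] ideal_cong_prod[OF p0(1)] ideal_cong_power[OF p0(1)])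
  ultimately have "(\<Sum>\<alpha>\<in>?A. ?c \<alpha> * (\<Prod>i<Suc n. a i ^ \<alpha> i)) \<in> p 0" by simp
  moreover have "(\<Sum>\<alpha>\<in>?A. ?c \<alpha> * (\<Prod>i<Suc n. a i ^ \<alpha> i)) =
      (\<Sum>\<alpha>\<in>{\<alpha> \<in> ?A. c \<alpha> \<noteq> 0}. ?c \<alpha> * (\<Prod>i\<in>{0..<Suc n}. a i ^ \<alpha> i))"
    using finA by (intro sum.mono_neutral_cong_right) (auto simp: lessThan_atLeast0)
  moreover have "(\<Sum>\<alpha>\<in>{\<alpha> \<in> ?A. c \<alpha> \<noteq> 0}. ?c \<alpha> * (\<Prod>i\<in>{0..<Suc n}. a i ^ \<alpha> i)) \<notin> p 0"
  proof (rule prime_chain_no_relation[where k = "Suc n"])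
    show "finite {\<alpha> \<in> ?A. c \<alpha> \<noteq> 0}" using finA by (rule finite_subset[rotated]) auto
    show "{\<alpha> \<in> ?A. c \<alpha> \<noteq> 0} \<subseteq> extensional {..<Suc n}" by (auto simp: PiE_def)
    fix \<alpha> assume "\<alpha> \<in> {\<alpha> \<in> ?A. c \<alpha> \<noteq> 0}"
    then have "?c \<alpha> * Poly_Mapping.single 0 (inverse (c \<alpha>)) = 1" by (simp add: mult_single)
    then show "?c \<alpha> \<notin> p (Suc n)"
      using is_prime_idealD(1,2)[OF pr[of "Suc n"]]
        is_idealD(4)[of "p (Suc n)" "?c \<alpha>" "Poly_Mapping.single 0 (inverse (c \<alpha>))"] by auto
  qed (use c pr sub a in auto)
  ultimately show False by simp
qed

section \<open>Vanishing Euler characteristic\<close>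

lemma sum_mult_delta:
  "finite A \<Longrightarrow> (\<Sum>G\<in>A. a G * (if H = G then 1 else 0)) = (if H \<in> A then a H else (0::'k::field))"
  by (simp add: if_distrib[of "\<lambda>x. _ * x"] cong: if_cong)

lemma card_le_of_independent:
  fixes u :: "'a \<Rightarrow> 'b \<Rightarrow> 'k::field"
  assumes "finite A" "finite B" and "\<And>c. (\<forall>m\<in>B. (\<Sum>\<alpha>\<in>A. c \<alpha> * u \<alpha> m) = 0) \<Longrightarrow> \<forall>\<alpha>\<in>A. c \<alpha> = 0"
  shows "card A \<le> card B"
proof (rule ccontr)
  assume "\<not> card A \<le> card B"
  then obtain c where "\<exists>\<alpha>\<in>A. c \<alpha> \<noteq> 0" "\<forall>m\<in>B. (\<Sum>\<alpha>\<in>A. c \<alpha> * u \<alpha> m) = 0"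
    using linear_dependence[OF assms(2,1), of u] by auto
  then show False using assms(3)[of c] by blast
qed

text \<open>The coefficients producing the unit vectors form a left inverse of the matrix
  \<open>u\<close>, so they are themselves independent.\<close>

lemma card_le_of_spanning:
  fixes u :: "'a \<Rightarrow> 'b \<Rightarrow> 'k::field"
  assumes fin: "finite A" "finite B"
    and sp: "\<And>\<beta>. \<beta> \<in> B \<Longrightarrow> \<exists>c. \<forall>m\<in>B. (\<Sum>\<alpha>\<in>A. c \<alpha> * u \<alpha> m) = (if m = \<beta> then 1 else 0)"
  shows "card B \<le> card A"
proof -
  obtain w where w: "\<And>\<beta> m. \<beta> \<in> B \<Longrightarrow> m \<in> B \<Longrightarrow> (\<Sum>\<alpha>\<in>A. w \<beta> \<alpha> * u \<alpha> m) = (if m = \<beta> then 1 else 0)"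
    using sp by metis
  show ?thesis
  proof (rule card_le_of_independent[OF fin(2,1), of w], rule ballI)
    fix c \<beta> assume c: "\<forall>\<alpha>\<in>A. (\<Sum>\<beta>\<in>B. c \<beta> * w \<beta> \<alpha>) = 0" and \<beta>: "\<beta> \<in> B"
    have "c \<beta> = (\<Sum>\<gamma>\<in>B. c \<gamma> * (if \<beta> = \<gamma> then 1 else 0))" using fin \<beta> by (simp add: sum_mult_delta)
    also have "\<dots> = (\<Sum>\<gamma>\<in>B. c \<gamma> * (\<Sum>\<alpha>\<in>A. w \<gamma> \<alpha> * u \<alpha> \<beta>))" using w \<beta> by (intro sum.cong) auto
    also have "\<dots> = (\<Sum>\<alpha>\<in>A. (\<Sum>\<gamma>\<in>B. c \<gamma> * w \<gamma> \<alpha>) * u \<alpha> \<beta>)"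
      unfolding sum_distrib_left sum_distrib_right by (subst sum.swap) (simp add: mult.assoc)
    also have "\<dots> = 0" using c by simp
    finally show "c \<beta> = 0" .
  qed
qed

text \<open>Adjoining \<open>w\<close>, indexed by \<open>None\<close>, gives one vector too many,
  hence a dependence; its coefficient at \<open>w\<close> is nonzero by independence of the
  rest.\<close>

lemma spanning_of_independent:
  fixes u :: "'a \<Rightarrow> 'b \<Rightarrow> 'k::field"
  assumes fin: "finite A" "finite B" and card: "card A = card B"
    and ind: "\<And>c. (\<forall>m\<in>B. (\<Sum>\<alpha>\<in>A. c \<alpha> * u \<alpha> m) = 0) \<Longrightarrow> \<forall>\<alpha>\<in>A. c \<alpha> = 0"
  shows "\<exists>c. \<forall>m\<in>B. (\<Sum>\<alpha>\<in>A. c \<alpha> * u \<alpha> m) = w m"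
proof -
  let ?A = "insert None (Some ` A)"
  let ?u = "\<lambda>a. case a of None \<Rightarrow> w | Some \<alpha> \<Rightarrow> u \<alpha>"
  have "card B < card ?A" using fin card by (simp add: card_insert_if card_image)
  then obtain c where c: "\<exists>a\<in>?A. c a \<noteq> 0" "\<forall>m\<in>B. (\<Sum>a\<in>?A. c a * ?u a m) = 0"
    using linear_dependence[OF fin(2), of ?A ?u] fin(1) by auto
  have eq: "c None * w m + (\<Sum>\<alpha>\<in>A. c (Some \<alpha>) * u \<alpha> m) = 0" if "m \<in> B" for m
    using c(2) that fin(1) by (simp add: sum.reindex)
  have "c None \<noteq> 0"
  proof
    assume 0: "c None = 0"
    then have "\<forall>\<alpha>\<in>A. c (Some \<alpha>) = 0" using ind[of "\<lambda>\<alpha>. c (Some \<alpha>)"] eq by simp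
    then show False using c(1) 0 by auto
  qed
  then have "(\<Sum>\<alpha>\<in>A. (- c (Some \<alpha>) / c None) * u \<alpha> m) = w m" if "m \<in> B" for m
  proof -
    have "(\<Sum>\<alpha>\<in>A. (- c (Some \<alpha>) / c None) * u \<alpha> m) = - (\<Sum>\<alpha>\<in>A. c (Some \<alpha>) * u \<alpha> m) / c None"
      by (simp add: sum_negf sum_divide_distrib)
    also have "- (\<Sum>\<alpha>\<in>A. c (Some \<alpha>) * u \<alpha> m) = c None * w m"
      using eq[OF that] unfolding neg_eq_iff_add_eq_0 by (simp only: add.commute)
    finally show ?thesis using \<open>c None \<noteq> 0\<close> by simp
  qed
  then show ?thesis by (intro exI[of _ "\<lambda>\<alpha>. - c (Some \<alpha>) / c None"]) simp
qed

text \<open>In the proof, \<open>Y i\<close> indexes a basis of a complement of the cocycles among the cochains of degree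
  \<open>i\<close>. Exactness gives \<open>card (Xi i) = card (Y (i - 1)) + card (Y i)\<close> below the top degree.\<close>

lemma exact_below_of_euler_char_zero:
  fixes X :: "'v set set"
  assumes or: "oriented \<nu> X" and conv: "convex_family X" and fin: "finite X"
    and ex: "exact_below TYPE('k::field) \<nu> X d" and le: "\<And>G. G \<in> X \<Longrightarrow> card G \<le> d"
    and \<chi>: "(\<Sum>G\<in>X. (-1) ^ card G) = (0::int)"
  shows "exact_below TYPE('k) \<nu> X n"
proof -
  let ?\<delta> = "cob \<nu> (\<lambda>_. 1) X :: ('v set \<Rightarrow> 'k) \<Rightarrow> _"
  let ?e = "\<lambda>G H. if H = G then 1 else 0 :: 'k"
  define Xi where "Xi i = {G \<in> X. card G = i}" for i
  have finXi: "finite (Xi i)" for i using fin by (simp add: Xi_def)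
  define supp where "supp Y c \<longleftrightarrow> (\<forall>G. G \<notin> Y \<longrightarrow> c G = 0)" for Y and c :: "'v set \<Rightarrow> 'k"
  define cocycle where "cocycle i c \<longleftrightarrow> (\<forall>H\<in>Xi (Suc i). ?\<delta> c H = 0)" for i c
  \<comment> \<open>The span of the basis cochains of \<open>Y\<close> meets the cocycles only in 0;
    for \<open>Y\<close> of maximal size it is a complement of the cocycles. Working with subsets of
    the standard basis turns dimensions into cardinalities.\<close>
  define free where "free i Y \<longleftrightarrow> Y \<subseteq> Xi i \<and> (\<forall>c. supp Y c \<and> cocycle i c \<longrightarrow> (\<forall>G. c G = 0))" for i Y
  have exXi: "\<exists>b. \<forall>G\<in>Xi i. c G = ?\<delta> b G" if "i < d" "cocycle i c" for i c
  proof -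
    have "\<forall>G\<in>X. card G = Suc i \<longrightarrow> ?\<delta> c G = 0" using that(2) by (simp add: cocycle_def Xi_def)
    then have "\<exists>b. \<forall>G\<in>X. card G = i \<longrightarrow> c G = ?\<delta> b G" using ex that(1) unfolding exact_below_def by simp
    then obtain b where "\<And>G. G \<in> X \<Longrightarrow> card G = i \<Longrightarrow> c G = ?\<delta> b G" by auto
    then show ?thesis by (intro exI[of _ b]) (simp add: Xi_def)
  qed
  have supp_expand: "c = (\<lambda>H. \<Sum>G\<in>Y. c G * ?e G H)" if "supp Y c" "finite Y" for Y c
    using that by (auto simp: supp_def fun_eq_iff sum_mult_delta)
  have supp_comb: "supp Y (\<lambda>H. \<Sum>G\<in>Y. a G * ?e G H)" for Y a
    by (auto simp: supp_def intro!: sum.neutral)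
  have \<delta>_comb: "?\<delta> (\<lambda>H. \<Sum>G\<in>Y. a G * ?e G H) H = (\<Sum>G\<in>Y. a G * ?\<delta> (?e G) H)" for Y a H
    by (rule cob_sum_scale)
  have "\<exists>Y. free i Y \<and> (\<forall>Y'. free i Y' \<longrightarrow> card Y' \<le> card Y)" for i
  proof -
    have "free i {}" by (auto simp: free_def supp_def)
    moreover have "\<forall>Y. free i Y \<longrightarrow> card Y < Suc (card (Xi i))"
      using card_mono[OF finXi] by (auto simp: free_def less_Suc_eq_le)
    ultimately show ?thesis by (rule ex_has_greatest_nat)
  qed
  then obtain Y where Y: "\<And>i. free i (Y i)" and Ymax: "\<And>i Y'. free i Y' \<Longrightarrow> card Y' \<le> card (Y i)" by metis
  have YX: "Y i \<subseteq> Xi i" for i using Y by (simp add: free_def)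
  have freeD: "\<forall>G. c G = 0" if "supp (Y i) c" "cocycle i c" for i c
    using Y[of i] that unfolding free_def by blast
  have finY: "finite (Y i)" for i using finite_subset[OF YX finXi] .
  have dec1: "\<exists>y. supp (Y i) y \<and> cocycle i (\<lambda>G. ?e \<beta> G - y G)" if \<beta>: "\<beta> \<in> Xi i" for i \<beta>
  proof (cases "\<beta> \<in> Y i")
    case True
    then show ?thesis by (intro exI[of _ "?e \<beta>"]) (auto simp: supp_def cocycle_def cob_def)
  next
    case False
    \<comment> \<open>Maximality yields a cocycle supported on \<open>insert \<beta> (Y i)\<close>
      and nonzero at \<open>\<beta>\<close>; subtracting its normalised multiple moves the basis
      cochain of \<open>\<beta>\<close> into the span of \<open>Y i\<close>.\<close>
    then have "card (insert \<beta> (Y i)) > card (Y i)" using finY by simp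
    then have "\<not> free i (insert \<beta> (Y i))" using Ymax by (meson not_le)
    then obtain w G where w: "supp (insert \<beta> (Y i)) w" "cocycle i w" "w G \<noteq> 0"
      using YX \<beta> by (auto simp: free_def)
    have "w \<beta> \<noteq> 0"
    proof
      assume "w \<beta> = 0"
      then have "supp (Y i) w" using w(1) unfolding supp_def by (metis insert_iff)
      then show False using Y[of i] w unfolding free_def by blast
    qed
    let ?y = "\<lambda>G. ?e \<beta> G - inverse (w \<beta>) * w G"
    have "supp (Y i) ?y" using w(1) \<open>w \<beta> \<noteq> 0\<close> by (auto simp: supp_def)
    moreover have "(\<lambda>G. ?e \<beta> G - ?y G) = (\<lambda>G. inverse (w \<beta>) * w G)" by auto
    then have "cocycle i (\<lambda>G. ?e \<beta> G - ?y G)" using w(2) by (simp only: cocycle_def cob_scale) simp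
    ultimately show ?thesis by blast
  qed
  have dec: "\<exists>y. supp (Y i) y \<and> cocycle i (\<lambda>G. c G - y G)" for i c
  proof -
    have "\<exists>y. \<forall>\<beta>. \<beta> \<in> Xi i \<longrightarrow> supp (Y i) (y \<beta>) \<and> cocycle i (\<lambda>G. ?e \<beta> G - y \<beta> G)"
    proof (rule choice, rule allI)
      fix \<beta> show "\<exists>y. \<beta> \<in> Xi i \<longrightarrow> supp (Y i) y \<and> cocycle i (\<lambda>G. ?e \<beta> G - y G)"
        using dec1[of \<beta> i] by (cases "\<beta> \<in> Xi i") auto
    qed
    then obtain y where y: "\<And>\<beta>. \<beta> \<in> Xi i \<Longrightarrow> supp (Y i) (y \<beta>)" "\<And>\<beta>. \<beta> \<in> Xi i \<Longrightarrow> cocycle i (\<lambda>G. ?e \<beta> G - y \<beta> G)"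
      by auto
    let ?y = "\<lambda>G. \<Sum>\<beta>\<in>Xi i. c \<beta> * y \<beta> G"
    have "supp (Y i) ?y" using y(1) by (auto simp: supp_def)
    moreover have "cocycle i (\<lambda>G. c G - ?y G)"
      unfolding cocycle_def
    proof
      fix H assume H: "H \<in> Xi (Suc i)"
      have "?\<delta> (\<lambda>G. c G - ?y G) H = ?\<delta> (\<lambda>G. \<Sum>\<beta>\<in>Xi i. c \<beta> * (?e \<beta> G - y \<beta> G)) H"
      proof (rule cob_cong)
        fix v assume "v \<in> H" "H - {v} \<in> X"
        then have "H - {v} \<in> Xi i" using H or by (auto simp: Xi_def oriented_def)
        then show "c (H - {v}) - ?y (H - {v}) = (\<Sum>\<beta>\<in>Xi i. c \<beta> * (?e \<beta> (H - {v}) - y \<beta> (H - {v})))"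
          using finXi by (simp add: right_diff_distrib sum_subtractf sum_mult_delta)
      qed
      also have "\<dots> = (\<Sum>\<beta>\<in>Xi i. c \<beta> * ?\<delta> (\<lambda>G. ?e \<beta> G - y \<beta> G) H)" by (rule cob_sum_scale)
      also have "\<dots> = 0" using y(2) H by (intro sum.neutral) (auto simp: cocycle_def)
      finally show "?\<delta> (\<lambda>G. c G - ?y G) H = 0" .
    qed
    ultimately show ?thesis by blast
  qed
  \<comment> \<open>The coboundary maps the span of \<open>Yp i\<close> isomorphically onto the
    coboundaries of degree \<open>i\<close>; in degree 0 there are none.\<close>
  define Yp where "Yp i = (case i of 0 \<Rightarrow> {} | Suc j \<Rightarrow> Y j)" for i
  have finYp: "finite (Yp i)" for i using finY by (auto simp: Yp_def split: nat.split)
  have \<delta>0: "?\<delta> c G = 0" if "G \<in> Xi 0" for c G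
    using that or by (auto simp: Xi_def oriented_def cob_def)
  have normalize: "\<exists>y. supp (Yp i) y \<and> (\<forall>G\<in>Xi i. ?\<delta> b G = ?\<delta> y G)" for i b
  proof (cases i)
    case 0
    then show ?thesis using \<delta>0 by (intro exI[of _ "\<lambda>_. 0"]) (auto simp: supp_def)
  next
    case (Suc j)
    obtain y where "supp (Y j) y" "cocycle j (\<lambda>G. b G - y G)" using dec by blast
    then show ?thesis using Suc by (intro exI[of _ y]) (auto simp: Yp_def cocycle_def cob_diff)
  qed
  have injYp: "\<forall>G. c G = 0" if "supp (Yp i) c" "\<forall>G\<in>Xi i. ?\<delta> c G = 0" for i c
  proof (cases i)
    case 0
    then show ?thesis using that by (simp add: Yp_def supp_def)
  next
    case (Suc j)
    then have "supp (Y j) c" "cocycle j c" using that by (auto simp: Yp_def cocycle_def)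
    then show ?thesis using Y[of j] unfolding free_def by blast
  qed
  have cardXi: "card (Xi i) = card (Yp i) + card (Y i)" if i: "i < d" for i
  proof -
    \<comment> \<open>A basis in degree \<open>i\<close>: coboundaries, which by exactness are all
      cocycles, and the complement of the cocycles.\<close>
    let ?A = "Inl ` Yp i \<union> Inr ` Y i"
    let ?u = "\<lambda>a. case a of Inl G \<Rightarrow> ?\<delta> (?e G) | Inr G \<Rightarrow> ?e G"
    have finA: "finite ?A" using finY finYp by simp
    have sumA: "(\<Sum>a\<in>?A. c a * ?u a m) = ?\<delta> (\<lambda>H. \<Sum>G\<in>Yp i. c (Inl G) * ?e G H) m + (\<Sum>G\<in>Y i. c (Inr G) * ?e G m)" for c m
      unfolding \<delta>_comb using finY finYp by (subst sum.union_disjoint) (auto simp: sum.reindex)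
    have "card ?A \<le> card (Xi i)"
    proof (rule card_le_of_independent[where u = ?u, OF finA finXi])
      fix c assume c: "\<forall>m\<in>Xi i. (\<Sum>a\<in>?A. c a * ?u a m) = 0"
      let ?p = "\<lambda>H. \<Sum>G\<in>Yp i. c (Inl G) * ?e G H" and ?q = "\<lambda>H. \<Sum>G\<in>Y i. c (Inr G) * ?e G H"
      have pq: "?\<delta> ?p m + ?q m = 0" if "m \<in> Xi i" for m using c that unfolding sumA by blast
      have "cocycle i ?q"
        unfolding cocycle_def
      proof
        fix H assume H: "H \<in> Xi (Suc i)"
        have "?\<delta> ?q H = ?\<delta> (\<lambda>m. (-1) * ?\<delta> ?p m) H"
        proof (rule cob_cong)
          fix v assume "v \<in> H" "H - {v} \<in> X"
          then have "H - {v} \<in> Xi i" using H or by (auto simp: Xi_def oriented_def)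
          then show "?q (H - {v}) = (-1) * ?\<delta> ?p (H - {v})" using pq by (simp add: eq_neg_iff_add_eq_0 add.commute)
        qed
        also have "\<dots> = (-1) * ?\<delta> (?\<delta> ?p) H" by (rule cob_scale)
        also have "\<dots> = 0" using H by (simp add: Xi_def cob_cob[OF or conv])
        finally show "?\<delta> ?q H = 0" .
      qed
      moreover have "supp (Y i) ?q" by (rule supp_comb)
      ultimately have q0: "\<forall>G. ?q G = 0" by (rule freeD[rotated])
      have p0: "\<forall>G. ?p G = 0"
      proof (rule injYp)
        show "supp (Yp i) ?p" by (rule supp_comb)
        show "\<forall>G\<in>Xi i. ?\<delta> ?p G = 0"
        proof
          fix G assume "G \<in> Xi i"
          then show "?\<delta> ?p G = 0" using pq[of G] q0[rule_format, of G] by (simp only: add_0_right)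
        qed
      qed
      have "c (Inl G) = 0" if "G \<in> Yp i" for G using p0[rule_format, of G] that finYp by (simp add: sum_mult_delta)
      moreover have "c (Inr G) = 0" if "G \<in> Y i" for G using q0[rule_format, of G] that finY by (simp add: sum_mult_delta)
      ultimately show "\<forall>\<alpha>\<in>?A. c \<alpha> = 0" by auto
    qed
    moreover have "card (Xi i) \<le> card ?A"
    proof (rule card_le_of_spanning[where u = ?u, OF finA finXi])
      fix \<beta> assume \<beta>: "\<beta> \<in> Xi i"
      obtain y where y: "supp (Y i) y" "cocycle i (\<lambda>G. ?e \<beta> G - y G)"
        using dec1[OF \<beta>] by auto
      obtain b where b: "\<And>G. G \<in> Xi i \<Longrightarrow> ?e \<beta> G - y G = ?\<delta> b G" using exXi[OF i y(2)] by auto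
      obtain z where z: "supp (Yp i) z" "\<And>G. G \<in> Xi i \<Longrightarrow> ?\<delta> b G = ?\<delta> z G" using normalize[of i b] by auto
      have "(\<Sum>a\<in>?A. (case a of Inl G \<Rightarrow> z G | Inr G \<Rightarrow> y G) * ?u a m) = ?e \<beta> m" if "m \<in> Xi i" for m
      proof -
        have zz: "(\<lambda>H. \<Sum>G\<in>Yp i. z G * ?e G H) = z" by (rule supp_expand[OF z(1) finYp, symmetric])
        have yy: "(\<Sum>G\<in>Y i. y G * ?e G m) = y m" by (rule supp_expand[OF y(1) finY, THEN fun_cong, symmetric])
        show ?thesis
          unfolding sumA sum.case zz yy using b[OF that] z(2)[OF that] by (simp add: algebra_simps)
      qed
      then show "\<exists>c. \<forall>m\<in>Xi i. (\<Sum>a\<in>?A. c a * ?u a m) = ?e \<beta> m"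
        by (intro exI[of _ "\<lambda>a. case a of Inl G \<Rightarrow> z G | Inr G \<Rightarrow> y G"] ballI)
    qed
    moreover have "card ?A = card (Yp i) + card (Y i)"
      using finY finYp by (subst card_Un_disjoint) (auto simp: card_image)
    ultimately show ?thesis by simp
  qed
  \<comment> \<open>The alternating sum telescopes because \<open>Yp (Suc i) = Y i\<close>; what
    remains is the number of coboundaries in degree \<open>j\<close>.\<close>
  have alt: "(\<Sum>i<j. (-1) ^ i * int (card (Xi i))) = - ((-1) ^ j) * int (card (Yp j))" if "j \<le> d" for j
    using that
  proof (induction j)
    case (Suc j)
    then show ?case using cardXi[of j] by (simp add: Yp_def algebra_simps)
  qed (simp add: Yp_def)
  have "(\<Sum>i<Suc d. (-1) ^ i * int (card (Xi i))) = (\<Sum>i<Suc d. \<Sum>G | G \<in> X \<and> card G = i. (-1) ^ card G)"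
    by (intro sum.cong) (auto simp: Xi_def)
  also have "\<dots> = (\<Sum>G\<in>X. (-1) ^ card G)"
    using fin le by (intro sum.group) (auto simp: less_Suc_eq_le)
  finally have "(-1) ^ d * (int (card (Xi d)) - int (card (Yp d))) = 0"
    using \<chi> alt[of d] by (simp add: algebra_simps)
  then have cardd: "card (Yp d) = card (Xi d)" by simp
  \<comment> \<open>The vanishing sum makes the coboundaries in degree \<open>d\<close> as numerous
    as all cochains there, so every cochain is one. Above \<open>d\<close> there are no
    sets.\<close>
  have top: "\<exists>b. \<forall>G\<in>Xi d. c G = ?\<delta> b G" for c
  proof -
    have "\<exists>a. \<forall>m\<in>Xi d. (\<Sum>G\<in>Yp d. a G * ?\<delta> (?e G) m) = c m"
    proof (rule spanning_of_independent[OF finYp finXi cardd])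
      fix a assume "\<forall>m\<in>Xi d. (\<Sum>G\<in>Yp d. a G * ?\<delta> (?e G) m) = 0"
      then have "\<forall>G. (\<Sum>H\<in>Yp d. a H * ?e H G) = 0"
        by (intro injYp[OF supp_comb[of "Yp d" a]]) (simp only: \<delta>_comb)
      then show "\<forall>G\<in>Yp d. a G = 0" using finYp by (simp add: sum_mult_delta) metis
    qed
    then obtain a where a: "\<And>m. m \<in> Xi d \<Longrightarrow> (\<Sum>G\<in>Yp d. a G * ?\<delta> (?e G) m) = c m" by blast
    show ?thesis
      by (intro exI[of _ "\<lambda>H. \<Sum>G\<in>Yp d. a G * ?e G H"] ballI) (simp only: \<delta>_comb a)
  qed
  show ?thesis
  proof (rule exact_belowI)
    fix i and c :: "'v set \<Rightarrow> 'k"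
    assume c: "\<And>G. G \<in> X \<Longrightarrow> card G = Suc i \<Longrightarrow> ?\<delta> c G = 0"
    consider "i < d" | "i = d" | "d < i" by linarith
    then show "\<exists>b. \<forall>G\<in>X. card G = i \<longrightarrow> c G = ?\<delta> b G"
    proof cases
      case 1
      have "cocycle i c" using c by (simp add: cocycle_def Xi_def)
      from exXi[OF 1 this] obtain b where "\<And>G. G \<in> Xi i \<Longrightarrow> c G = ?\<delta> b G" by auto
      then show ?thesis by (intro exI[of _ b]) (simp add: Xi_def)
    next
      case 2
      from top[of c] obtain b where "\<And>G. G \<in> Xi d \<Longrightarrow> c G = ?\<delta> b G" by auto
      then show ?thesis using 2 by (intro exI[of _ b]) (simp add: Xi_def)
    next
      case 3 then show ?thesis using le by (intro exI[of _ c]) fastforce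
    qed
  qed
qed

section \<open>Order complexes\<close>

text \<open>\<open>var_ideal\<close> involves the variables of the whole type, but those outside
  \<open>V\<close> belong to the Stanley--Reisner ideal as singleton non-faces.\<close>

lemma var_ideal_combination:
  fixes a :: "('v, 'k::field) mpoly"
  assumes V: "finite V" "\<And>G. G \<in> \<Delta> \<Longrightarrow> G \<subseteq> V" and a: "a \<in> var_ideal"
  shows "\<exists>g. a - (\<Sum>u\<in>V. g u * pvar u) \<in> SR_ideal \<Delta>"
proof -
  let ?I = "SR_ideal \<Delta> :: ('v, 'k) mpoly set"
  let ?J = "{a. \<exists>g. a - (\<Sum>u\<in>V. g u * pvar u) \<in> ?I}"
  have I: "is_ideal ?I" by (rule is_ideal_SR_ideal)
  have "is_ideal ?J"
    unfolding is_ideal_def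
  proof (intro conjI ballI allI)
    show "0 \<in> ?J" using is_idealD(1)[OF I] by (auto intro!: exI[of _ "\<lambda>_. 0"])
  next
    fix a b assume "a \<in> ?J" "b \<in> ?J"
    then obtain g h where "a - (\<Sum>u\<in>V. g u * pvar u) \<in> ?I" "b - (\<Sum>u\<in>V. h u * pvar u) \<in> ?I" by auto
    then have "(a - (\<Sum>u\<in>V. g u * pvar u)) + (b - (\<Sum>u\<in>V. h u * pvar u)) \<in> ?I" by (rule is_idealD(2)[OF I])
    then have "a + b - (\<Sum>u\<in>V. (g u + h u) * pvar u) \<in> ?I"
      by (simp add: distrib_right sum.distrib algebra_simps)
    then show "a + b \<in> ?J" by (intro CollectI exI[of _ "\<lambda>u. g u + h u"])
  next
    fix r a assume "a \<in> ?J"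
    then obtain g where "a - (\<Sum>u\<in>V. g u * pvar u) \<in> ?I" by auto
    then have "r * (a - (\<Sum>u\<in>V. g u * pvar u)) \<in> ?I" by (rule is_idealD(3)[OF I])
    then have "r * a - (\<Sum>u\<in>V. (r * g u) * pvar u) \<in> ?I"
      by (simp add: right_diff_distrib sum_distrib_left mult.assoc)
    then show "r * a \<in> ?J" by (intro CollectI exI[of _ "\<lambda>u. r * g u"])
  qed
  moreover have "range pvar \<subseteq> ?J"
  proof clarify
    fix v :: 'v
    show "\<exists>g. pvar v - (\<Sum>u\<in>V. g u * pvar u) \<in> ?I"
    proof (cases "v \<in> V")
      case True
      have "(\<Sum>u\<in>V. (if u = v then 1 else 0) * pvar u) = (\<Sum>u\<in>V. if u = v then pvar v else 0 :: ('v, 'k) mpoly)"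
        by (rule sum.cong) auto
      then have "pvar v - (\<Sum>u\<in>V. (if u = v then 1 else 0) * pvar u) = (0 :: ('v, 'k) mpoly)"
        using True V by simp
      then show ?thesis using is_idealD(1)[OF I] by (intro exI[of _ "\<lambda>u. if u = v then 1 else 0"]) simp
    next
      case False
      then have "{v} \<notin> \<Delta>" using V(2) by auto
      then have "(\<Prod>u\<in>{v}. pvar u) \<in> {\<Prod>v\<in>F. pvar v |F. finite F \<and> F \<notin> \<Delta>}" by (intro CollectI exI[of _ "{v}"]) simp
      then have "pvar v \<in> ?I" unfolding SR_ideal_def using gen_ideal_superset by fastforce
      then show ?thesis by (intro exI[of _ "\<lambda>_. 0"]) simp
    qed
  qed
  ultimately have "var_ideal \<subseteq> ?J" unfolding var_ideal_def by (rule gen_ideal_least)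
  then show ?thesis using a by blast
qed

text \<open>The face \<open>K\<close> bounds the Krull dimension, hence the depth, from below by
  \<open>d\<close>; a regular sequence of that length gives Koszul exactness, then exactness for
  deletions, then for stars.\<close>

lemma exact_star_of_cohen_macaulay:
  fixes \<Delta> :: "'v set set"
  assumes CM: "SR_cohen_macaulay TYPE('k::field) \<Delta>"
    and \<Delta>: "simplicial \<Delta>" "finite V" "\<And>G. G \<in> \<Delta> \<Longrightarrow> G \<subseteq> V" and \<nu>: "inj_on \<nu> V"
    and K: "K \<in> \<Delta>" "card K = d" and F: "F \<in> \<Delta>"
  shows "exact_below TYPE('k) \<nu> {G \<in> \<Delta>. F \<subseteq> G} d"
proof (cases d)
  case 0
  then show ?thesis by (simp add: exact_below_def)
next
  case (Suc k)
  let ?I = "SR_ideal \<Delta> :: ('v, 'k) mpoly set"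
  have "enat (Suc k) \<le> krull_dim_quot ?I"
    using krull_dim_quot_ge_card_face[OF \<Delta>(1) K(1) finite_subset[OF \<Delta>(3)[OF K(1)] \<Delta>(2)]] K(2) Suc by simp
  then have "enat (Suc k) \<le> depth_quot ?I var_ideal" using CM by (simp add: SR_cohen_macaulay_def)
  then obtain f where "regular_seq_quot ?I var_ideal (Suc k) f" by (rule depth_quot_ge_imp_regular_seq)
  then have "koszul_exact \<nu> pvar V ?I d"
    unfolding Suc using var_ideal_combination[OF \<Delta>(2,3)]
    by (intro koszul_exact_of_regular_seq[OF \<Delta>(2) \<nu> is_ideal_SR_ideal]) auto
  then have "exact_below TYPE('k) \<nu> {G \<in> \<Delta>. G \<inter> U = {}} (d - card U)" if "U \<subseteq> V" for U
    using that by (intro exact_deletion_of_koszul_exact[OF \<Delta>(2) \<nu> \<Delta>(1,3)])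
  from exact_star_of_exact_deletion[OF \<Delta>(2) \<nu> \<Delta>(1,3) this, of F "{}"]
  show ?thesis using \<Delta>(3)[OF F] finite_subset[OF \<Delta>(3)[OF F] \<Delta>(2)] by simp
qed

lemma simplicial_order_complex: "simplicial (order_complex P le)"
  by (auto simp: simplicial_def order_complex_def intro: finite_subset)

locale finite_poset =
  fixes P :: "'a set" and le :: "'a \<Rightarrow> 'a \<Rightarrow> bool"
  assumes fin: "finite P" and po: "partial_order_on' P le"
begin

abbreviation \<Delta> :: "'a set set" where "\<Delta> \<equiv> order_complex P le"

lemma refl: "x \<in> P \<Longrightarrow> le x x"
  and antisym: "x \<in> P \<Longrightarrow> y \<in> P \<Longrightarrow> le x y \<Longrightarrow> le y x \<Longrightarrow> x = y"
  and trans: "x \<in> P \<Longrightarrow> y \<in> P \<Longrightarrow> z \<in> P \<Longrightarrow> le x y \<Longrightarrow> le y z \<Longrightarrow> le x z"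
  using po unfolding partial_order_on'_def by blast+

lemma chain_iff: "G \<in> \<Delta> \<longleftrightarrow> G \<subseteq> P \<and> (\<forall>x\<in>G. \<forall>y\<in>G. le x y \<or> le y x)"
  unfolding order_complex_def using finite_subset[OF _ fin] by blast

lemma chainD: "G \<in> \<Delta> \<Longrightarrow> G \<subseteq> P" "G \<in> \<Delta> \<Longrightarrow> finite G" "G \<in> \<Delta> \<Longrightarrow> x \<in> G \<Longrightarrow> y \<in> G \<Longrightarrow> le x y \<or> le y x"
  unfolding order_complex_def by auto

lemma simplicial_chains: "simplicial \<Delta>"
  by (rule simplicial_order_complex)

lemma finite_chains: "finite \<Delta>"
  using chainD(1) fin by (intro finite_subset[of \<Delta> "Pow P"]) auto

section \<open>Linear extensions, rank and height of a finite poset\<close>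

definition strict_mono_P :: "('a \<Rightarrow> nat) \<Rightarrow> bool" where
  "strict_mono_P f \<longleftrightarrow> (\<forall>x\<in>P. \<forall>y\<in>P. strict le x y \<longrightarrow> f x < f y)"

lemma strict_mono_P_chain:
  assumes "strict_mono_P f" "G \<in> \<Delta>" "x \<in> G" "y \<in> G"
  shows "f x < f y \<longleftrightarrow> strict le x y" "f x = f y \<longleftrightarrow> x = y" "f x \<le> f y \<longleftrightarrow> le x y"
proof -
  have P: "x \<in> P" "y \<in> P" using assms chainD(1) by auto
  have "le x y \<or> le y x" using chainD(3)[OF assms(2-4)] .
  then consider "x = y" | "strict le x y" "f x < f y" | "strict le y x" "f y < f x"
    using assms(1) P unfolding strict_mono_P_def strict_def by blast
  then show "f x < f y \<longleftrightarrow> strict le x y" "f x = f y \<longleftrightarrow> x = y" "f x \<le> f y \<longleftrightarrow> le x y"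
    using antisym[OF P] refl[OF P(1)] by (cases; auto simp: strict_def)+
qed

lemma strict_mono_P_inj_on: "strict_mono_P f \<Longrightarrow> G \<in> \<Delta> \<Longrightarrow> inj_on f G"
  using strict_mono_P_chain(2) by (intro inj_onI) blast

lemma strict_mono_P_osgn:
  assumes "strict_mono_P f" "strict_mono_P g" "G \<in> \<Delta>" "v \<in> G"
  shows "osgn f v G = osgn g v G"
proof -
  have "{w \<in> G. f w < f v} = {w \<in> G. g w < g v}" using assms strict_mono_P_chain(1) by blast
  then show ?thesis by (simp add: osgn_def)
qed

text \<open>The pair of the number of elements below \<open>x\<close> and an arbitrary label under
  \<open>N\<close> is encoded in base \<open>N\<close>: the first entry makes it monotone, the
  second injective.\<close>

lemma linear_extension_exists: "\<exists>\<nu>. strict_mono_P \<nu> \<and> inj_on \<nu> P"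
proof -
  obtain g :: "'a \<Rightarrow> nat" and N where g: "g ` P = {i. i < N}" "inj_on g P"
    using finite_imp_inj_to_nat_seg[OF fin] by auto
  have gN: "g x < N" if "x \<in> P" for x using g(1) that by auto
  let ?\<nu> = "\<lambda>x. card (below P le x) * N + g x"
  have "inj_on ?\<nu> P"
  proof (rule inj_onI)
    fix x y assume xy: "x \<in> P" "y \<in> P" "?\<nu> x = ?\<nu> y"
    have "?\<nu> z mod N = g z" if "z \<in> P" for z using gN[OF that] by simp
    then have "g x = g y" using xy by metis
    then show "x = y" using g(2) xy by (auto dest: inj_onD)
  qed
  moreover have "strict_mono_P ?\<nu>"
    unfolding strict_mono_P_def
  proof (intro ballI impI)
    fix x y assume xy: "x \<in> P" "y \<in> P" "strict le x y"
    have "below P le x \<subset> below P le y"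
    proof
      show "below P le x \<subseteq> below P le y"
        using xy trans antisym unfolding below_def strict_def by blast
      show "below P le x \<noteq> below P le y"
        using xy by (auto simp: below_def strict_def)
    qed
    then have "card (below P le x) < card (below P le y)"
      using fin by (intro psubset_card_mono) (auto simp: below_def)
    then have "Suc (card (below P le x)) * N \<le> card (below P le y) * N" by (intro mult_right_mono) auto
    then show "?\<nu> x < ?\<nu> y" using gN[OF xy(1)] by simp
  qed
  ultimately show ?thesis by blast
qed

definition height :: nat where "height = Max (card ` \<Delta>)"

text \<open>\<open>P\<close> is not assumed graded; the longest chain strictly below
  \<open>x\<close> still separates comparable elements and takes values below
  \<open>height\<close>.\<close>

definition rk :: "'a \<Rightarrow> nat" where "rk x = Max (card ` order_complex (below P le x) le)"

lemma card_chain_le: "G \<in> \<Delta> \<Longrightarrow> card G \<le> height"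
  unfolding height_def using finite_chains by (intro Max_ge) auto

lemma height_attained: "\<exists>K\<in>\<Delta>. card K = height"
proof -
  have "Max (card ` \<Delta>) \<in> card ` \<Delta>"
    using finite_chains simplicial_chains by (intro Max_in) (auto simp: simplicial_def)
  then show ?thesis unfolding height_def by auto
qed

lemma chains_below:
  "C \<in> order_complex (below P le x) le \<longleftrightarrow> C \<in> \<Delta> \<and> (\<forall>c\<in>C. strict le c x)"
  unfolding order_complex_def below_def by blast

lemma finite_chains_below: "finite (order_complex (below P le x) le)"
  using finite_chains by (rule finite_subset[rotated]) (auto simp: chains_below)

lemma rk_attained:
  obtains C where "C \<in> \<Delta>" "\<And>c. c \<in> C \<Longrightarrow> strict le c x" "card C = rk x"
proof -
  have "{} \<in> order_complex (below P le x) le" by (simp add: order_complex_def)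
  then have "rk x \<in> card ` order_complex (below P le x) le"
    unfolding rk_def using finite_chains_below by (intro Max_in) auto
  then obtain C where "C \<in> order_complex (below P le x) le" "card C = rk x" by auto
  then show ?thesis using that chains_below by auto
qed

lemma chain_insert_top:
  assumes "C \<in> \<Delta>" "x \<in> P" "\<And>c. c \<in> C \<Longrightarrow> strict le c x"
  shows "insert x C \<in> \<Delta>" "card (insert x C) = Suc (card C)"
proof -
  show "insert x C \<in> \<Delta>" using assms refl unfolding chain_iff strict_def by blast
  have "x \<notin> C" using assms(3) by (auto simp: strict_def)
  then show "card (insert x C) = Suc (card C)" using chainD(2)[OF assms(1)] by simp
qed

lemma rk_less_height: "x \<in> P \<Longrightarrow> rk x < height"
proof -
  assume x: "x \<in> P"
  obtain C where C: "C \<in> \<Delta>" "\<And>c. c \<in> C \<Longrightarrow> strict le c x" "card C = rk x" using rk_attained[of x] by blast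
  show ?thesis using card_chain_le[OF chain_insert_top(1)[OF C(1) x C(2)]] chain_insert_top(2)[OF C(1) x C(2)] C(3) by simp
qed

lemma strict_mono_rk: "strict_mono_P rk"
  unfolding strict_mono_P_def
proof (intro ballI impI)
  fix x y assume xy: "x \<in> P" "y \<in> P" "strict le x y"
  obtain C where C: "C \<in> \<Delta>" "\<And>c. c \<in> C \<Longrightarrow> strict le c x" "card C = rk x" using rk_attained[of x] by blast
  have "strict le c y" if "c \<in> insert x C" for c
  proof (cases "c = x")
    case False
    then have c: "c \<in> P" "strict le c x" using that C chainD(1) by auto
    then have "le c y" using trans[OF c(1) xy(1,2)] xy by (simp add: strict_def)
    moreover have "c \<noteq> y" using c xy antisym by (auto simp: strict_def)
    ultimately show ?thesis by (simp add: strict_def)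
  qed (use xy in simp)
  then have "insert x C \<in> order_complex (below P le y) le"
    using chain_insert_top(1)[OF C(1) xy(1) C(2)] by (simp add: chains_below)
  then have "card (insert x C) \<le> rk y" unfolding rk_def using finite_chains_below by (intro Max_ge) auto
  then show "rk x < rk y" using chain_insert_top(2)[OF C(1) xy(1) C(2)] C(3) by simp
qed

lemma rk_mono: "x \<in> P \<Longrightarrow> y \<in> P \<Longrightarrow> le x y \<Longrightarrow> rk x \<le> rk y"
  using strict_mono_rk unfolding strict_mono_P_def strict_def by (cases "x = y") (auto simp: less_imp_le)

lemma chain_has_min:
  assumes "C \<in> \<Delta>" "C \<noteq> {}"
  obtains y where "y \<in> C" "\<And>c. c \<in> C \<Longrightarrow> le y c"
proof -
  have "Min (rk ` C) \<in> rk ` C" using assms chainD(2) by (intro Min_in) auto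
  then obtain y where y: "y \<in> C" "rk y = Min (rk ` C)" by auto
  then have "rk y \<le> rk c" if "c \<in> C" for c using assms chainD(2) that by simp
  then show ?thesis using that y strict_mono_P_chain(3)[OF strict_mono_rk assms(1)] by blast
qed

text \<open>A chain through \<open>F\<close> is an arbitrary chain below the minimum
  \<open>y\<close> of \<open>F\<close> joined to a chain above \<open>y\<close> containing
  \<open>F\<close>. The sum is a product whose first factor is, up to sign, the reduced Euler
  characteristic of the part below \<open>y\<close>.\<close>

lemma star_euler_char_zero:
  assumes F: "F \<in> \<Delta>" "F \<noteq> {} \<Longrightarrow> y \<in> F" "\<And>c. c \<in> F \<Longrightarrow> le y c"
    and \<chi>: "F = {} \<Longrightarrow> red_euler_char P le = 0" "F \<noteq> {} \<Longrightarrow> red_euler_char (below P le y) le = 0"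
  shows "(\<Sum>H\<in>{H \<in> \<Delta>. F \<subseteq> H}. (-1) ^ card H) = (0::int)"
proof (cases "F = {}")
  case True
  then show ?thesis using \<chi>(1) by (simp add: red_euler_char_def sum_negf)
next
  case False
  then have y: "y \<in> F" "y \<in> P" using F chainD(1) by auto
  let ?A = "order_complex (below P le y) le"
  let ?B = "{B \<in> \<Delta>. F \<subseteq> B \<and> (\<forall>b\<in>B. le y b)}"
  let ?lo = "\<lambda>H. {h \<in> H. strict le h y}" and ?hi = "\<lambda>H. {h \<in> H. le y h}"
  have split: "?lo H \<union> ?hi H = H" if "H \<in> {H \<in> \<Delta>. F \<subseteq> H}" for H
    using that y chainD(3)[of H] refl[OF y(2)] by (auto simp: strict_def)
  have lo: "?lo (A \<union> B) = A" and hi: "?hi (A \<union> B) = B" if "A \<in> ?A" "B \<in> ?B" for A B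
  proof -
    have "\<not> strict le b y" if "b \<in> B" for b
      using that \<open>B \<in> ?B\<close> antisym[OF y(2), of b] chainD(1)[of B] by (auto simp: strict_def)
    then show "?lo (A \<union> B) = A" using that by (auto simp: chains_below)
    have "\<not> le y a" if "a \<in> A" for a
      using that \<open>A \<in> ?A\<close> antisym[OF y(2), of a] chainD(1)[of A] by (auto simp: chains_below strict_def)
    then show "?hi (A \<union> B) = B" using that by auto
  qed
  have un: "A \<union> B \<in> \<Delta> \<and> F \<subseteq> A \<union> B" if "A \<in> ?A" "B \<in> ?B" for A B
  proof -
    have AB: "A \<in> \<Delta>" "B \<in> \<Delta>" "F \<subseteq> B" using that by (auto simp: chains_below)
    have "le a b" if "a \<in> A" "b \<in> B" for a b
    proof -
      have "le a y" "le y b" using \<open>A \<in> ?A\<close> \<open>B \<in> ?B\<close> that by (auto simp: chains_below strict_def)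
      then show ?thesis using trans[of a y b] chainD(1)[OF AB(1)] chainD(1)[OF AB(2)] that y by blast
    qed
    then show ?thesis using AB unfolding chain_iff by blast
  qed
  have "(\<Sum>H\<in>{H \<in> \<Delta>. F \<subseteq> H}. (-1) ^ card H) = (\<Sum>(A, B)\<in>?A \<times> ?B. (-1::int) ^ card A * (-1) ^ card B)"
  proof (rule sum.reindex_bij_witness[where j = "\<lambda>H. (?lo H, ?hi H)" and i = "\<lambda>(A, B). A \<union> B"])
    fix H assume H: "H \<in> {H \<in> \<Delta>. F \<subseteq> H}"
    show "(case (?lo H, ?hi H) of (A, B) \<Rightarrow> A \<union> B) = H" using split[OF H] by simp
    have sub: "?lo H \<in> \<Delta>" "?hi H \<in> \<Delta>" using H simplicialD[OF simplicial_chains, of H] by auto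
    then show "(?lo H, ?hi H) \<in> ?A \<times> ?B" using H F(3) by (auto simp: chains_below)
    have "card H = card (?lo H) + card (?hi H)"
    proof -
      have "?lo H \<inter> ?hi H = {}" using H chainD(1)[of H] antisym[OF y(2)] by (auto simp: strict_def)
      then show ?thesis using card_Un_disjoint[of "?lo H" "?hi H"] split[OF H] chainD(2)[OF sub(1)] chainD(2)[OF sub(2)] by simp
    qed
    then show "(case (?lo H, ?hi H) of (A, B) \<Rightarrow> (-1::int) ^ card A * (-1) ^ card B) = (-1) ^ card H"
      by (simp add: power_add)
  next
    fix p assume p: "p \<in> ?A \<times> ?B"
    obtain A B where AB: "p = (A, B)" "A \<in> ?A" "B \<in> ?B" using p by blast
    show "(\<lambda>H. (?lo H, ?hi H)) (case p of (A, B) \<Rightarrow> A \<union> B) = p" using lo[OF AB(2,3)] hi[OF AB(2,3)] AB(1) by simp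
    show "(case p of (A, B) \<Rightarrow> A \<union> B) \<in> {H \<in> \<Delta>. F \<subseteq> H}" using un[OF AB(2,3)] AB(1) by simp
  qed
  also have "\<dots> = (\<Sum>A\<in>?A. (-1) ^ card A) * (\<Sum>B\<in>?B. (-1) ^ card B)"
    by (simp add: sum_product sum.cartesian_product)
  also have "(\<Sum>A\<in>?A. (-1) ^ card A) = (0::int)"
    using \<chi>(2)[OF False] by (simp add: red_euler_char_def sum_negf)
  finally show ?thesis by simp
qed

end

section \<open>The poset P \<uplus> Q\<close>

definition starred :: "('a + 'a) set \<Rightarrow> 'a set" where "starred G = {x. Inr x \<in> G}"

definition unstarred :: "('a + 'a) set \<Rightarrow> 'a set" where "unstarred G = {x. Inl x \<in> G}"

lemma starred_simps [simp]:
  "x \<in> starred G \<longleftrightarrow> Inr x \<in> G" "x \<in> unstarred G \<longleftrightarrow> Inl x \<in> G"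
  "starred (insert (Inl x) G) = starred G" "starred (insert (Inr x) G) = insert x (starred G)"
  "unstarred (insert (Inl x) G) = insert x (unstarred G)" "unstarred (insert (Inr x) G) = unstarred G"
  "starred (G - {Inl x}) = starred G" "unstarred (G - {Inr x}) = unstarred G"
  "starred (G - {Inr x}) = starred G - {x}" "unstarred (G - {Inl x}) = unstarred G - {x}"
  by (auto simp: starred_def unstarred_def)

lemma starred_mono: "G \<subseteq> H \<Longrightarrow> starred G \<subseteq> starred H" "G \<subseteq> H \<Longrightarrow> unstarred G \<subseteq> unstarred H"
  by (auto simp: starred_def unstarred_def)

locale finite_poset_ideal = finite_poset P le for P :: "'a set" and le +
  fixes Q :: "'a set"
  assumes ideal: "poset_ideal P le Q"
begin

abbreviation \<Gamma> :: "('a + 'a) set set" where "\<Gamma> \<equiv> order_complex (uplus_carrier P Q) (uplus_le le Q)"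

lemma QP: "Q \<subseteq> P" and Q_down: "x \<in> Q \<Longrightarrow> y \<in> P \<Longrightarrow> le y x \<Longrightarrow> y \<in> Q"
  using ideal unfolding poset_ideal_def strict_def by auto

lemma finite_carrier: "finite (uplus_carrier P Q)"
  unfolding uplus_carrier_def using fin finite_subset[OF QP fin] by simp

text \<open>A chain is a chain in \<open>Q\<close> followed by a chain in \<open>P\<close>. The
  comparison between the two is weak, so one element \<open>x\<close> may occur in both; all
  pairings below rest on this.\<close>

lemma uplus_chain_iff:
  "G \<in> \<Gamma> \<longleftrightarrow> starred G \<subseteq> Q \<and> starred G \<in> \<Delta> \<and> unstarred G \<in> \<Delta> \<and> (\<forall>x\<in>starred G. \<forall>y\<in>unstarred G. le x y)"
proof
  assume G: "G \<in> \<Gamma>"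
  have sub: "G \<subseteq> Inl ` P \<union> Inr ` Q" using G by (auto simp: order_complex_def uplus_carrier_def)
  have cmp: "uplus_le le Q a b \<or> uplus_le le Q b a" if "a \<in> G" "b \<in> G" for a b
    using G that by (auto simp: order_complex_def)
  have st: "starred G \<subseteq> Q" and un: "unstarred G \<subseteq> P" using sub by auto
  have stP: "x \<in> P" if "Inr x \<in> G" for x using st QP that starred_simps(1)[of x G] by blast
  have unP: "x \<in> P" if "Inl x \<in> G" for x using un that starred_simps(2)[of x G] by blast
  have "le x y \<or> le y x" if "Inr x \<in> G" "Inr y \<in> G" for x y
    using cmp[OF that] refl[OF stP[OF that(1)]] by (auto simp: uplus_le_def strict_def)
  moreover have "le x y \<or> le y x" if "Inl x \<in> G" "Inl y \<in> G" for x y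
    using cmp[OF that] refl[OF unP[OF that(1)]] by (auto simp: uplus_le_def strict_def)
  moreover have "le x y" if "Inr x \<in> G" "Inl y \<in> G" for x y
    using cmp[OF that] by (auto simp: uplus_le_def)
  ultimately show "starred G \<subseteq> Q \<and> starred G \<in> \<Delta> \<and> unstarred G \<in> \<Delta> \<and> (\<forall>x\<in>starred G. \<forall>y\<in>unstarred G. le x y)"
    using st un QP unfolding chain_iff by auto
next
  assume *: "starred G \<subseteq> Q \<and> starred G \<in> \<Delta> \<and> unstarred G \<in> \<Delta> \<and> (\<forall>x\<in>starred G. \<forall>y\<in>unstarred G. le x y)"
  have sub: "G \<subseteq> uplus_carrier P Q"
  proof
    fix a assume a: "a \<in> G"
    show "a \<in> uplus_carrier P Q"
    proof (cases a)
      case (Inl x)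
      then have "x \<in> unstarred G" using a by simp
      then have "x \<in> P" using * chainD(1) by blast
      then show ?thesis using Inl by (simp add: uplus_carrier_def)
    next
      case (Inr x)
      then have "x \<in> starred G" using a by simp
      then have "x \<in> Q" using * by blast
      then show ?thesis using Inr by (simp add: uplus_carrier_def)
    qed
  qed
  have st: "le x y \<or> le y x" if "Inr x \<in> G" "Inr y \<in> G" for x y using * chainD(3)[of "starred G" x y] that by simp
  have un: "le x y \<or> le y x" if "Inl x \<in> G" "Inl y \<in> G" for x y using * chainD(3)[of "unstarred G" x y] that by simp
  have su: "x \<in> Q \<and> le x y" if "Inr x \<in> G" "Inl y \<in> G" for x y using * that by auto
  have "uplus_le le Q a b \<or> uplus_le le Q b a" if "a \<in> G" "b \<in> G" for a b
    using that st un su by (cases a; cases b) (auto simp: uplus_le_def strict_def)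
  then show "G \<in> \<Gamma>" using sub finite_subset[OF sub finite_carrier] by (simp add: order_complex_def)
qed

lemma uplus_chainD:
  assumes "G \<in> \<Gamma>"
  shows "starred G \<subseteq> Q" "starred G \<in> \<Delta>" "unstarred G \<in> \<Delta>"
    "\<And>x y. Inr x \<in> G \<Longrightarrow> Inl y \<in> G \<Longrightarrow> le x y"
    "\<And>x. Inr x \<in> G \<Longrightarrow> x \<in> P" "\<And>x. Inl x \<in> G \<Longrightarrow> x \<in> P"
  using assms uplus_chain_iff[of G] QP chainD(1)[of "unstarred G"] by auto

text \<open>The shift by one on unstarred elements separates the two copies of an element and turns
  the weak comparison of a starred with an unstarred element into a strict one of colours.\<close>

definition urk :: "'a + 'a \<Rightarrow> nat" where "urk = case_sum (\<lambda>x. Suc (rk x)) rk"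

lemma urk_simps [simp]: "urk (Inl x) = Suc (rk x)" "urk (Inr x) = rk x"
  by (simp_all add: urk_def)

lemma coloured_uplus: "coloured urk (Suc height) (uplus_carrier P Q) \<Gamma>"
  unfolding coloured_def
proof (intro conjI ballI)
  show "finite (uplus_carrier P Q)" by (rule finite_carrier)
  show "simplicial \<Gamma>" by (rule simplicial_order_complex)
  show "urk ` uplus_carrier P Q \<subseteq> {..<Suc height}"
    using rk_less_height QP by (auto simp: uplus_carrier_def less_SucI)
  fix G assume G: "G \<in> \<Gamma>"
  show "G \<subseteq> uplus_carrier P Q" using G by (simp add: order_complex_def)
  note D = uplus_chainD[OF G]
  have st: "inj_on rk (starred G)" and un: "inj_on rk (unstarred G)"
    using strict_mono_P_inj_on[OF strict_mono_rk] D by auto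
  have mix: "rk x < Suc (rk y)" if "Inr x \<in> G" "Inl y \<in> G" for x y
    using rk_mono[OF D(5)[OF that(1)] D(6)[OF that(2)] D(4)[OF that]] by simp
  show "inj_on urk G"
  proof (rule inj_onI)
    fix a b assume ab: "a \<in> G" "b \<in> G" "urk a = urk b"
    show "a = b"
    proof (cases a; cases b)
      fix x y assume "a = Inl x" "b = Inl y" then show ?thesis using ab inj_onD[OF un, of x y] by simp
    next
      fix x y assume "a = Inr x" "b = Inr y" then show ?thesis using ab inj_onD[OF st, of x y] by simp
    next
      fix x y assume "a = Inl x" "b = Inr y" then show ?thesis using ab mix[of y x] by simp
    next
      fix x y assume "a = Inr x" "b = Inl y" then show ?thesis using ab mix[of x y] by simp
    qed
  qed
qed

lemma oriented_uplus: "oriented urk {G \<in> \<Gamma>. R G}"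
  using colouredD(8)[OF coloured_uplus] by (auto simp: oriented_def)

text \<open>\<open>z\<close> lies above all starred elements by maximality and below all unstarred
  ones because its starred copy does. Dually for the minimum of the unstarred part, provided that it
  lies in \<open>Q\<close>.\<close>

lemma insert_unstarred_max:
  assumes G: "G \<in> \<Gamma>" and z: "Inr z \<in> G" "\<And>a. Inr a \<in> G \<Longrightarrow> le a z"
  shows "insert (Inl z) G \<in> \<Gamma>"
proof -
  note D = uplus_chainD[OF G]
  have zP: "z \<in> P" using D z by auto
  have "insert z (unstarred G) \<in> \<Delta>"
    using D(3) D(4)[OF z(1)] zP refl[OF zP] unfolding chain_iff by auto
  then show ?thesis unfolding uplus_chain_iff using D z by auto
qed

lemma insert_starred_min:
  assumes G: "G \<in> \<Gamma>" and u: "Inl u \<in> G" "u \<in> Q" "\<And>b. Inl b \<in> G \<Longrightarrow> le u b"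
  shows "insert (Inr u) G \<in> \<Gamma>"
proof -
  note D = uplus_chainD[OF G]
  have uP: "u \<in> P" using QP u by auto
  have "insert u (starred G) \<in> \<Delta>"
    using D(2) D(4)[OF _ u(1)] uP refl[OF uP] unfolding chain_iff by auto
  then show ?thesis unfolding uplus_chain_iff using D u by auto
qed

text \<open>Faces \<open>G\<close> whose largest starred element is \<open>z\<^sup>*\<close> are paired by adding or removing the unstarred \<open>z\<close>,
  unless \<open>F\<close> contains \<open>z\<close>; dually for the smallest unstarred element below.\<close>

lemma exact_filter_max_starred:
  assumes lev0: "exact_below TYPE('k::field) urk {G \<in> \<Gamma>. F \<subseteq> G \<and> starred G = {}} n"
    and lev: "\<And>z. Inl z \<in> F \<Longrightarrow> exact_below TYPE('k) urk {G \<in> \<Gamma>. F \<subseteq> G \<and> Inr z \<in> G \<and> (\<forall>a. Inr a \<in> G \<longrightarrow> le a z)} n"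
  shows "exact_below TYPE('k) urk {G \<in> \<Gamma>. F \<subseteq> G} n"
proof -
  obtain \<nu> where \<nu>: "strict_mono_P \<nu>" "inj_on \<nu> P" using linear_extension_exists by blast
  let ?X = "{G \<in> \<Gamma>. F \<subseteq> G}"
  \<comment> \<open>Injectivity of \<open>\<nu>\<close> makes the level determine the largest
    starred element; the value 0 is reserved for faces without one.\<close>
  let ?\<phi> = "\<lambda>G. if starred G = {} then 0 else Suc (Max (\<nu> ` starred G))"
  have finst: "finite (starred G)" if "G \<in> \<Gamma>" for G using chainD(2)[OF uplus_chainD(2)[OF that]] .
  show ?thesis
  proof (rule exact_below_filter[where \<phi> = ?\<phi>])
    show "oriented urk ?X" by (rule oriented_uplus)
    show "convex_family ?X" by (rule convex_family_simplicial[OF simplicial_order_complex]) auto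
    show "finite ?X" using colouredD(7)[OF coloured_uplus] by simp
    show "?\<phi> G \<le> ?\<phi> H" if "G \<in> ?X" "H \<in> ?X" "G \<subseteq> H" for G H
      using starred_mono(1)[OF that(3)] finst that by (auto intro!: Max_mono)
  next
    fix t
    show "exact_below TYPE('k) urk {G \<in> ?X. ?\<phi> G = t} n"
    proof (cases t)
      case 0
      then have "{G \<in> ?X. ?\<phi> G = t} = {G \<in> \<Gamma>. F \<subseteq> G \<and> starred G = {}}" by auto
      then show ?thesis using lev0 by simp
    next
      case (Suc s)
      show ?thesis
      proof (cases "{G \<in> ?X. ?\<phi> G = t} = {}")
        case True
        show ?thesis unfolding True by (rule exact_below_empty)
      next
        case False
        have phi: "?\<phi> G = t \<longleftrightarrow> (\<exists>z. Inr z \<in> G \<and> \<nu> z = s \<and> (\<forall>a. Inr a \<in> G \<longrightarrow> le a z))" if G: "G \<in> \<Gamma>" for G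
        proof
          assume \<phi>: "?\<phi> G = t"
          then have ne: "starred G \<noteq> {}" using Suc by (auto split: if_splits)
          then have s: "Max (\<nu> ` starred G) = s" using \<phi> Suc by simp
          have "Max (\<nu> ` starred G) \<in> \<nu> ` starred G" using ne finst[OF G] by (intro Max_in) auto
          then obtain z where z: "z \<in> starred G" "\<nu> z = s" using s by auto
          have "le a z" if "Inr a \<in> G" for a
          proof -
            have "\<nu> a \<le> \<nu> z" unfolding z(2) s[symmetric] using finst[OF G] that by (intro Max_ge) auto
            then show ?thesis using strict_mono_P_chain(3)[OF \<nu>(1) uplus_chainD(2)[OF G], of a z] z that by simp
          qed
          then show "\<exists>z. Inr z \<in> G \<and> \<nu> z = s \<and> (\<forall>a. Inr a \<in> G \<longrightarrow> le a z)" using z by auto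
        next
          assume "\<exists>z. Inr z \<in> G \<and> \<nu> z = s \<and> (\<forall>a. Inr a \<in> G \<longrightarrow> le a z)"
          then obtain z where z: "Inr z \<in> G" "\<nu> z = s" "\<And>a. Inr a \<in> G \<Longrightarrow> le a z" by blast
          have "Max (\<nu> ` starred G) = \<nu> z"
          proof (rule Max_eqI)
            fix k assume "k \<in> \<nu> ` starred G"
            then obtain a where "a \<in> starred G" "k = \<nu> a" by blast
            then show "k \<le> \<nu> z" using strict_mono_P_chain(3)[OF \<nu>(1) uplus_chainD(2)[OF G], of a z] z by simp
          qed (use finst[OF G] z in auto)
          moreover have "starred G \<noteq> {}" using z(1) by (auto simp: starred_def)
          ultimately show "?\<phi> G = t" using z(2) Suc by simp
        qed
        obtain G0 where G0: "G0 \<in> \<Gamma>" "?\<phi> G0 = t" using False by blast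
        then obtain z where z: "Inr z \<in> G0" "\<nu> z = s" using phi[OF G0(1)] by blast
        have zP: "z \<in> P" using uplus_chainD(5)[OF G0(1) z(1)] .
        have L: "{G \<in> ?X. ?\<phi> G = t} = {G \<in> \<Gamma>. F \<subseteq> G \<and> Inr z \<in> G \<and> (\<forall>a. Inr a \<in> G \<longrightarrow> le a z)}"
        proof (intro equalityI subsetI)
          fix G assume G: "G \<in> {G \<in> ?X. ?\<phi> G = t}"
          then obtain w where w: "Inr w \<in> G" "\<nu> w = s" "\<forall>a. Inr a \<in> G \<longrightarrow> le a w" using phi[of G] by blast
          have "w \<in> P" using uplus_chainD(5)[of G w] G w by auto
          then have "w = z" using inj_onD[OF \<nu>(2), of w z] w(2) z(2) zP by simp
          then show "G \<in> {G \<in> \<Gamma>. F \<subseteq> G \<and> Inr z \<in> G \<and> (\<forall>a. Inr a \<in> G \<longrightarrow> le a z)}" using G w by simp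
        next
          fix G assume G: "G \<in> {G \<in> \<Gamma>. F \<subseteq> G \<and> Inr z \<in> G \<and> (\<forall>a. Inr a \<in> G \<longrightarrow> le a z)}"
          then have "\<exists>z. Inr z \<in> G \<and> \<nu> z = s \<and> (\<forall>a. Inr a \<in> G \<longrightarrow> le a z)" using z(2) by blast
          then show "G \<in> {G \<in> ?X. ?\<phi> G = t}" using phi[of G] G by simp
        qed
        show ?thesis
        proof (cases "Inl z \<in> F")
          case True
          then show ?thesis unfolding L by (rule lev)
        next
          case F: False
          show ?thesis unfolding L
          proof (rule exact_below_toggle[where u = "Inl z", OF oriented_uplus])
            fix G assume G: "G \<in> {G \<in> \<Gamma>. F \<subseteq> G \<and> Inr z \<in> G \<and> (\<forall>a. Inr a \<in> G \<longrightarrow> le a z)}"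
            then show "insert (Inl z) G \<in> {G \<in> \<Gamma>. F \<subseteq> G \<and> Inr z \<in> G \<and> (\<forall>a. Inr a \<in> G \<longrightarrow> le a z)}"
              using insert_unstarred_max[of G z] by auto
            show "G - {Inl z} \<in> {G \<in> \<Gamma>. F \<subseteq> G \<and> Inr z \<in> G \<and> (\<forall>a. Inr a \<in> G \<longrightarrow> le a z)}"
              using G F simplicialD[OF simplicial_order_complex, of G _ _ "G - {Inl z}"] by auto
          qed
        qed
      qed
    qed
  qed
qed

text \<open>The smallest unstarred element of a face over \<open>F\<close> is below
  \<open>y\<close>, hence in \<open>Q\<close>, and its starred copy is not forced by
  \<open>F\<close>. It can always be toggled, so the whole star is acyclic.\<close>

lemma exact_filter_min_unstarred:
  assumes y: "Inl y \<in> F" "y \<in> Q" and st: "starred F = {}"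
  shows "exact_below TYPE('k::field) urk {G \<in> \<Gamma>. F \<subseteq> G} n"
proof -
  obtain \<nu> where \<nu>: "strict_mono_P \<nu>" "inj_on \<nu> P" using linear_extension_exists by blast
  \<comment> \<open>The minimum decreases as the face grows, while a filtration has to increase;
    subtracting from an upper bound of \<open>\<nu>\<close> keeps the levels apart in spite of
    truncation.\<close>
  define N where "N = Max (\<nu> ` P)"
  have N: "\<nu> x \<le> N" if "x \<in> P" for x unfolding N_def using fin that by (intro Max_ge) auto
  let ?X = "{G \<in> \<Gamma>. F \<subseteq> G}"
  let ?\<phi> = "\<lambda>G. N - Min (\<nu> ` unstarred G)"
  have finun: "finite (unstarred G)" if "G \<in> \<Gamma>" for G using chainD(2)[OF uplus_chainD(3)[OF that]] .
  have yG: "y \<in> unstarred G" if "G \<in> ?X" for G using y that by auto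
  show ?thesis
  proof (rule exact_below_filter[where \<phi> = ?\<phi>])
    show "oriented urk ?X" by (rule oriented_uplus)
    show "convex_family ?X" by (rule convex_family_simplicial[OF simplicial_order_complex]) auto
    show "finite ?X" using colouredD(7)[OF coloured_uplus] by simp
    show "?\<phi> G \<le> ?\<phi> H" if "G \<in> ?X" "H \<in> ?X" "G \<subseteq> H" for G H
    proof -
      have "Min (\<nu> ` unstarred H) \<le> Min (\<nu> ` unstarred G)"
        using starred_mono(2)[OF that(3)] finun[of H] yG[OF that(1)] that(2) by (intro Min_antimono) auto
      then show ?thesis by simp
    qed
  next
    fix t
    show "exact_below TYPE('k) urk {G \<in> ?X. ?\<phi> G = t} n"
    proof (cases "{G \<in> ?X. ?\<phi> G = t} = {}")
      case True
      show ?thesis unfolding True by (rule exact_below_empty)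
    next
      case False
      have min: "\<exists>u. Inl u \<in> G \<and> \<nu> u = Min (\<nu> ` unstarred G) \<and> (\<forall>b. Inl b \<in> G \<longrightarrow> le u b)" if G: "G \<in> ?X" for G
      proof -
        have "Min (\<nu> ` unstarred G) \<in> \<nu> ` unstarred G" using yG[OF G] finun G by (intro Min_in) auto
        then obtain u where u: "u \<in> unstarred G" "\<nu> u = Min (\<nu> ` unstarred G)" by auto
        have "le u b" if "Inl b \<in> G" for b
        proof -
          have "\<nu> u \<le> \<nu> b" unfolding u(2) using finun[of G] G that by (intro Min_le) auto
          then show ?thesis using strict_mono_P_chain(3)[OF \<nu>(1) uplus_chainD(3)[of G], of u b] u that G by simp
        qed
        then show ?thesis using u by auto
      qed
      obtain G0 where G0: "G0 \<in> ?X" "?\<phi> G0 = t" using False by blast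
      obtain u where u: "Inl u \<in> G0" "\<nu> u = Min (\<nu> ` unstarred G0)" "\<And>b. Inl b \<in> G0 \<Longrightarrow> le u b"
        using min[OF G0(1)] by blast
      have uP: "u \<in> P" using uplus_chainD(6)[of G0 u] G0 u by auto
      have uQ: "u \<in> Q" using Q_down[OF y(2) uP] u(3)[of y] yG[OF G0(1)] by simp
      have L: "{G \<in> ?X. ?\<phi> G = t} = {G \<in> \<Gamma>. F \<subseteq> G \<and> Inl u \<in> G \<and> (\<forall>b. Inl b \<in> G \<longrightarrow> le u b)}"
      proof (intro equalityI subsetI)
        fix G assume G: "G \<in> {G \<in> ?X. ?\<phi> G = t}"
        then obtain w where w: "Inl w \<in> G" "\<nu> w = Min (\<nu> ` unstarred G)" "\<forall>b. Inl b \<in> G \<longrightarrow> le w b" using min[of G] by blast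
        have wP: "w \<in> P" using uplus_chainD(6)[of G w] G w by auto
        have "N - \<nu> w = N - \<nu> u" using G G0(2) w(2) u(2) by simp
        then have "\<nu> w = \<nu> u" using N[OF wP] N[OF uP] by simp
        then have "w = u" using inj_onD[OF \<nu>(2), of w u] wP uP by simp
        then show "G \<in> {G \<in> \<Gamma>. F \<subseteq> G \<and> Inl u \<in> G \<and> (\<forall>b. Inl b \<in> G \<longrightarrow> le u b)}" using G w by simp
      next
        fix G assume G: "G \<in> {G \<in> \<Gamma>. F \<subseteq> G \<and> Inl u \<in> G \<and> (\<forall>b. Inl b \<in> G \<longrightarrow> le u b)}"
        have "Min (\<nu> ` unstarred G) = \<nu> u"
        proof (rule Min_eqI)
          fix k assume "k \<in> \<nu> ` unstarred G"
          then obtain b where "b \<in> unstarred G" "k = \<nu> b" by blast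
          then show "\<nu> u \<le> k" using strict_mono_P_chain(3)[OF \<nu>(1) uplus_chainD(3)[of G], of u b] G by simp
        qed (use finun[of G] G in auto)
        then show "G \<in> {G \<in> ?X. ?\<phi> G = t}" using G G0(2) u(2) by simp
      qed
      show ?thesis unfolding L
      proof (rule exact_below_toggle[where u = "Inr u", OF oriented_uplus])
        fix G assume G: "G \<in> {G \<in> \<Gamma>. F \<subseteq> G \<and> Inl u \<in> G \<and> (\<forall>b. Inl b \<in> G \<longrightarrow> le u b)}"
        then show "insert (Inr u) G \<in> {G \<in> \<Gamma>. F \<subseteq> G \<and> Inl u \<in> G \<and> (\<forall>b. Inl b \<in> G \<longrightarrow> le u b)}"
          using insert_starred_min[of G u] uQ by auto
        have "Inr u \<notin> F" using st starred_simps(1)[of u F] by simp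
        then show "G - {Inr u} \<in> {G \<in> \<Gamma>. F \<subseteq> G \<and> Inl u \<in> G \<and> (\<forall>b. Inl b \<in> G \<longrightarrow> le u b)}"
          using G simplicialD[OF simplicial_order_complex, of G _ _ "G - {Inr u}"] by auto
      qed
    qed
  qed
qed

end

context finite_poset_ideal
begin

text \<open>These faces are chains of \<open>P\<close>, and raising all ranks by one leaves the
  signs unchanged.\<close>

lemma exact_unstarred_level:
  assumes F: "F \<in> \<Gamma>" "starred F = {}"
    and ex: "exact_below TYPE('k::field) rk {H \<in> \<Delta>. unstarred F \<subseteq> H} n"
  shows "exact_below TYPE('k) urk {G \<in> \<Gamma>. F \<subseteq> G \<and> starred G = {}} n"
proof -
  let ?X = "{H \<in> \<Delta>. unstarred F \<subseteq> H}" and ?W = "{G \<in> \<Gamma>. F \<subseteq> G \<and> starred G = {}}"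
  have st: "starred (Inl ` H) = {}" and un: "unstarred (Inl ` H) = H" for H :: "'a set"
    by (auto simp: starred_def unstarred_def)
  have eq: "G = Inl ` unstarred G" if "starred G = {}" for G :: "('a + 'a) set"
  proof (rule set_eqI)
    fix a show "a \<in> G \<longleftrightarrow> a \<in> Inl ` unstarred G"
      using that by (cases a) (auto simp: starred_def)
  qed
  define g :: "'a set \<Rightarrow> ('a + 'a) set" where "g H = Inl ` H" for H
  have g_in: "Inl v \<in> g H \<longleftrightarrow> v \<in> H" "Inr v \<notin> g H" for v H by (auto simp: g_def)
  have g_iff: "g H \<in> ?W \<longleftrightarrow> H \<in> ?X" for H
  proof -
    have "F \<subseteq> g H \<longleftrightarrow> unstarred F \<subseteq> H" using eq[OF F(2)] unfolding g_def by blast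
    moreover have "g H \<in> \<Gamma> \<longleftrightarrow> H \<in> \<Delta>"
      using simplicial_chains unfolding uplus_chain_iff g_def by (simp add: st un simplicial_def)
    ultimately show ?thesis using st[of H] by (simp add: g_def)
  qed
  have W: "?W = g ` ?X"
  proof (intro equalityI subsetI)
    fix G assume G: "G \<in> ?W"
    then have "G = g (unstarred G)" using eq[of G] by (simp add: g_def)
    then show "G \<in> g ` ?X" using g_iff[of "unstarred G"] G by (metis image_eqI)
  next
    fix G assume "G \<in> g ` ?X"
    then show "G \<in> ?W" using g_iff by blast
  qed
  have "exact_below TYPE('k) urk ?W (n + 0)"
  proof (rule exact_below_transfer[OF ex W, where \<tau> = Inl and e = "\<lambda>_. 1"])
    show "inj_on g ?X" unfolding g_def by (rule inj_onI) (simp add: inj_image_eq_iff)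
    fix H assume H: "H \<in> ?X"
    show "card (g H) = card H + 0" by (simp add: g_def card_image)
    show "inj_on Inl H" by simp
    have rm: "g H - {Inl v} = g (H - {v})" for v by (auto simp: g_def)
    show "{v'. v' \<in> g H \<and> g H - {v'} \<in> ?W} = Inl ` {v. v \<in> H \<and> H - {v} \<in> ?X}"
    proof (rule set_eqI)
      fix a show "a \<in> {v'. v' \<in> g H \<and> g H - {v'} \<in> ?W} \<longleftrightarrow> a \<in> Inl ` {v. v \<in> H \<and> H - {v} \<in> ?X}"
      proof (cases a)
        case (Inl v)
        have "Inl v \<in> {v'. v' \<in> g H \<and> g H - {v'} \<in> ?W} \<longleftrightarrow> v \<in> H \<and> g (H - {v}) \<in> ?W"
          by (simp only: mem_Collect_eq g_in rm)
        then show ?thesis unfolding Inl g_iff by auto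
      next
        case (Inr v)
        then show ?thesis using g_in(2)[of v H] by blast
      qed
    qed
    fix v assume v: "v \<in> H"
    show "g H - {Inl v} = g (H - {v})" by (rule rm)
    have "{w \<in> g H. urk w < urk (Inl v)} = Inl ` {w \<in> H. rk w < rk v}" by (auto simp: g_def)
    then show "osgn urk (Inl v) (g H) = 1 * osgn rk v H * (1::'k)" by (simp add: osgn_def card_image)
  qed simp
  then show ?thesis by simp
qed

text \<open>If \<open>y\<close> and \<open>y\<^sup>*\<close> both lie in \<open>G\<close>, forgetting the stars turns \<open>G\<close> into a chain of \<open>P\<close> through \<open>y\<close> with one
  element less.\<close>

lemma exact_middle_level:
  assumes y: "Inl y \<in> F"
    and ex: "\<And>K. K \<in> \<Delta> \<Longrightarrow> exact_below TYPE('k::field) rk {H \<in> \<Delta>. K \<subseteq> H} n"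
  shows "exact_below TYPE('k) urk {G \<in> \<Gamma>. F \<subseteq> G \<and> Inr y \<in> G \<and> (\<forall>a. Inr a \<in> G \<longrightarrow> le a y)} (Suc n)"
    (is "exact_below _ _ ?W _")
proof (cases "?W = {}")
  case True
  show ?thesis unfolding True by (rule exact_below_empty)
next
  case False
  then obtain G0 where G0: "G0 \<in> \<Gamma>" "F \<subseteq> G0" "Inr y \<in> G0" "\<And>a. Inr a \<in> G0 \<Longrightarrow> le a y" by blast
  note D0 = uplus_chainD[OF G0(1)]
  have yP: "y \<in> P" and yQ: "y \<in> Q" using D0(5)[OF G0(3)] D0(1) G0(3) starred_simps(1)[of y G0] by blast+
  define K where "K = starred F \<union> unstarred F"
  have Flo: "le x y" "x \<in> P" if "Inr x \<in> F" for x using G0(2,4) D0(5)[of x] that by auto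
  have Fhi: "le y x" "x \<in> P" if "Inl x \<in> F" for x using D0(4)[OF G0(3), of x] D0(6)[of x] G0(2) that by auto
  have join: "A \<union> B \<in> \<Delta>" if "A \<in> \<Delta>" "B \<in> \<Delta>" "\<And>a. a \<in> A \<Longrightarrow> le a y" "\<And>b. b \<in> B \<Longrightarrow> le y b" for A B
  proof -
    have "le a b" if "a \<in> A" "b \<in> B" for a b
      using trans[of a y b] \<open>A \<in> \<Delta>\<close> \<open>B \<in> \<Delta>\<close> chainD(1) yP that \<open>\<And>a. a \<in> A \<Longrightarrow> le a y\<close> \<open>\<And>b. b \<in> B \<Longrightarrow> le y b\<close> by blast
    then show ?thesis using that(1,2) unfolding chain_iff by blast
  qed
  have "starred F \<in> \<Delta>" "unstarred F \<in> \<Delta>"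
    using simplicialD[OF simplicial_chains D0(2)] simplicialD[OF simplicial_chains D0(3)] starred_mono[OF G0(2)] by auto
  then have K\<Delta>: "K \<in> \<Delta>" unfolding K_def using Flo(1) Fhi(1) by (intro join) auto
  have yK: "y \<in> K" using y by (simp add: K_def)
  let ?X = "{H \<in> \<Delta>. K \<subseteq> H}"
  \<comment> \<open>Inverse to forgetting stars: elements up to \<open>y\<close> are starred, those
    from \<open>y\<close> on are not, and \<open>y\<close> itself is doubled.\<close>
  define f where "f H = Inr ` {h \<in> H. le h y} \<union> Inl ` {h \<in> H. le y h}" for H
  define \<tau> where "\<tau> v = (if le v y then Inr v else Inl v)" for v
  \<comment> \<open>The second copy of \<open>y\<close> adds one predecessor to every vertex above
    \<open>y\<close> and none to those below, which flips the signs of the former; \<open>e\<close>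
    compensates for this.\<close>
  define e :: "'a set \<Rightarrow> 'k" where "e H = (-1) ^ card {h \<in> H. \<not> le h y}" for H
  have f_st: "starred (f H) = {h \<in> H. le h y}" and f_un: "unstarred (f H) = {h \<in> H. le y h}" for H
    by (auto simp: f_def starred_def unstarred_def)
  have f_in: "Inr h \<in> f H \<longleftrightarrow> h \<in> H \<and> le h y" "Inl h \<in> f H \<longleftrightarrow> h \<in> H \<and> le y h" for h H
    by (auto simp: f_def)
  have cmp: "le h y \<or> le y h" "h \<in> P" if "H \<in> \<Delta>" "y \<in> H" "h \<in> H" for h H
    using chainD(3)[OF that(1,3,2)] chainD(1)[OF that(1)] that by auto
  have eqy: "h = y" if "le h y" "le y h" "h \<in> P" for h using antisym[OF that(3) yP that(1,2)] .
  have split: "{h \<in> H. le h y} \<union> {h \<in> H. le y h} = H" "{h \<in> H. le h y} \<inter> {h \<in> H. le y h} = {y}"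
    if "H \<in> \<Delta>" "y \<in> H" for H
    using cmp[OF that] eqy refl[OF yP] that(2) by blast+
  have card_f: "card (f H) = Suc (card H)" if "H \<in> \<Delta>" "y \<in> H" for H
  proof -
    have fin: "finite H" using chainD(2) that by auto
    have "card (f H) = card {h \<in> H. le h y} + card {h \<in> H. le y h}"
      unfolding f_def using fin by (subst card_Un_disjoint) (auto simp: card_image)
    also have "\<dots> = card H + card {y}"
      using card_Un_Int[of "{h \<in> H. le h y}" "{h \<in> H. le y h}"] split[OF that] fin by simp
    finally show ?thesis by simp
  qed
  have X: "H \<in> \<Delta>" "y \<in> H" "K \<subseteq> H" if "H \<in> ?X" for H using that yK by auto
  have f\<Gamma>: "f H \<in> ?W" if H: "H \<in> ?X" for H
  proof -
    have sub: "{h \<in> H. le h y} \<in> \<Delta>" "{h \<in> H. le y h} \<in> \<Delta>" using simplicialD[OF simplicial_chains X(1)[OF H]] by auto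
    have "{h \<in> H. le h y} \<subseteq> Q" using Q_down[OF yQ] cmp(2)[OF X(1,2)[OF H]] by auto
    moreover have "le a b" if "a \<in> H" "le a y" "b \<in> H" "le y b" for a b
      using trans[of a y b] cmp(2)[OF X(1,2)[OF H]] that yP by blast
    ultimately have "f H \<in> \<Gamma>" unfolding uplus_chain_iff f_st f_un using sub by auto
    moreover have "F \<subseteq> f H"
    proof
      fix a assume a: "a \<in> F"
      show "a \<in> f H"
      proof (cases a)
        case (Inl x)
        then have "x \<in> K" using a by (simp add: K_def)
        then show ?thesis using X(3)[OF H] Fhi(1)[of x] a Inl by (auto simp: f_in)
      next
        case (Inr x)
        then have "x \<in> K" using a by (simp add: K_def)
        then show ?thesis using X(3)[OF H] Flo(1)[of x] a Inr by (auto simp: f_in)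
      qed
    qed
    ultimately show ?thesis using X(2)[OF H] refl[OF yP] by (auto simp: f_in)
  qed
  have W: "?W = f ` ?X"
  proof (intro equalityI subsetI)
    fix G assume G: "G \<in> ?W"
    then have G': "G \<in> \<Gamma>" "F \<subseteq> G" "Inr y \<in> G" "Inl y \<in> G" "\<And>a. Inr a \<in> G \<Longrightarrow> le a y" using y by auto
    note D = uplus_chainD[OF G'(1)]
    let ?H = "starred G \<union> unstarred G"
    have "?H \<in> \<Delta>" using D G' by (intro join) auto
    moreover have "K \<subseteq> ?H" using starred_mono[OF G'(2)] by (auto simp: K_def)
    moreover have "f ?H = G"
    proof (rule set_eqI)
      fix a show "a \<in> f ?H \<longleftrightarrow> a \<in> G"
      proof (cases a)
        case (Inl x)
        have "Inr x \<in> G \<Longrightarrow> le y x \<Longrightarrow> x = y" using G'(5) D(5) eqy by blast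
        then show ?thesis using Inl D(4)[OF G'(3)] G'(4) by (auto simp: f_in)
      next
        case (Inr x)
        have "Inl x \<in> G \<Longrightarrow> le x y \<Longrightarrow> x = y" using D(4)[OF G'(3)] D(6) eqy by blast
        then show ?thesis using Inr G'(3,5) by (auto simp: f_in)
      qed
    qed
    ultimately show "G \<in> f ` ?X" by blast
  next
    fix G assume "G \<in> f ` ?X"
    then show "G \<in> ?W" using f\<Gamma> by blast
  qed
  have "exact_below TYPE('k) urk ?W (n + 1)"
  proof (rule exact_below_transfer[OF ex[OF K\<Delta>] W, where \<tau> = \<tau> and e = e])
    show "inj_on f ?X"
    proof (rule inj_onI)
      fix H H' assume H: "H \<in> ?X" "H' \<in> ?X" "f H = f H'"
      have rec: "starred (f H) \<union> unstarred (f H) = H" if "H \<in> ?X" for H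
        unfolding f_st f_un using split(1)[OF X(1,2)[OF that]] .
      have "H = starred (f H) \<union> unstarred (f H)" by (rule rec[OF H(1), symmetric])
      also have "\<dots> = starred (f H') \<union> unstarred (f H')" by (simp only: H(3))
      also have "\<dots> = H'" by (rule rec[OF H(2)])
      finally show "H = H'" .
    qed
    show "e H * e H = 1" for H by (simp add: e_def flip: power_mult_distrib)
    fix H assume H: "H \<in> ?X"
    note HX = X[OF H]
    show "card (f H) = card H + 1" using card_f[OF HX(1,2)] by simp
    show "inj_on \<tau> H" by (auto simp: inj_on_def \<tau>_def split: if_splits)
    have low: "H - {v} \<in> ?X \<longleftrightarrow> v \<notin> K" for v
      using HX simplicialD[OF simplicial_chains HX(1), of "H - {v}"] by auto
    have fW: "f H \<in> ?W" by (rule f\<Gamma>[OF H])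
    have lowW: "f H - {v'} \<in> ?W \<longleftrightarrow> v' \<notin> F \<and> v' \<noteq> Inr y" for v'
      using fW simplicialD[OF simplicial_order_complex, of "f H" _ _ "f H - {v'}"] by auto
    show "{v'. v' \<in> f H \<and> f H - {v'} \<in> ?W} = \<tau> ` {v. v \<in> H \<and> H - {v} \<in> ?X}"
      unfolding low lowW
    proof (intro equalityI subsetI)
      fix a assume a: "a \<in> {v'. v' \<in> f H \<and> v' \<notin> F \<and> v' \<noteq> Inr y}"
      show "a \<in> \<tau> ` {v. v \<in> H \<and> v \<notin> K}"
      proof (cases a)
        case (Inl h)
        have h: "h \<in> H" "le y h" "h \<noteq> y" "h \<in> P" using a Inl y cmp(2)[OF HX(1,2)] by (auto simp: f_in)
        then have "\<not> le h y" using eqy by blast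
        moreover from this have "h \<notin> K" using Flo(1)[of h] a Inl by (auto simp: K_def)
        ultimately show ?thesis using h Inl by (intro image_eqI[of _ _ h]) (auto simp: \<tau>_def)
      next
        case (Inr h)
        have h: "h \<in> H" "le h y" "h \<noteq> y" "h \<in> P" using a Inr cmp(2)[OF HX(1,2)] by (auto simp: f_in)
        then have "\<not> le y h" using eqy by blast
        then have "h \<notin> K" using Fhi(1)[of h] a Inr by (auto simp: K_def)
        then show ?thesis using h Inr by (intro image_eqI[of _ _ h]) (auto simp: \<tau>_def)
      qed
    next
      fix a assume "a \<in> \<tau> ` {v. v \<in> H \<and> v \<notin> K}"
      then obtain v where v: "a = \<tau> v" "v \<in> H" "v \<notin> K" by blast
      have "v \<noteq> y" using v yK by auto
      then show "a \<in> {v'. v' \<in> f H \<and> v' \<notin> F \<and> v' \<noteq> Inr y}"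
        using v cmp(1)[OF HX(1,2) v(2)] by (auto simp: \<tau>_def f_in K_def)
    qed
    fix v assume v: "v \<in> H" "H - {v} \<in> ?X"
    have vK: "v \<notin> K" using v low by blast
    then have vy: "v \<noteq> y" using yK by auto
    have vP: "v \<in> P" using cmp(2)[OF HX(1,2) v(1)] .
    have not_both: "\<not> (le v y \<and> le y v)" using eqy vP vy by blast
    show "f H - {\<tau> v} = f (H - {v})"
    proof (rule set_eqI)
      fix a show "a \<in> f H - {\<tau> v} \<longleftrightarrow> a \<in> f (H - {v})"
        using not_both cmp(1)[OF HX(1,2) v(1)] by (cases a) (auto simp: f_in \<tau>_def)
    qed
    note rk = strict_mono_P_chain[OF strict_mono_rk HX(1)]
    have finH: "finite H" using chainD(2)[OF HX(1)] .
    show "osgn urk (\<tau> v) (f H) = e H * osgn rk v H * e (H - {v})"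
    proof (cases "le v y")
      case True
      have vlt: "rk v < rk y" using rk(1)[OF v(1) HX(2)] True vy by (simp add: strict_def)
      have "{w \<in> f H. urk w < urk (\<tau> v)} = Inr ` {h \<in> H. rk h < rk v}"
      proof (rule set_eqI)
        fix a show "a \<in> {w \<in> f H. urk w < urk (\<tau> v)} \<longleftrightarrow> a \<in> Inr ` {h \<in> H. rk h < rk v}"
        proof (cases a)
          case (Inl h)
          have "\<not> (h \<in> H \<and> le y h \<and> Suc (rk h) < rk v)" using rk(3)[OF HX(2), of h] vlt by auto
          then show ?thesis using Inl True by (auto simp: f_in \<tau>_def)
        next
          case (Inr h)
          have "h \<in> H \<Longrightarrow> rk h < rk v \<Longrightarrow> le h y" using rk(3)[OF _ HX(2), of h] vlt by auto
          then show ?thesis using Inr True by (auto simp: f_in \<tau>_def)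
        qed
      qed
      then have "osgn urk (\<tau> v) (f H) = (osgn rk v H :: 'k)" by (simp add: osgn_def card_image)
      moreover have "{h \<in> H - {v}. \<not> le h y} = {h \<in> H. \<not> le h y}" using True by auto
      then have "e (H - {v}) = e H" by (simp add: e_def)
      moreover have "e H * e H = 1" by (simp add: e_def flip: power_mult_distrib)
      ultimately show ?thesis by (simp add: mult.commute mult.left_commute)
    next
      case False
      then have "le y v" using cmp(1)[OF HX(1,2) v(1)] by simp
      then have vgt: "rk y < rk v" using rk(1)[OF HX(2) v(1)] vy by (simp add: strict_def)
      let ?L = "{h \<in> H. rk h < rk v}"
      have "{w \<in> f H. urk w < urk (\<tau> v)} = f ?L"
      proof (rule set_eqI)
        fix a show "a \<in> {w \<in> f H. urk w < urk (\<tau> v)} \<longleftrightarrow> a \<in> f ?L"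
        proof (cases a)
          case (Inl h)
          then show ?thesis using False by (auto simp: f_in \<tau>_def)
        next
          case (Inr h)
          have "h \<in> H \<Longrightarrow> le h y \<Longrightarrow> rk h < rk v" using rk(3)[OF _ HX(2), of h] vgt by auto
          then show ?thesis using Inr False by (auto simp: f_in \<tau>_def)
        qed
      qed
      moreover have "?L \<in> \<Delta>" "y \<in> ?L" using simplicialD[OF simplicial_chains HX(1), of ?L] vgt HX(2) by auto
      ultimately have "card {w \<in> f H. urk w < urk (\<tau> v)} = Suc (card ?L)" using card_f[of ?L] by simp
      then have o: "osgn urk (\<tau> v) (f H) = - (osgn rk v H :: 'k)" by (simp add: osgn_def)
      have "{h \<in> H. \<not> le h y} = insert v {h \<in> H - {v}. \<not> le h y}" using False v(1) by auto
      then have "card {h \<in> H. \<not> le h y} = Suc (card {h \<in> H - {v}. \<not> le h y})" using finH by simp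
      then have "e H = - e (H - {v})" by (simp add: e_def)
      moreover have "e (H - {v}) * e (H - {v}) = 1" by (simp add: e_def flip: power_mult_distrib)
      ultimately show ?thesis using o by (simp add: mult.commute mult.left_commute)
    qed
  qed
  then show ?thesis by simp
qed

text \<open>If \<open>F\<close> has no star but meets \<open>Q\<close>, its star is acyclic.
  Otherwise filter by the largest starred element: the levels not paired off gain a degree from the
  doubled element. The level without stars is empty if \<open>F\<close> has stars; if not,
  \<open>F\<close> lies over \<open>P - Q\<close>, and the Euler characteristic hypothesis at its
  minimum, or for all of \<open>P\<close>, supplies the extra degree.\<close>

lemma exact_star_uplus:
  assumes ex: "\<And>K. K \<in> \<Delta> \<Longrightarrow> exact_below TYPE('k::field) rk {H \<in> \<Delta>. K \<subseteq> H} height"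
    and \<chi>: "\<forall>x\<in>P - Q. red_euler_char (below P le x) le = 0" "red_euler_char P le = 0"
    and F: "F \<in> \<Gamma>"
  shows "exact_below TYPE('k) urk {G \<in> \<Gamma>. F \<subseteq> G} (Suc height)"
proof (cases "starred F = {} \<and> unstarred F \<inter> Q \<noteq> {}")
  case True
  then obtain y where "Inl y \<in> F" "y \<in> Q" by auto
  then show ?thesis using True by (intro exact_filter_min_unstarred) auto
next
  case False
  have "exact_below TYPE('k) urk {G \<in> \<Gamma>. F \<subseteq> G \<and> starred G = {}} (Suc height)"
  proof (cases "starred F = {}")
    case st: True
    let ?B = "unstarred F"
    have B: "?B \<in> \<Delta>" "?B \<inter> Q = {}" using uplus_chainD(3)[OF F] False st by auto
    have "exact_below TYPE('k) rk {H \<in> \<Delta>. ?B \<subseteq> H} (Suc height)"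
    proof (rule exact_below_of_euler_char_zero[OF _ _ _ ex[OF B(1)]])
      show "oriented rk {H \<in> \<Delta>. ?B \<subseteq> H}"
        using chainD(2) strict_mono_P_inj_on[OF strict_mono_rk] by (simp add: oriented_def)
      show "convex_family {H \<in> \<Delta>. ?B \<subseteq> H}" by (rule convex_family_simplicial[OF simplicial_chains]) auto
      show "finite {H \<in> \<Delta>. ?B \<subseteq> H}" using finite_chains by simp
      show "card G \<le> height" if "G \<in> {H \<in> \<Delta>. ?B \<subseteq> H}" for G using card_chain_le that by simp
      show "(\<Sum>G\<in>{H \<in> \<Delta>. ?B \<subseteq> H}. (-1) ^ card G) = (0::int)"
      proof (cases "?B = {}")
        case True
        then show ?thesis using \<chi>(2) B(1) by (intro star_euler_char_zero[of _ undefined]) auto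
      next
        case False
        obtain y where y: "y \<in> ?B" "\<And>c. c \<in> ?B \<Longrightarrow> le y c" using chain_has_min[OF B(1) False] by blast
        then have "y \<in> P - Q" using B chainD(1) by blast
        then show ?thesis using y B(1) \<chi>(1) False by (intro star_euler_char_zero[of _ y]) auto
      qed
    qed
    then show ?thesis by (rule exact_unstarred_level[OF F st])
  next
    case False
    then have "{G \<in> \<Gamma>. F \<subseteq> G \<and> starred G = {}} = {}" using starred_mono(1)[of F] by blast
    then show ?thesis using exact_below_empty by metis
  qed
  then show ?thesis by (rule exact_filter_max_starred) (rule exact_middle_level[OF _ ex])
qed

end

theorem theorem6p3:
  fixes P Q :: "'a set" and le :: "'a \<Rightarrow> 'a \<Rightarrow> bool"
  assumes "finite P"
    and "partial_order_on' P le"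
    and "cohen_macaulay_poset TYPE('k::field) P le"
    and "poset_ideal P le Q"
    and "\<forall>x \<in> P - Q. red_euler_char (below P le x) le = 0"
    and "red_euler_char P le = 0"
  shows "cohen_macaulay_poset TYPE('k) (uplus_carrier P Q) (uplus_le le Q)"
proof -
  interpret finite_poset_ideal P le Q
    by unfold_locales (use assms in auto)
  obtain \<nu> where \<nu>: "strict_mono_P \<nu>" "inj_on \<nu> P" using linear_extension_exists by blast
  obtain K where K: "K \<in> \<Delta>" "card K = height" using height_attained by blast
  \<comment> \<open>The Koszul complex needs an order injective on all of \<open>P\<close>, the
    colouring needs ranks. Both induce the same order on each chain, so the signs agree.\<close>
  have ex: "exact_below TYPE('k) rk {H \<in> \<Delta>. F \<subseteq> H} height" if F: "F \<in> \<Delta>" for F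
  proof (rule exact_below_osgn_cong)
    show "exact_below TYPE('k) \<nu> {H \<in> \<Delta>. F \<subseteq> H} height"
      using assms(3) F unfolding cohen_macaulay_poset_def
      by (intro exact_star_of_cohen_macaulay[OF _ simplicial_chains fin chainD(1) \<nu>(2) K]) auto
    show "osgn rk v G = osgn \<nu> v G" if "G \<in> {H \<in> \<Delta>. F \<subseteq> H}" "v \<in> G" for G v
      using that by (intro strict_mono_P_osgn[OF strict_mono_rk \<nu>(1)]) auto
  qed
  let ?I = "SR_ideal \<Gamma> :: ('a + 'a, 'k) mpoly set"
  note col = coloured_uplus
  have "enat (Suc height) \<le> depth_quot ?I var_ideal"
    using exact_star_uplus[OF ex assms(5,6)] by (intro depth_quot_ge_of_exact[OF col])
  moreover have "krull_dim_quot ?I \<le> enat (Suc height)"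
  proof (rule krull_dim_quot_SR_ideal_le[OF colouredD(2,1)[OF col]])
    fix G assume G: "G \<in> \<Gamma>"
    have "urk ` G \<subseteq> {..<Suc height}" using colouredD(3)[OF col G] colouredD(6)[OF col] by auto
    then have "card (urk ` G) \<le> Suc height" using card_mono[of "{..<Suc height}"] by fastforce
    then show "G \<subseteq> uplus_carrier P Q \<and> card G \<le> Suc height"
      using colouredD(3)[OF col G] card_image[OF colouredD(4)[OF col G]] by simp
  qed
  moreover have "depth_quot ?I var_ideal \<le> krull_dim_quot ?I" by (rule depth_quot_le_krull_dim_quot)
  ultimately show ?thesis
    unfolding cohen_macaulay_poset_def SR_cohen_macaulay_def by (metis order_antisym order_trans)
qed

end
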